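(* Let $p$ and $q$ be monic polynomials with degree $2$ of $\mathbb{F}[t]$. Assume that $p$ is irreducible over $\mathbb{F}$ and that $q$ splits over $\mathbb{F}$ with distinct roots $y_1$ and $y_2$. Assume furthermore that if $\mathbb{F}$ has characteristic $2$ then $\operatorname{tr}(p)\neq\operatorname{tr}(q)$. Let $u$ be an endomorphism of a finite-dimensional vector space $V$ over $\mathbb{F}$. The following conditions are then equivalent: (i) $u$ is a d-exceptional $(p,q)$-difference. (ii) The irreducible monic divisors of the minimal polynomial of $u$ belong to $\bigl\{p(t+y_1),p(t+y_2)\bigr\}$. Moreover, in writing the invariant factors of $u$ as $r_1=p(t+y_1)^{\alpha_1}p(t+y_2)^{\beta_1},\dots,r_k=p(t+y_1)^{\alpha_k}p(t+y_2)^{\beta_k},\dots$, we have $|\alpha_k-\beta_k|\leq 1$ for all $k\geq 1$. (iii) In some basis of $V$, the endomorphism $u$ is represented by a block-diagonal matrix in which every diagonal block equals $C\bigl(p(t+y_1)^n\bigr)\oplus C\bigl(p(t+y_2)^n\bigr)$, $C\bigl(p(t+y_1)^n\bigr)\oplus C\bigl(p(t+y_2)^{n-1}\bigr)$ or $C\bigl(p(t+y_1)^{n-1}\bigr)\oplus C\bigl(p(t+y_2)^n\bigr)$ for some positive integer $n$.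
   Context: $\mathbb{F}$ is an arbitrary field with algebraic closure $\overline{\mathbb{F}}$. For a monic polynomial $p$ of degree $n\ge 1$, $\operatorname{tr}(p)$ is the opposite of the coefficient of $p$ on $t^{n-1}$, and $\operatorname{Root}(p)$ is its set of roots in $\overline{\mathbb{F}}$. An endomorphism $u$ of $V$ is a $(p,q)$-difference if $u=a-b$ for some endomorphisms $a,b$ of $V$ with $p(a)=0$ and $q(b)=0$. It is d-exceptional with respect to $(p,q)$ if all its eigenvalues in $\overline{\mathbb{F}}$ belong to $\operatorname{Root}(p)-\operatorname{Root}(q)=\{x-y: x\in\operatorname{Root}(p),\,y\in\operatorname{Root}(q)\}$; a d-exceptional $(p,q)$-difference is a $(p,q)$-difference that is d-exceptional with respect to $(p,q)$. $C(r)$ is the companion matrix of the monic polynomial $r$ ($C(1)$ is the $0\times0$ matrix), and $\oplus$ is block-diagonal sum. The invariant factors of $u$ are the monic polynomials $r_1,r_2,\dots$ with $r_{i+1}\mid r_i$ such that $u$ is represented in some basis by $C(r_1)\oplus C(r_2)\oplus\cdots$; the finite list of nonconstant ones is extended to an infinite sequence by $r_i=1$. *)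

theory Defs
  imports "HOL-Algebra.Algebraic_Closure_Type" "Jordan_Normal_Form.Char_Poly"
begin

definition poly_trace :: "'a::field poly \<Rightarrow> 'a" where
  "poly_trace p = - Polynomial.coeff p (Polynomial.degree p - 1)"

definition ac_roots :: "'a::field poly \<Rightarrow> 'a alg_closure set" where
  "ac_roots p = {x. poly (map_poly to_ac p) x = 0}"

text \<open>Convention: ones below the diagonal, and minus the low-order coefficients in the last
  column. \<open>companion 1\<close> is the empty matrix.\<close>

definition companion :: "'a::field poly \<Rightarrow> 'a mat" where
  "companion r = (let n = Polynomial.degree r in
     mat n n (\<lambda>(i, j). if j = n - 1 then - Polynomial.coeff r i else if i = j + 1 then 1 else 0))"

text \<open>Below, the vector space is the whole type \<open>'b\<close> with scalar multiplication \<open>scale\<close>. The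
  definitions are meant for \<open>scale\<close> satisfying \<open>vector_space\<close>. They are global rather than
  made inside that locale because its interpretation for \<open>real_vector\<close> would capture their names.\<close>

definition poly_endo ::
    "('a::field \<Rightarrow> 'b::ab_group_add \<Rightarrow> 'b) \<Rightarrow> 'a poly \<Rightarrow> ('b \<Rightarrow> 'b) \<Rightarrow> 'b \<Rightarrow> 'b" where
  "poly_endo scale f u v =
     (\<Sum>i\<le>Polynomial.degree f. scale (Polynomial.coeff f i) ((u ^^ i) v))"

definition annihilates ::
    "('a::field \<Rightarrow> 'b::ab_group_add \<Rightarrow> 'b) \<Rightarrow> 'a poly \<Rightarrow> ('b \<Rightarrow> 'b) \<Rightarrow> bool" where
  "annihilates scale f u \<longleftrightarrow> (\<forall>v. poly_endo scale f u v = 0)"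

definition minimal_poly ::
    "('a::field \<Rightarrow> 'b::ab_group_add \<Rightarrow> 'b) \<Rightarrow> ('b \<Rightarrow> 'b) \<Rightarrow> 'a poly" where
  "minimal_poly scale u =
     (THE m. lead_coeff m = 1 \<and> (\<forall>f. annihilates scale f u \<longleftrightarrow> m dvd f))"

text \<open>\<open>represents scale bs u M\<close>: \<open>bs\<close> is an ordered basis of the whole space, and column \<open>j\<close> of
  \<open>M\<close> holds the coordinates of \<open>u (bs ! j)\<close>.\<close>

definition represents ::
    "('a::field \<Rightarrow> 'b::ab_group_add \<Rightarrow> 'b) \<Rightarrow> 'b list \<Rightarrow> ('b \<Rightarrow> 'b) \<Rightarrow> 'a mat \<Rightarrow> bool" where
  "represents scale bs u M \<longleftrightarrow>
     distinct bs \<and> \<not> module.dependent scale (set bs) \<and> module.span scale (set bs) = UNIV \<and>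
     M \<in> carrier_mat (length bs) (length bs) \<and>
     (\<forall>j<length bs. u (bs ! j) = (\<Sum>i<length bs. scale (M $$ (i, j)) (bs ! i)))"

text \<open>Eigenvalues in the algebraic closure are taken after extension of scalars, that is, for the
  matrix of \<open>u\<close> in a basis, viewed over the closure. The basis does not matter.\<close>

definition ac_eigenvalue ::
    "('a::field \<Rightarrow> 'b::ab_group_add \<Rightarrow> 'b) \<Rightarrow> ('b \<Rightarrow> 'b) \<Rightarrow> 'a alg_closure \<Rightarrow> bool" where
  "ac_eigenvalue scale u x \<longleftrightarrow>
     (\<exists>bs M. represents scale bs u M \<and> eigenvalue (map_mat to_ac M) x)"

definition pq_difference ::
    "('a::field \<Rightarrow> 'b::ab_group_add \<Rightarrow> 'b) \<Rightarrow> 'a poly \<Rightarrow> 'a poly \<Rightarrow> ('b \<Rightarrow> 'b) \<Rightarrow> bool" where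
  "pq_difference scale p q u \<longleftrightarrow>
     (\<exists>a b. Vector_Spaces.linear scale scale a \<and> Vector_Spaces.linear scale scale b \<and>
        (\<forall>v. u v = a v - b v) \<and> annihilates scale p a \<and> annihilates scale q b)"

definition d_exceptional ::
    "('a::field \<Rightarrow> 'b::ab_group_add \<Rightarrow> 'b) \<Rightarrow> 'a poly \<Rightarrow> 'a poly \<Rightarrow> ('b \<Rightarrow> 'b) \<Rightarrow> bool" where
  "d_exceptional scale p q u \<longleftrightarrow>
     (\<forall>z. ac_eigenvalue scale u z \<longrightarrow> z \<in> {x - y | x y. x \<in> ac_roots p \<and> y \<in> ac_roots q})"

text \<open>\<open>invariant_factors scale u r\<close>: \<open>r 0, r 1, \<dots>\<close> is the (unique) sequence of invariant factors
  of \<open>u\<close>, numbered from 0 and padded with 1. The choice of the cut-off \<open>m\<close> is immaterial, because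
  \<open>companion 1\<close> is the empty matrix.\<close>

definition invariant_factors ::
    "('a::field \<Rightarrow> 'b::ab_group_add \<Rightarrow> 'b) \<Rightarrow> ('b \<Rightarrow> 'b) \<Rightarrow> (nat \<Rightarrow> 'a poly) \<Rightarrow> bool" where
  "invariant_factors scale u r \<longleftrightarrow>
     (\<forall>i. lead_coeff (r i) = 1) \<and> (\<forall>i. r (Suc i) dvd r i) \<and>
     (\<exists>m. (\<forall>i\<ge>m. r i = 1) \<and>
        (\<exists>bs. represents scale bs u (diag_block_mat (map (\<lambda>i. companion (r i)) [0..<m]))))"

end

theory Submission
  imports Defs
begin

text \<open>
  Write \<open>p1 = p(t + y1)\<close>, \<open>p2 = p(t + y2)\<close>, \<open>\<delta> = tr p - tr q\<close>, and let \<open>\<sigma>\<close> be the involution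
  \<open>g(t) \<mapsto> g(\<delta> - t)\<close> of \<open>F[t]\<close>, which exchanges \<open>p1\<close> and \<open>p2\<close>; the hypothesis on the traces says
  that \<open>2t - \<delta> \<noteq> 0\<close>, so that \<open>p1\<close> and \<open>p2\<close> are coprime.

  If \<open>u = a - b\<close> with \<open>p(a) = q(b) = 0\<close>, the commutator \<open>w = ub - bu\<close> satisfies
  \<open>w g(u) = (\<sigma> g)(u) w\<close> and \<open>w\<^sup>2 = p1(u) p2(u)\<close>. When \<open>u\<close> is d-exceptional, \<open>w\<close> is nilpotent and
  exchanges the two primary components of \<open>V\<close>. As for nilpotent endomorphisms, a generating family of
  homogeneous vectors whose \<open>w\<close>-strings have minimal total length is independent, and a string of
  length \<open>l\<close> starting in the \<open>p1\<close>-component is the sum of two cyclic modules of orders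
  \<open>p1^\<lceil>l/2\<rceil>\<close> and \<open>p2^\<lfloor>l/2\<rfloor>\<close>. This gives the blocks of (iii).

  Sorting the exponents of \<open>p1\<close> and those of \<open>p2\<close> separately preserves the bound on their
  differences, and the Chinese remainder theorem then gives the invariant factors of (ii).

  Conversely, \<open>F[t]\<close> is the direct sum of the subring \<open>S\<close> of polynomials in \<open>t(\<delta> - t)\<close> and of
  \<open>p1 S\<close>. Letting \<open>b\<close> act as \<open>y1\<close> on the first summand and as \<open>y2\<close> on the second, one has
  \<open>q(b) = 0\<close> and \<open>p(t + b) = 0\<close>, and \<open>b\<close> preserves the ideals generated by \<open>p1^n p2^n\<close> and
  \<open>p1^(n+1) p2^n\<close>, hence descends to the corresponding cyclic modules.
\<close>

subsection \<open>Coprime polynomials over a field\<close>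

text \<open>By division with remainder, a nonzero element of least degree in the ideal
  \<open>J\<close> generated by \<open>f\<close> and \<open>g\<close> divides all of
  \<open>J\<close>; coprimality makes it a unit.\<close>

lemma coprime_poly_iff_bezout:
  fixes f g :: "'a::field poly"
  shows "coprime f g \<longleftrightarrow> (\<exists>a b. a * f + b * g = 1)"
proof
  assume cop: "coprime f g"
  define J where "J = {a * f + b * g | a b. True}"
  have fJ: "f \<in> J" unfolding J_def by (rule CollectI, rule exI[of _ 1], rule exI[of _ 0]) simp
  have gJ: "g \<in> J" unfolding J_def by (rule CollectI, rule exI[of _ 0], rule exI[of _ 1]) simp
  have "f \<noteq> 0 \<or> g \<noteq> 0"
    using cop by auto
  then have ex: "\<exists>d. d \<in> J \<and> d \<noteq> 0"
    using fJ gJ by blast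
  obtain d where d: "d \<in> J" "d \<noteq> 0"
    and least: "\<And>e. e \<in> J \<Longrightarrow> e \<noteq> 0 \<Longrightarrow> Polynomial.degree d \<le> Polynomial.degree e"
    using ex_has_least_nat[of "\<lambda>d. d \<in> J \<and> d \<noteq> 0" _ Polynomial.degree] ex by blast
  obtain a b where ab: "d = a * f + b * g"
    using d(1) unfolding J_def by blast
  have dvd: "d dvd h" if hJ: "h \<in> J" for h
  proof -
    obtain a' b' where h: "h = a' * f + b' * g"
      using hJ unfolding J_def by blast
    have "h mod d = h - h div d * d"
      by (simp add: minus_div_mult_eq_mod)
    also have "\<dots> = (a' - h div d * a) * f + (b' - h div d * b) * g"
      unfolding h ab by (simp add: algebra_simps)
    finally have "h mod d \<in> J"
      unfolding J_def by blast
    then have "h mod d = 0"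
      using least[of "h mod d"] degree_mod_less[of d h] d(2) by fastforce
    then show ?thesis
      by (simp add: dvd_eq_mod_eq_0)
  qed
  have "d dvd 1"
    using cop dvd[OF fJ] dvd[OF gJ] coprime_common_divisor by blast
  then obtain e where "1 = d * e" ..
  then have "(e * a) * f + (e * b) * g = 1"
    unfolding ab by (simp add: algebra_simps)
  then show "\<exists>a b. a * f + b * g = 1"
    by blast
next
  assume "\<exists>a b. a * f + b * g = 1"
  then obtain a b where ab: "a * f + b * g = 1" by blast
  show "coprime f g"
    by (rule coprimeI) (metis ab dvd_add dvd_mult)
qed

lemma coprime_poly_mult_right:
  fixes f g h :: "'a::field poly"
  assumes "coprime f g" "coprime f h"
  shows "coprime f (g * h)"
proof -
  obtain a b c d where "a * f + b * g = 1" "c * f + d * h = 1"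
    using assms unfolding coprime_poly_iff_bezout by blast
  then have "(a * f + b * g) * (c * f + d * h) = 1"
    by simp
  then have "(a * (c * f + d * h) + b * g * c) * f + (b * d) * (g * h) = 1"
    by (simp add: algebra_simps)
  then show ?thesis
    unfolding coprime_poly_iff_bezout by blast
qed

lemma coprime_poly_power_right:
  fixes f g :: "'a::field poly"
  assumes "coprime f g"
  shows "coprime f (g ^ n)"
  by (induction n) (auto intro: coprime_poly_mult_right assms)

lemma coprime_poly_power:
  fixes f g :: "'a::field poly"
  assumes "coprime f g"
  shows "coprime (f ^ m) (g ^ n)"
  using assms by (metis coprime_commute coprime_poly_power_right)

lemma coprime_poly_dvd_mult:
  fixes f g h :: "'a::field poly"
  assumes "coprime f g" "f dvd g * h"
  shows "f dvd h"
proof -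
  obtain a b where "a * f + b * g = 1"
    using assms(1) unfolding coprime_poly_iff_bezout by blast
  then have "h = (a * f + b * g) * h"
    by simp
  also have "\<dots> = f * (a * h) + b * (g * h)"
    by (simp add: algebra_simps)
  finally show ?thesis
    using assms(2) by (metis dvd_add dvd_mult dvd_triv_left)
qed

lemma coprime_poly_mult_dvd:
  fixes f g h :: "'a::field poly"
  assumes "coprime f g" "f dvd h" "g dvd h"
  shows "f * g dvd h"
proof -
  obtain k where k: "h = g * k"
    using assms(3) ..
  then have "f dvd k"
    using assms(1,2) coprime_poly_dvd_mult by blast
  then show ?thesis
    unfolding k by (metis dvd_refl mult.commute mult_dvd_mono)
qed

lemma irreducible_coprime_poly:
  fixes f g :: "'a::field poly"
  assumes "Factorial_Ring.irreducible f" "\<not> f dvd g"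
  shows "coprime f g"
proof (rule coprimeI)
  fix c assume c: "c dvd f" "c dvd g"
  then obtain k where k: "f = c * k" by blast
  show "is_unit c"
  proof (rule ccontr)
    assume "\<not> is_unit c"
    then have "is_unit k"
      using assms(1) k by (metis irreducibleD)
    then have "f dvd c"
      unfolding k by (simp add: mult_unit_dvd_iff)
    then show False
      using assms(2) c(2) dvd_trans by blast
  qed
qed

text \<open>Divide by \<open>P\<close> as long as possible; this stops because \<open>P\<close> has
  positive degree. The exponent is the multiplicity of \<open>P\<close> in \<open>f\<close>.\<close>

lemma poly_split_prime_power:
  fixes P f :: "'a::field poly"
  assumes "Factorial_Ring.irreducible P" "f \<noteq> 0"
  obtains k g where "f = P ^ k * g" "\<not> P dvd g"
proof -
  have nu: "\<not> is_unit P" "P \<noteq> 0"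
    using assms(1) by (auto simp: Factorial_Ring.irreducible_def)
  have "\<exists>k g. f = P ^ k * g \<and> \<not> P dvd g"
    using assms(2)
  proof (induction "Polynomial.degree f" arbitrary: f rule: less_induct)
    case less
    show ?case
    proof (cases "P dvd f")
      case False
      then show ?thesis by (intro exI[of _ 0] exI[of _ f]) auto
    next
      case True
      then obtain h where h: "f = P * h" ..
      have ne: "P \<noteq> 0" "h \<noteq> 0"
        using less.prems h by auto
      have "Polynomial.degree P \<noteq> 0"
        using nu is_unit_iff_degree[of P] by simp
      then have "Polynomial.degree h < Polynomial.degree f"
        unfolding h using ne by (simp add: degree_mult_eq)
      then obtain k g where "h = P ^ k * g" "\<not> P dvd g"
        using less.hyps ne(2) by blast
      then show ?thesis
        by (intro exI[of _ "Suc k"] exI[of _ g]) (auto simp: h)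
    qed
  qed
  then show ?thesis using that by blast
qed

subsection \<open>Polynomials in an endomorphism\<close>

locale endo = vector_space scale
  for scale :: "'a::field \<Rightarrow> 'b::ab_group_add \<Rightarrow> 'b" +
  fixes u :: "'b \<Rightarrow> 'b"
  assumes linear_u: "Vector_Spaces.linear scale scale u"
begin

abbreviation E :: "'a poly \<Rightarrow> 'b \<Rightarrow> 'b" where
  "E f v \<equiv> poly_endo scale f u v"

lemma u_add: "u (v + w) = u v + u w"
  and u_scale: "u (scale c v) = scale c (u v)"
  using linear_u by (simp_all add: Vector_Spaces.linear_iff)

lemma u_0: "u 0 = 0"
  using u_add[of 0 0] by simp

lemma u_sum: "u (\<Sum>i\<in>A. h i) = (\<Sum>i\<in>A. u (h i))"
  by (induction A rule: infinite_finite_induct) (auto simp: u_0 u_add)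

lemma upow_linear: "(u ^^ k) (v + w) = (u ^^ k) v + (u ^^ k) w"
  "(u ^^ k) (scale c v) = scale c ((u ^^ k) v)"
  by (induction k) (auto simp: u_add u_scale)

lemma E_bound:
  assumes "Polynomial.degree f \<le> n"
  shows "E f v = (\<Sum>i\<le>n. scale (Polynomial.coeff f i) ((u ^^ i) v))"
  unfolding poly_endo_def
  by (rule sum.mono_neutral_left) (use assms in \<open>auto simp: coeff_eq_0\<close>)

lemma E_add_left: "E (f + g) v = E f v + E g v"
proof -
  let ?n = "max (Polynomial.degree f) (Polynomial.degree g)"
  show ?thesis
    using E_bound[of f ?n v] E_bound[of g ?n v] E_bound[of "f + g" ?n v]
    by (simp add: degree_add_le scale_left_distrib sum.distrib)
qed

lemma E_0_left [simp]: "E 0 v = 0"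
  by (simp add: poly_endo_def)

lemma E_pCons: "E (pCons c f) v = scale c v + u (E f v)"
proof -
  have "E (pCons c f) v =
      (\<Sum>i\<le>Suc (Polynomial.degree f). scale (Polynomial.coeff (pCons c f) i) ((u ^^ i) v))"
    by (rule E_bound) (simp add: degree_pCons_le)
  also have "\<dots> = scale c v + (\<Sum>i\<le>Polynomial.degree f. scale (Polynomial.coeff f i) (u ((u ^^ i) v)))"
    by (subst sum.atMost_Suc_shift) simp
  finally show ?thesis
    by (simp add: poly_endo_def u_sum u_scale)
qed

lemma E_const [simp]: "E [:c:] v = scale c v"
  using E_pCons[of c 0] by (simp add: u_0)

lemma E_1 [simp]: "E 1 v = v"
  by (simp add: one_pCons)

lemma E_uminus_left: "E (- f) v = - E f v"
  by (simp add: poly_endo_def sum_negf)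

lemma E_diff_left: "E (f - g) v = E f v - E g v"
  using E_add_left[of f "- g"] by (simp add: E_uminus_left)

lemma E_smult_left: "E (Polynomial.smult c f) v = scale c (E f v)"
  using E_bound[of "Polynomial.smult c f" "Polynomial.degree f" v]
  by (simp add: poly_endo_def scale_sum_right)

lemma E_add: "E f (v + w) = E f v + E f w"
  by (simp add: poly_endo_def upow_linear scale_right_distrib sum.distrib)

lemma E_scale: "E f (scale c v) = scale c (E f v)"
  by (simp add: poly_endo_def upow_linear scale_sum_right mult.commute)

lemma E_0 [simp]: "E f 0 = 0"
  using E_scale[of f 0 0] by simp

lemma E_uminus: "E f (- v) = - E f v"
  using E_scale[of f "-1" v] by simp

lemma E_diff: "E f (v - w) = E f v - E f w"
  using E_add[of f v "- w"] by (simp add: E_uminus)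

lemma E_sum: "E f (\<Sum>i\<in>A. h i) = (\<Sum>i\<in>A. E f (h i))"
  by (induction A rule: infinite_finite_induct) (auto simp: E_add)

lemma E_sum_left: "E (\<Sum>i\<in>A. h i) v = (\<Sum>i\<in>A. E (h i) v)"
  by (induction A rule: infinite_finite_induct) (auto simp: E_add_left)

text \<open>Together with additivity in both arguments, this makes the space an F[t]-module in which
  \<open>t\<close> acts as \<open>u\<close>.\<close>

lemma E_mult: "E (f * g) v = E f (E g v)"
proof (induction f)
  case 0
  show ?case by simp
next
  case (pCons c f)
  then show ?case
    by (simp add: E_add_left E_smult_left E_pCons)
qed

lemma E_mult_commute: "E f (E g v) = E g (E f v)"
  by (metis E_mult mult.commute)

lemma E_monom: "E (Polynomial.monom c k) v = scale c ((u ^^ k) v)"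
  by (induction k) (simp_all add: monom_0 monom_Suc E_pCons u_scale u_0)

lemma E_dvd: "f dvd g \<Longrightarrow> E f v = 0 \<Longrightarrow> E g v = 0"
  by (metis E_0 E_mult dvdE mult.commute)

lemma E_mod: "E f v = 0 \<Longrightarrow> E (g mod f) v = E g v"
  by (metis E_0 E_add_left E_mult add.left_neutral div_mult_mod_eq)

lemma E_coprime:
  assumes "coprime f g" "E f v = 0" "E g v = 0"
  shows "v = 0"
proof -
  obtain a b where "a * f + b * g = 1"
    using assms(1) unfolding coprime_poly_iff_bezout by blast
  then have "v = E (a * f + b * g) v"
    by simp
  then show ?thesis
    using assms(2,3) by (simp add: E_add_left E_mult)
qed

subsection \<open>Decompositions into cyclic submodules\<close>

text \<open>The \<open>F[t]\<close>-module defined by \<open>u\<close> is the direct sum of the cyclic submodules generated by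
  the \<open>z i\<close>, where \<open>z i\<close> has order \<open>f i\<close>.\<close>

definition cyclic_decomp :: "'i set \<Rightarrow> ('i \<Rightarrow> 'b) \<Rightarrow> ('i \<Rightarrow> 'a poly) \<Rightarrow> bool" where
  "cyclic_decomp I z f \<longleftrightarrow> finite I \<and> (\<forall>v. \<exists>g. v = (\<Sum>i\<in>I. E (g i) (z i))) \<and>
     (\<forall>g. (\<Sum>i\<in>I. E (g i) (z i)) = 0 \<longleftrightarrow> (\<forall>i\<in>I. f i dvd g i))"

lemma cyclic_decompD:
  assumes "cyclic_decomp I z f"
  shows "finite I" "\<exists>g. v = (\<Sum>i\<in>I. E (g i) (z i))"
    "(\<Sum>i\<in>I. E (g i) (z i)) = 0 \<longleftrightarrow> (\<forall>i\<in>I. f i dvd g i)"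
  using assms unfolding cyclic_decomp_def by blast+

text \<open>Apply the relation criterion to a family of cofactors that is zero away from
  \<open>i\<close>.\<close>

lemma cyclic_decomp_order:
  assumes "cyclic_decomp I z f" "i \<in> I"
  shows "E g (z i) = 0 \<longleftrightarrow> f i dvd g"
proof -
  have "(\<Sum>j\<in>I. E (if j = i then g else 0) (z j)) = (\<Sum>j\<in>I. if j = i then E g (z i) else 0)"
    by (rule sum.cong) auto
  also have "\<dots> = E g (z i)"
    using assms(2) cyclic_decompD(1)[OF assms(1)] by (simp add: sum.delta)
  finally show ?thesis
    using cyclic_decompD(3)[OF assms(1), of "\<lambda>j. if j = i then g else 0"] assms(2)
    by (auto split: if_splits)
qed

lemma cyclic_decomp_reindex:
  assumes "cyclic_decomp I z f" "bij_betw h J I"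
    and "\<And>j. j \<in> J \<Longrightarrow> z' j = z (h j)" "\<And>j. j \<in> J \<Longrightarrow> f' j = f (h j)"
  shows "cyclic_decomp J z' f'"
proof -
  have sum_eq: "(\<Sum>j\<in>J. E (g (h j)) (z' j)) = (\<Sum>i\<in>I. E (g i) (z i))" for g
    using sum.reindex_bij_betw[OF assms(2), of "\<lambda>i. E (g i) (z i)"] assms(3) by simp
  define k where "k = the_inv_into J h"
  have k: "k (h j) = j" if "j \<in> J" for j
    unfolding k_def using assms(2) that by (simp add: bij_betw_def the_inv_into_f_f)
  have sum_eq': "(\<Sum>j\<in>J. E (g j) (z' j)) = (\<Sum>i\<in>I. E (g (k i)) (z i))" for g
    unfolding sum_eq[of "\<lambda>i. g (k i)", symmetric] by (rule sum.cong) (auto simp: k)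
  have "(\<forall>i\<in>I. f i dvd g (k i)) \<longleftrightarrow> (\<forall>j\<in>J. f' j dvd g j)" for g
    using bij_betw_imp_surj_on[OF assms(2)] assms(4) k by auto
  moreover have "\<exists>g. v = (\<Sum>j\<in>J. E (g j) (z' j))" for v
  proof -
    obtain g where "v = (\<Sum>i\<in>I. E (g i) (z i))"
      using cyclic_decompD(2)[OF assms(1)] by blast
    then have "v = (\<Sum>j\<in>J. E (g (h j)) (z' j))"
      by (simp add: sum_eq)
    then show ?thesis by (intro exI[of _ "\<lambda>j. g (h j)"])
  qed
  moreover have "finite J"
    using assms(2) cyclic_decompD(1)[OF assms(1)] bij_betw_finite by blast
  moreover have "(\<Sum>j\<in>J. E (g j) (z' j)) = 0 \<longleftrightarrow> (\<forall>i\<in>I. f i dvd g (k i))" for g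
    unfolding sum_eq' by (rule cyclic_decompD(3)[OF assms(1)])
  ultimately show ?thesis
    unfolding cyclic_decomp_def by blast
qed

text \<open>A generator of order 1 is zero, so dropping it changes neither the sums nor the
  relations.\<close>

lemma cyclic_decomp_subset:
  assumes "cyclic_decomp I z f" "J \<subseteq> I" "\<And>i. i \<in> I - J \<Longrightarrow> f i = 1"
  shows "cyclic_decomp J z f"
proof -
  have z0: "z i = 0" if "i \<in> I - J" for i
    using cyclic_decomp_order[OF assms(1), of i 1] assms(3)[OF that] that by simp
  have eq: "(\<Sum>i\<in>J. E (g i) (z i)) = (\<Sum>i\<in>I. E (g i) (z i))" for g
    by (rule sum.mono_neutral_left) (use assms cyclic_decompD(1) z0 in auto)
  have "finite J"
    using assms(1,2) cyclic_decompD(1) finite_subset by blast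
  moreover have "(\<forall>i\<in>I. f i dvd g i) \<longleftrightarrow> (\<forall>i\<in>J. f i dvd g i)" for g
    using assms(2,3) by (metis DiffI one_dvd subsetD)
  ultimately show ?thesis
    using assms(1) unfolding cyclic_decomp_def eq by blast
qed

text \<open>Chinese remainder theorem: two cyclic modules of coprime orders form a single one,
  generated by the sum of their generators.\<close>

lemma cyclic_decomp_combine:
  fixes z :: "'i \<times> bool \<Rightarrow> 'b"
  assumes dec: "cyclic_decomp (I \<times> UNIV) z f"
    and cop: "\<And>i. i \<in> I \<Longrightarrow> coprime (f (i, True)) (f (i, False))"
  shows "cyclic_decomp I (\<lambda>i. z (i, True) + z (i, False)) (\<lambda>i. f (i, True) * f (i, False))"
proof -
  have fin: "finite I"
    using cyclic_decompD(1)[OF dec] by (auto dest: finite_cartesian_productD1)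
  have UB: "(UNIV :: bool set) = {True, False}" by auto
  have split: "(\<Sum>x\<in>I \<times> UNIV. E (g x) (z x)) = (\<Sum>i\<in>I. E (g (i, True)) (z (i, True)) + E (g (i, False)) (z (i, False)))" for g
    using sum.cartesian_product[of "\<lambda>i e. E (g (i, e)) (z (i, e))" UNIV I] by (simp add: UB)
  have "\<exists>h. v = (\<Sum>i\<in>I. E (h i) (z (i, True) + z (i, False)))" for v
  proof -
    obtain g where v: "v = (\<Sum>x\<in>I \<times> UNIV. E (g x) (z x))"
      using cyclic_decompD(2)[OF dec] by blast
    \<comment> \<open>With \<open>a * ?f + b * ?f' = 1\<close>, the polynomial
      \<open>b * ?f'\<close> acts as the identity on the first generator and as zero on the second,
      and \<open>a * ?f\<close> does the opposite.\<close>
    have "\<exists>h. E h (z (i, True)) = E (g (i, True)) (z (i, True)) \<and> E h (z (i, False)) = E (g (i, False)) (z (i, False))"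
      if i: "i \<in> I" for i
    proof -
      let ?f = "f (i, True)" and ?f' = "f (i, False)"
      obtain a b where ab: "a * ?f + b * ?f' = 1"
        using cop[OF i] unfolding coprime_poly_iff_bezout by blast
      have o: "E ?f (z (i, True)) = 0" "E ?f' (z (i, False)) = 0"
        using cyclic_decomp_order[OF dec] i by auto
      have "E (b * ?f') (z (i, True)) = E (a * ?f + b * ?f') (z (i, True))"
        using o by (simp add: E_add_left E_mult)
      then have 1: "E (b * ?f') (z (i, True)) = z (i, True)"
        by (simp add: ab)
      have "E (a * ?f) (z (i, False)) = E (a * ?f + b * ?f') (z (i, False))"
        using o by (simp add: E_add_left E_mult)
      then have 2: "E (a * ?f) (z (i, False)) = z (i, False)"
        by (simp add: ab)
      have 3: "E (a * ?f) (z (i, True)) = 0" "E (b * ?f') (z (i, False)) = 0"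
        using o by (simp_all add: E_mult)
      show ?thesis
        using 1 2 3
        by (intro exI[of _ "g (i, True) * (b * ?f') + g (i, False) * (a * ?f)"])
          (simp only: E_add_left E_mult[of "g _"] E_0 add_0_left add_0_right)
    qed
    then obtain h where "\<forall>i\<in>I. E (h i) (z (i, True)) = E (g (i, True)) (z (i, True)) \<and>
        E (h i) (z (i, False)) = E (g (i, False)) (z (i, False))"
      by metis
    then have "v = (\<Sum>i\<in>I. E (h i) (z (i, True) + z (i, False)))"
      unfolding v split by (simp add: E_add)
    then show ?thesis by (intro exI[of _ h])
  qed
  moreover have "(\<Sum>i\<in>I. E (h i) (z (i, True) + z (i, False))) = 0 \<longleftrightarrow>
      (\<forall>i\<in>I. f (i, True) * f (i, False) dvd h i)" for h
  proof -
    have "(\<Sum>i\<in>I. E (h i) (z (i, True) + z (i, False))) = 0 \<longleftrightarrow> (\<forall>x\<in>I \<times> UNIV. f x dvd h (fst x))"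
      using cyclic_decompD(3)[OF dec, of "\<lambda>x. h (fst x)"] unfolding split by (simp add: E_add)
    also have "\<dots> \<longleftrightarrow> (\<forall>i\<in>I. f (i, True) dvd h i \<and> f (i, False) dvd h i)"
      by (auto simp: UB)
    also have "\<dots> \<longleftrightarrow> (\<forall>i\<in>I. f (i, True) * f (i, False) dvd h i)"
      using cop coprime_poly_mult_dvd by (metis dvd_mult_left dvd_mult_right)
    finally show ?thesis .
  qed
  ultimately show ?thesis
    unfolding cyclic_decomp_def using fin by blast
qed

end

subsection \<open>Companion matrices and cyclic decompositions\<close>

text \<open>Independence of a set ignores repetitions in a family with that image. Injectivity makes
  up for this: two equal members would give a relation with coefficients 1 and -1.\<close>

lemma (in vector_space) independent_family_iff:
  assumes "finite S"
  shows "inj_on b S \<and> independent (b ` S) \<longleftrightarrow>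
    (\<forall>c. (\<Sum>s\<in>S. scale (c s) (b s)) = 0 \<longrightarrow> (\<forall>s\<in>S. c s = 0))"
proof
  assume L: "inj_on b S \<and> independent (b ` S)"
  then have inj: "inj_on b S" by blast
  show "\<forall>c. (\<Sum>s\<in>S. scale (c s) (b s)) = 0 \<longrightarrow> (\<forall>s\<in>S. c s = 0)"
  proof (intro allI impI ballI)
    fix c s assume c: "(\<Sum>s\<in>S. scale (c s) (b s)) = 0" and s: "s \<in> S"
    define d where "d = c \<circ> the_inv_into S b"
    have d: "d (b s) = c s" if "s \<in> S" for s
      using the_inv_into_f_f[OF inj that] by (simp add: d_def)
    have "(\<Sum>v\<in>b ` S. scale (d v) v) = 0"
      using c by (simp add: sum.reindex[OF inj] d)
    then have "d (b s) = 0"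
      using independentD[of "b ` S" "b ` S" d "b s"] L assms s by blast
    then show "c s = 0" by (simp add: d s)
  qed
next
  assume R: "\<forall>c. (\<Sum>s\<in>S. scale (c s) (b s)) = 0 \<longrightarrow> (\<forall>s\<in>S. c s = 0)"
  have inj: "inj_on b S"
  proof (rule inj_onI, rule ccontr)
    fix s t assume st: "s \<in> S" "t \<in> S" "b s = b t" "s \<noteq> t"
    define c where "c x = (if x = s then 1 else if x = t then -1 else 0 :: 'a)" for x
    have "(\<Sum>x\<in>S. scale (c x) (b x)) = (\<Sum>x\<in>{s, t}. scale (c x) (b x))"
      by (rule sum.mono_neutral_right) (use assms st in \<open>auto simp: c_def\<close>)
    also have "\<dots> = 0"
      using st by (simp add: c_def)
    finally have "c s = 0"
      using R st(1) by blast
    then show False by (simp add: c_def)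
  qed
  moreover have "independent (b ` S)"
  proof (rule independent_if_scalars_zero)
    fix d v assume d: "(\<Sum>x\<in>b ` S. scale (d x) x) = 0" "v \<in> b ` S"
    then have "(\<Sum>s\<in>S. scale (d (b s)) (b s)) = 0"
      by (simp add: sum.reindex[OF inj])
    then have "\<forall>s\<in>S. d (b s) = 0"
      using R[rule_format, of "\<lambda>s. d (b s)"] by blast
    then show "d v = 0"
      using d(2) by blast
  qed (use assms in simp)
  ultimately show "inj_on b S \<and> independent (b ` S)" ..
qed

lemma (in vector_space) basis_family_iff:
  assumes "finite S"
  shows "inj_on b S \<and> independent (b ` S) \<and> span (b ` S) = UNIV \<longleftrightarrow>
    (\<forall>c. (\<Sum>s\<in>S. scale (c s) (b s)) = 0 \<longrightarrow> (\<forall>s\<in>S. c s = 0)) \<and>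
    (\<forall>v. \<exists>c. v = (\<Sum>s\<in>S. scale (c s) (b s)))"
proof -
  have "span (b ` S) = UNIV \<longleftrightarrow> (\<forall>v. \<exists>c. v = (\<Sum>s\<in>S. scale (c s) (b s)))"
    if inj: "inj_on b S"
  proof
    assume span: "span (b ` S) = UNIV"
    show "\<forall>v. \<exists>c. v = (\<Sum>s\<in>S. scale (c s) (b s))"
    proof
      fix v
      have "v \<in> span (b ` S)" using span by simp
      then obtain d where "v = (\<Sum>v\<in>b ` S. scale (d v) v)"
        using assms by (auto simp: span_finite)
      then show "\<exists>c. v = (\<Sum>s\<in>S. scale (c s) (b s))"
        by (intro exI[of _ "d \<circ> b"]) (simp add: sum.reindex[OF inj])
    qed
  next
    assume R: "\<forall>v. \<exists>c. v = (\<Sum>s\<in>S. scale (c s) (b s))"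
    have "v \<in> span (b ` S)" for v
    proof -
      obtain c where "v = (\<Sum>s\<in>S. scale (c s) (b s))"
        using R by blast
      then show ?thesis
        by (simp only:) (intro span_sum span_scale span_base imageI)
    qed
    then show "span (b ` S) = UNIV" by blast
  qed
  then show ?thesis
    unfolding independent_family_iff[OF assms, of b, symmetric] by blast
qed

section \<open>Splitting sums, lists and block matrices\<close>

lemma sum_lessThan_add:
  fixes h :: "nat \<Rightarrow> 'c::comm_monoid_add"
  shows "(\<Sum>i<n + m. h i) = (\<Sum>i<n. h i) + (\<Sum>i<m. h (n + i))"
  by (induction m) (simp_all add: add.assoc)

lemma all_less_add_iff:
  fixes n m :: nat
  shows "(\<forall>j<n + m. P j) \<longleftrightarrow> (\<forall>j<n. P j) \<and> (\<forall>j<m. P (n + j))"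
  by (metis add_diff_inverse_nat add_less_cancel_left trans_less_add1)

lemma distinct_concat_map_Pair:
  "distinct xs \<Longrightarrow> distinct (concat (map (\<lambda>i. map (Pair i) [0..<n i]) xs))"
  by (induction xs) (auto simp: distinct_map inj_on_def)

lemma diag_block_mat_concat:
  "diag_block_mat (concat Ass) = diag_block_mat (map diag_block_mat Ass)"
  by (induction Ass) (simp_all add: diag_block_mat_append Let_def)

context endo
begin

abbreviation chain :: "'b \<Rightarrow> nat \<Rightarrow> 'b list" where
  "chain z n \<equiv> map (\<lambda>k. (u ^^ k) z) [0..<n]"

text \<open>The matrix condition of \<open>represents\<close> without the requirement that
  \<open>bs\<close> be a basis; it can be cut along diagonal blocks, where each piece of
  \<open>bs\<close> spans only part of the space.\<close>

definition acts_as :: "'b list \<Rightarrow> 'a mat \<Rightarrow> bool" where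
  "acts_as bs M \<longleftrightarrow> M \<in> carrier_mat (length bs) (length bs) \<and>
     (\<forall>j<length bs. u (bs ! j) = (\<Sum>i<length bs. scale (M $$ (i, j)) (bs ! i)))"

lemma acts_as_four_block:
  assumes A: "A \<in> carrier_mat (length xs) (length xs)" and B: "B \<in> carrier_mat m m"
  shows "acts_as (xs @ ys) (four_block_mat A (0\<^sub>m (length xs) m) (0\<^sub>m m (length xs)) B) \<longleftrightarrow>
    acts_as xs A \<and> acts_as ys B"
proof (cases "length ys = m")
  \<comment> \<open>If the lengths do not fit, both sides fail on the size of the matrix.\<close>
  case False
  then show ?thesis
    using A B by (auto simp: acts_as_def)
next
  case m: True
  let ?n = "length xs"
  let ?M = "four_block_mat A (0\<^sub>m ?n m) (0\<^sub>m m ?n) B"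
  have car: "?M \<in> carrier_mat (?n + m) (?n + m)"
    using A B by simp
  have left: "(\<Sum>i<?n + m. scale (?M $$ (i, j)) ((xs @ ys) ! i)) = (\<Sum>i<?n. scale (A $$ (i, j)) (xs ! i))"
    if j: "j < ?n" for j
    using A B j by (simp add: sum_lessThan_add nth_append)
  have right: "(\<Sum>i<?n + m. scale (?M $$ (i, ?n + j)) ((xs @ ys) ! i)) = (\<Sum>i<m. scale (B $$ (i, j)) (ys ! i))"
    if j: "j < m" for j
    using A B j by (simp add: sum_lessThan_add nth_append)
  have "acts_as (xs @ ys) ?M \<longleftrightarrow> (\<forall>j<?n + m. u ((xs @ ys) ! j) = (\<Sum>i<?n + m. scale (?M $$ (i, j)) ((xs @ ys) ! i)))"
    using car m by (simp add: acts_as_def)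
  also have "\<dots> \<longleftrightarrow>
      (\<forall>j<?n. u ((xs @ ys) ! j) = (\<Sum>i<?n + m. scale (?M $$ (i, j)) ((xs @ ys) ! i))) \<and>
      (\<forall>j<m. u ((xs @ ys) ! (?n + j)) = (\<Sum>i<?n + m. scale (?M $$ (i, ?n + j)) ((xs @ ys) ! i)))"
    by (rule all_less_add_iff)
  also have "\<dots> \<longleftrightarrow> (\<forall>j<?n. u (xs ! j) = (\<Sum>i<?n. scale (A $$ (i, j)) (xs ! i))) \<and>
      (\<forall>j<m. u (ys ! j) = (\<Sum>i<m. scale (B $$ (i, j)) (ys ! i)))"
    using left right by (simp add: nth_append)
  finally show ?thesis
    using A B m by (simp add: acts_as_def)
qed

lemma companion_carrier: "companion f \<in> carrier_mat (Polynomial.degree f) (Polynomial.degree f)"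
  by (simp add: companion_def Let_def)

text \<open>All columns but the last force \<open>bs\<close> to be the chain of its first vector
  \<open>z\<close>, and the last column then reads \<open>f(u) z = 0\<close>. In degree 0 the list
  is empty and \<open>z = 0\<close> serves.\<close>

lemma acts_as_companion:
  assumes "lead_coeff f = 1"
  shows "acts_as bs (companion f) \<longleftrightarrow> (\<exists>z. bs = chain z (Polynomial.degree f) \<and> E f z = 0)"
proof (cases "Polynomial.degree f")
  case 0
  have "acts_as bs (companion f) \<longleftrightarrow> bs = []"
    using 0 companion_carrier[of f] by (auto simp: acts_as_def)
  then show ?thesis
    using 0 by (auto intro: exI[of _ 0])
next
  case (Suc m)
  let ?n = "Suc m"
  have Ef: "E f z = (\<Sum>i<?n. scale (Polynomial.coeff f i) ((u ^^ i) z)) + (u ^^ ?n) z" for z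
    using assms Suc by (simp add: poly_endo_def flip: lessThan_Suc_atMost)
  have col: "(\<Sum>i<?n. scale (companion f $$ (i, j)) (bs ! i)) =
      (if j = m then - (\<Sum>i<?n. scale (Polynomial.coeff f i) (bs ! i)) else bs ! Suc j)"
    if j: "j < ?n" for j
  proof (cases "j = m")
    case True
    then show ?thesis
      using Suc j by (simp add: companion_def Let_def sum_negf)
  next
    case False
    then have "(\<Sum>i<?n. scale (companion f $$ (i, j)) (bs ! i)) = (\<Sum>i<?n. if i = Suc j then bs ! Suc j else 0)"
      using Suc j by (intro sum.cong) (auto simp: companion_def Let_def)
    then show ?thesis
      using False j by (simp add: sum.delta del: sum.lessThan_Suc)
  qed
  have car: "companion f \<in> carrier_mat ?n ?n"
    using companion_carrier[of f] Suc by simp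
  show ?thesis
  proof
    assume L: "acts_as bs (companion f)"
    then have len: "length bs = ?n"
      using car by (auto simp: acts_as_def)
    have step: "u (bs ! j) = (if j = m then - (\<Sum>i<?n. scale (Polynomial.coeff f i) (bs ! i)) else bs ! Suc j)"
      if "j < ?n" for j
      using L col[OF that] that len by (simp add: acts_as_def del: sum.lessThan_Suc)
    have pow: "bs ! k = (u ^^ k) (bs ! 0)" if "k < ?n" for k
      using that
    proof (induction k)
      case (Suc k)
      then show ?case using step[of k] by simp
    qed simp
    have "bs = chain (bs ! 0) ?n"
    proof (rule nth_equalityI)
      fix k assume "k < length bs"
      then show "bs ! k = chain (bs ! 0) ?n ! k"
        using pow[of k] len by (simp del: upt_Suc)
    qed (simp add: len)
    moreover have "(u ^^ ?n) (bs ! 0) = - (\<Sum>i<?n. scale (Polynomial.coeff f i) (bs ! i))"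
      using step[of m] pow[of m] by (simp del: sum.lessThan_Suc)
    moreover have "(\<Sum>i<?n. scale (Polynomial.coeff f i) (bs ! i)) =
        (\<Sum>i<?n. scale (Polynomial.coeff f i) ((u ^^ i) (bs ! 0)))"
      by (rule sum.cong) (simp_all only: lessThan_iff pow[symmetric])
    ultimately show "\<exists>z. bs = chain z (Polynomial.degree f) \<and> E f z = 0"
      unfolding Suc Ef by (intro exI[of _ "bs ! 0"]) (simp del: sum.lessThan_Suc upt_Suc)
  next
    assume "\<exists>z. bs = chain z (Polynomial.degree f) \<and> E f z = 0"
    then obtain z where z: "bs = chain z ?n" "E f z = 0"
      using Suc by auto
    have len: "length bs = ?n" and nth: "\<And>k. k < ?n \<Longrightarrow> bs ! k = (u ^^ k) z"
      using z(1) by (simp_all del: upt_Suc)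
    have "(\<Sum>i<?n. scale (Polynomial.coeff f i) (bs ! i)) =
        (\<Sum>i<?n. scale (Polynomial.coeff f i) ((u ^^ i) z))"
      by (rule sum.cong) (use nth in auto)
    then have top: "(u ^^ ?n) z = - (\<Sum>i<?n. scale (Polynomial.coeff f i) (bs ! i))"
      using minus_unique[OF z(2)[unfolded Ef]] by (simp only:)
    have "u (bs ! j) = (\<Sum>i<?n. scale (companion f $$ (i, j)) (bs ! i))" if j: "j < ?n" for j
    proof (cases "j = m")
      case True
      then show ?thesis
        unfolding col[OF j] using top nth[OF j] by simp
    next
      case False
      then show ?thesis
        unfolding col[OF j] using nth[of j] nth[of "Suc j"] j by simp
    qed
    then show "acts_as bs (companion f)"
      unfolding acts_as_def len using car by blast
  qed
qed

text \<open>Induction on the blocks: the first companion block takes the first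
  \<open>degree f\<close> vectors of \<open>bs\<close>, and the rest of \<open>bs\<close> belongs to
  the remaining blocks.\<close>

lemma acts_as_companions:
  assumes "\<forall>f\<in>set fs. lead_coeff f = 1"
  shows "acts_as bs (diag_block_mat (map companion fs)) \<longleftrightarrow>
    (\<exists>z. bs = concat (map (\<lambda>i. chain (z i) (Polynomial.degree (fs ! i))) [0..<length fs]) \<and>
      (\<forall>i<length fs. E (fs ! i) (z i) = 0))"
  using assms
proof (induction fs arbitrary: bs)
  case Nil
  have "acts_as bs (0\<^sub>m 0 0) \<longleftrightarrow> bs = []"
    unfolding acts_as_def by (cases bs) auto
  then show ?case by simp
next
  case (Cons f fs)
  let ?D = "diag_block_mat (map companion fs)"
  let ?n = "Polynomial.degree f"
  define m where "m = dim_row ?D"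
  have "square_mat ?D"
    by (rule diag_block_mat_square) (simp add: companion_def Let_def)
  then have D: "?D \<in> carrier_mat m m"
    by (intro carrier_matI) (simp_all add: m_def)
  have M: "diag_block_mat (map companion (f # fs)) =
      four_block_mat (companion f) (0\<^sub>m ?n m) (0\<^sub>m m ?n) ?D"
    using D companion_carrier[of f] by (simp add: Let_def)
  let ?chains = "\<lambda>z. concat (map (\<lambda>i. chain (z i) (Polynomial.degree (fs ! i))) [0..<length fs])"
  have "acts_as bs (diag_block_mat (map companion (f # fs))) \<longleftrightarrow>
      (\<exists>xs ys. bs = xs @ ys \<and> acts_as xs (companion f) \<and> acts_as ys ?D)"
  proof
    assume L: "acts_as bs (diag_block_mat (map companion (f # fs)))"
    then have "length bs = ?n + m"
      unfolding M using D companion_carrier[of f] by (auto simp: acts_as_def)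
    then have "length (take ?n bs) = ?n"
      by simp
    then have "acts_as (take ?n bs) (companion f) \<and> acts_as (drop ?n bs) ?D"
      using acts_as_four_block[of "companion f" "take ?n bs" ?D m "drop ?n bs"] L D
        companion_carrier[of f]
      unfolding M by simp
    then show "\<exists>xs ys. bs = xs @ ys \<and> acts_as xs (companion f) \<and> acts_as ys ?D"
      by (metis append_take_drop_id)
  next
    assume "\<exists>xs ys. bs = xs @ ys \<and> acts_as xs (companion f) \<and> acts_as ys ?D"
    then obtain xs ys where *: "bs = xs @ ys" "acts_as xs (companion f)" "acts_as ys ?D"
      by blast
    then have "length xs = ?n"
      using companion_carrier[of f] by (auto simp: acts_as_def)
    then show "acts_as bs (diag_block_mat (map companion (f # fs)))"
      using * acts_as_four_block[of "companion f" xs ?D m ys] D companion_carrier[of f]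
      unfolding M by simp
  qed
  also have "\<dots> \<longleftrightarrow> (\<exists>xs ys. bs = xs @ ys \<and> (\<exists>z. xs = chain z ?n \<and> E f z = 0) \<and>
      (\<exists>z. ys = ?chains z \<and> (\<forall>i<length fs. E (fs ! i) (z i) = 0)))"
    using acts_as_companion[of f] Cons by simp
  also have "\<dots> \<longleftrightarrow> (\<exists>z0 z. bs = chain z0 ?n @ ?chains z \<and> E f z0 = 0 \<and>
      (\<forall>i<length fs. E (fs ! i) (z i) = 0))"
    by blast
  \<comment> \<open>The generator of the first chain and the sequence of the others are merged into
    one sequence by \<open>case_nat\<close>.\<close>
  also have "\<dots> \<longleftrightarrow> (\<exists>z. bs = chain (z 0) ?n @ ?chains (\<lambda>i. z (Suc i)) \<and> E f (z 0) = 0 \<and>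
      (\<forall>i<length fs. E (fs ! i) (z (Suc i)) = 0))" (is "?lhs \<longleftrightarrow> ?rhs")
  proof
    assume ?lhs
    then obtain z0 z where "bs = chain z0 ?n @ ?chains z" "E f z0 = 0"
      "\<forall>i<length fs. E (fs ! i) (z i) = 0" by blast
    then show ?rhs
      by (intro exI[of _ "case_nat z0 z"]) simp
  next
    assume ?rhs
    then obtain z where "bs = chain (z 0) ?n @ ?chains (\<lambda>i. z (Suc i))" "E f (z 0) = 0"
      "\<forall>i<length fs. E (fs ! i) (z (Suc i)) = 0" by blast
    then show ?lhs
      by (intro exI[of _ "z 0"] exI[of _ "\<lambda>i. z (Suc i)"]) simp
  qed
  also have "\<dots> \<longleftrightarrow> (\<exists>z. bs = concat (map (\<lambda>i. chain (z i) (Polynomial.degree ((f # fs) ! i))) [0..<length (f # fs)]) \<and>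
      (\<forall>i<length (f # fs). E ((f # fs) ! i) (z i) = 0))"
  proof -
    have "map (\<lambda>i. chain (z i) (Polynomial.degree ((f # fs) ! i))) [0..<length (f # fs)] =
        chain (z 0) ?n # map (\<lambda>i. chain (z (Suc i)) (Polynomial.degree (fs ! i))) [0..<length fs]" for z
      by (simp add: upt_conv_Cons del: upt_Suc flip: map_Suc_upt)
    moreover have "(\<forall>i<length (f # fs). E ((f # fs) ! i) (z i) = 0) \<longleftrightarrow>
        E f (z 0) = 0 \<and> (\<forall>i<length fs. E (fs ! i) (z (Suc i)) = 0)" for z
      by (simp add: All_less_Suc2)
    ultimately show ?thesis
      by simp
  qed
  finally show ?case .
qed

text \<open>Each cofactor matters only through its remainder modulo \<open>f i\<close>, and the
  coefficients of the remainders are coordinates with respect to the vectors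
  \<open>(u ^^ k) (z i)\<close>. A cyclic decomposition thus amounts to a basis made of
  chains.\<close>

lemma cyclic_decomp_iff_basis:
  fixes z :: "'i \<Rightarrow> 'b"
  assumes I: "finite I" and f: "\<And>i. i \<in> I \<Longrightarrow> lead_coeff (f i) = 1"
    and z: "\<And>i. i \<in> I \<Longrightarrow> E (f i) (z i) = 0"
    and S: "S = Sigma I (\<lambda>i. {..<Polynomial.degree (f i)})"
  shows "cyclic_decomp I z f \<longleftrightarrow>
    (\<forall>c. (\<Sum>s\<in>S. scale (c s) ((u ^^ snd s) (z (fst s)))) = 0 \<longrightarrow> (\<forall>s\<in>S. c s = 0)) \<and>
    (\<forall>v. \<exists>c. v = (\<Sum>s\<in>S. scale (c s) ((u ^^ snd s) (z (fst s)))))"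
proof -
  \<comment> \<open>\<open>G\<close> assembles coefficients into polynomials; \<open>C\<close> below
    takes the coefficients of the remainders, and the two are inverse to each other up to reduction
    modulo \<open>f i\<close>.\<close>
  define G where "G c i = (\<Sum>k<Polynomial.degree (f i). Polynomial.monom (c (i, k)) k)" for c :: "'i \<times> nat \<Rightarrow> 'a" and i
  have coeff_G: "Polynomial.coeff (G c i) k = (if k < Polynomial.degree (f i) then c (i, k) else 0)" for c i k
    by (simp add: G_def Polynomial.coeff_sum sum.delta)
  have sum_S: "(\<Sum>s\<in>S. scale (c s) ((u ^^ snd s) (z (fst s)))) = (\<Sum>i\<in>I. E (G c i) (z i))" for c
    using sum.Sigma[of I "\<lambda>i. {..<Polynomial.degree (f i)}" "\<lambda>i k. scale (c (i, k)) ((u ^^ k) (z i))"] I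
    by (simp add: S case_prod_beta G_def E_sum_left E_monom)
  have mod_coeff: "Polynomial.coeff (g mod f i) k = 0" if "i \<in> I" "Polynomial.degree (f i) \<le> k" for g i k
    using f[OF that(1)] degree_mod_less[of "f i" g] that(2)
    by (metis coeff_0 coeff_eq_0 leading_coeff_0_iff order_less_le_trans zero_neq_one)
  define C where "C g = (\<lambda>s. Polynomial.coeff (g (fst s) mod f (fst s)) (snd s))" for g :: "'i \<Rightarrow> 'a poly"
  have G_C: "G (C g) i = g i mod f i" if "i \<in> I" for g i
    by (rule poly_eqI) (use mod_coeff[OF that] in \<open>auto simp: coeff_G C_def\<close>)
  have sum_E: "(\<Sum>i\<in>I. E (g i) (z i)) = (\<Sum>s\<in>S. scale (C g s) ((u ^^ snd s) (z (fst s))))" for g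
    unfolding sum_S by (rule sum.cong) (auto simp: G_C E_mod z)
  have zero_iff: "(\<forall>s\<in>S. C g s = 0) \<longleftrightarrow> (\<forall>i\<in>I. f i dvd g i)" for g
  proof
    assume R: "\<forall>s\<in>S. C g s = 0"
    show "\<forall>i\<in>I. f i dvd g i"
    proof
      fix i assume i: "i \<in> I"
      have "g i mod f i = 0"
      proof (rule poly_eqI)
        fix k
        show "Polynomial.coeff (g i mod f i) k = Polynomial.coeff 0 k"
          using R[rule_format, of "(i, k)"] mod_coeff[OF i, of k "g i"] i
          by (cases "k < Polynomial.degree (f i)") (auto simp: S C_def)
      qed
      then show "f i dvd g i" by (simp add: dvd_eq_mod_eq_0)
    qed
  next
    assume "\<forall>i\<in>I. f i dvd g i"
    then show "\<forall>s\<in>S. C g s = 0"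
      by (auto simp: C_def S)
  qed
  have C_G: "C (G c) s = c s" if "s \<in> S" for c s
  proof -
    have "G c (fst s) mod f (fst s) = G c (fst s)"
    proof (cases "G c (fst s) = 0")
      case False
      have "Polynomial.degree (G c (fst s)) < Polynomial.degree (f (fst s))"
        using False coeff_G[of c "fst s" "Polynomial.degree (G c (fst s))"] leading_coeff_0_iff[of "G c (fst s)"]
        by (auto split: if_splits)
      then show ?thesis by (rule mod_poly_less)
    qed simp
    then show ?thesis
      using that by (auto simp: C_def coeff_G S)
  qed
  show ?thesis
  proof
    assume dec: "cyclic_decomp I z f"
    have "\<forall>s\<in>S. c s = 0" if "(\<Sum>s\<in>S. scale (c s) ((u ^^ snd s) (z (fst s)))) = 0" for c
      using that cyclic_decompD(3)[OF dec, of "G c"] zero_iff[of "G c"] C_G[of _ c]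
      unfolding sum_S by simp
    moreover have "\<exists>c. v = (\<Sum>s\<in>S. scale (c s) ((u ^^ snd s) (z (fst s))))" for v
    proof -
      obtain g where "v = (\<Sum>i\<in>I. E (g i) (z i))"
        using cyclic_decompD(2)[OF dec] by blast
      then show ?thesis
        unfolding sum_E by blast
    qed
    ultimately show "(\<forall>c. (\<Sum>s\<in>S. scale (c s) ((u ^^ snd s) (z (fst s)))) = 0 \<longrightarrow> (\<forall>s\<in>S. c s = 0)) \<and>
      (\<forall>v. \<exists>c. v = (\<Sum>s\<in>S. scale (c s) ((u ^^ snd s) (z (fst s)))))"
      by blast
  next
    assume R: "(\<forall>c. (\<Sum>s\<in>S. scale (c s) ((u ^^ snd s) (z (fst s)))) = 0 \<longrightarrow> (\<forall>s\<in>S. c s = 0)) \<and>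
      (\<forall>v. \<exists>c. v = (\<Sum>s\<in>S. scale (c s) ((u ^^ snd s) (z (fst s)))))"
    have "\<exists>g. v = (\<Sum>i\<in>I. E (g i) (z i))" for v
    proof -
      obtain c where "v = (\<Sum>s\<in>S. scale (c s) ((u ^^ snd s) (z (fst s))))"
        using R by blast
      then show ?thesis
        unfolding sum_S by (intro exI[of _ "G c"])
    qed
    moreover have "(\<Sum>i\<in>I. E (g i) (z i)) = 0 \<longleftrightarrow> (\<forall>i\<in>I. f i dvd g i)" for g
    proof
      assume "(\<Sum>i\<in>I. E (g i) (z i)) = 0"
      then show "\<forall>i\<in>I. f i dvd g i"
        using R zero_iff unfolding sum_E by blast
    next
      assume "\<forall>i\<in>I. f i dvd g i"
      then show "(\<Sum>i\<in>I. E (g i) (z i)) = 0"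
        using E_dvd z by (intro sum.neutral) blast
    qed
    ultimately show "cyclic_decomp I z f"
      using I unfolding cyclic_decomp_def by blast
  qed
qed

text \<open>This passes from matrices to modules: the chains found by
  \<open>acts_as_companions\<close> form a basis exactly when their generators decompose the
  module.\<close>

theorem represents_companions_iff:
  assumes monic: "\<forall>f\<in>set fs. lead_coeff f = 1"
  shows "(\<exists>bs. represents scale bs u (diag_block_mat (map companion fs))) \<longleftrightarrow>
    (\<exists>z. cyclic_decomp {..<length fs} z ((!) fs))"
proof -
  let ?n = "\<lambda>i. Polynomial.degree (fs ! i)"
  \<comment> \<open>\<open>ps\<close> lists the pairs of a block number and an exponent in the order
    in which the chains are concatenated.\<close>
  define ps where "ps = concat (map (\<lambda>i. map (Pair i) [0..<?n i]) [0..<length fs])"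
  let ?S = "Sigma {..<length fs} (\<lambda>i. {..<?n i})"
  have ps: "set ps = ?S"
    by (auto simp: ps_def)
  have dist: "distinct ps"
    unfolding ps_def by (rule distinct_concat_map_Pair) simp
  have fin: "finite ?S" by auto
  have chains: "concat (map (\<lambda>i. chain (z i) (?n i)) [0..<length fs]) = map (\<lambda>s. (u ^^ snd s) (z (fst s))) ps" for z
    unfolding ps_def by (simp add: map_concat o_def)
  have key: "represents scale bs u (diag_block_mat (map companion fs)) \<longleftrightarrow>
      (\<exists>z. bs = map (\<lambda>s. (u ^^ snd s) (z (fst s))) ps \<and> cyclic_decomp {..<length fs} z ((!) fs))" for bs
  proof -
    have "represents scale bs u (diag_block_mat (map companion fs)) \<longleftrightarrow>
      distinct bs \<and> independent (set bs) \<and> span (set bs) = UNIV \<and> acts_as bs (diag_block_mat (map companion fs))"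
      unfolding represents_def acts_as_def by blast
    also have "\<dots> \<longleftrightarrow> (\<exists>z. bs = map (\<lambda>s. (u ^^ snd s) (z (fst s))) ps \<and>
        (\<forall>i<length fs. E (fs ! i) (z i) = 0) \<and>
        inj_on (\<lambda>s. (u ^^ snd s) (z (fst s))) ?S \<and>
        independent ((\<lambda>s. (u ^^ snd s) (z (fst s))) ` ?S) \<and>
        span ((\<lambda>s. (u ^^ snd s) (z (fst s))) ` ?S) = UNIV)"
      unfolding acts_as_companions[OF monic] chains
      using dist by (auto simp: distinct_map ps)
    also have "\<dots> \<longleftrightarrow> (\<exists>z. bs = map (\<lambda>s. (u ^^ snd s) (z (fst s))) ps \<and> (\<forall>i<length fs. E (fs ! i) (z i) = 0) \<and>
        cyclic_decomp {..<length fs} z ((!) fs))"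
    proof -
      have "cyclic_decomp {..<length fs} z ((!) fs) \<longleftrightarrow> inj_on (\<lambda>s. (u ^^ snd s) (z (fst s))) ?S \<and>
        independent ((\<lambda>s. (u ^^ snd s) (z (fst s))) ` ?S) \<and>
        span ((\<lambda>s. (u ^^ snd s) (z (fst s))) ` ?S) = UNIV"
        if "\<forall>i<length fs. E (fs ! i) (z i) = 0" for z
        unfolding basis_family_iff[OF fin]
        using cyclic_decomp_iff_basis[of "{..<length fs}" "(!) fs" z ?S] monic that by simp
      then show ?thesis by blast
    qed
    also have "\<dots> \<longleftrightarrow> (\<exists>z. bs = map (\<lambda>s. (u ^^ snd s) (z (fst s))) ps \<and> cyclic_decomp {..<length fs} z ((!) fs))"
    proof -
      have "\<forall>i<length fs. E (fs ! i) (z i) = 0" if "cyclic_decomp {..<length fs} z ((!) fs)" for z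
        using cyclic_decomp_order[OF that] by simp
      then show ?thesis by blast
    qed
    finally show ?thesis .
  qed
  show ?thesis
    unfolding key by blast
qed

end

subsection \<open>The twisted derivation\<close>

text \<open>The trace hypothesis appears here in a form that does not mention the characteristic:
  the polynomial in \<open>nondegenerate\<close> vanishes only if 2 = 0 and
  \<open>poly_trace p = y1 + y2\<close>.\<close>

locale shifted_pair =
  fixes p :: "'a::field poly" and y1 y2 :: 'a
  assumes monic_p: "lead_coeff p = 1" and degree_p: "Polynomial.degree p = 2"
    and irreducible_p: "Factorial_Ring.irreducible p"
    and y12: "y1 \<noteq> y2"
    and nondegenerate: "[:y1 + y2 - poly_trace p, 2:] \<noteq> 0"
begin

abbreviation "p1 \<equiv> p \<circ>\<^sub>p [:y1, 1:]"
abbreviation "p2 \<equiv> p \<circ>\<^sub>p [:y2, 1:]"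

definition \<delta> :: 'a where
  "\<delta> = poly_trace p - (y1 + y2)"

text \<open>This is \<open>t - \<sigma> t\<close>, the common divisor of all differences
  \<open>g - \<sigma> g\<close>.\<close>

definition \<epsilon> :: "'a poly" where
  "\<epsilon> = [:- \<delta>, 2:]"

definition \<sigma> :: "'a poly \<Rightarrow> 'a poly" where
  "\<sigma> g = g \<circ>\<^sub>p [:\<delta>, -1:]"

text \<open>The divided difference operator of the reflection
  \<open>t \<mapsto> \<delta> - t\<close>. The division is exact, as
  \<open>\<epsilon>_\<tau>\<close> shows.\<close>

definition \<tau> :: "'a poly \<Rightarrow> 'a poly" where
  "\<tau> g = (g - \<sigma> g) div \<epsilon>"

lemma \<epsilon>_nonzero: "\<epsilon> \<noteq> 0"
  using nondegenerate by (simp add: \<epsilon>_def \<delta>_def)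

lemma p_eq: "p = [:Polynomial.coeff p 0, - poly_trace p, 1:]"
proof (rule poly_eqI)
  fix k
  show "Polynomial.coeff p k = Polynomial.coeff [:Polynomial.coeff p 0, - poly_trace p, 1:] k"
    using monic_p degree_p coeff_eq_0[of p k]
    by (auto simp: poly_trace_def coeff_pCons numeral_2_eq_2 split: nat.split)
qed

section \<open>Rules for the involution and the twisted derivation\<close>

lemma \<sigma>_simps [simp]:
  "\<sigma> (f + g) = \<sigma> f + \<sigma> g" "\<sigma> (f - g) = \<sigma> f - \<sigma> g" "\<sigma> (f * g) = \<sigma> f * \<sigma> g"
  "\<sigma> (- f) = - \<sigma> f" "\<sigma> (Polynomial.smult c f) = Polynomial.smult c (\<sigma> f)"
  "\<sigma> 0 = 0" "\<sigma> 1 = 1" "\<sigma> [:c:] = [:c:]" "\<sigma> (pCons c f) = [:c:] + [:\<delta>, -1:] * \<sigma> f"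
  by (simp_all add: \<sigma>_def pcompose_add pcompose_diff pcompose_uminus pcompose_smult
    pcompose_mult pcompose_pCons)

lemma \<sigma>_power: "\<sigma> (f ^ n) = \<sigma> f ^ n"
  by (induction n) simp_all

lemma \<sigma>_\<sigma> [simp]: "\<sigma> (\<sigma> f) = f"
  by (simp add: \<sigma>_def pcompose_pCons flip: pcompose_assoc)

text \<open>The quadratic \<open>p\<close> is invariant under \<open>s \<mapsto> tr p - s\<close>,
  and \<open>\<delta> - t + y1 = tr p - (t + y2)\<close>.\<close>

lemma \<sigma>_p1 [simp]: "\<sigma> p1 = p2"
  by (subst p_eq, subst (2) p_eq) (simp add: pcompose_pCons \<delta>_def algebra_simps)

lemma \<sigma>_p2 [simp]: "\<sigma> p2 = p1"
  using \<sigma>_\<sigma>[of p1] by simp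

lemma smult_2: "Polynomial.smult 2 f = f + f" for f :: "'a poly"
  by (rule poly_eqI) (simp only: coeff_smult Polynomial.coeff_add mult_2)

lemma \<epsilon>_\<tau>: "\<epsilon> * \<tau> g = g - \<sigma> g"
proof -
  have "\<epsilon> dvd g - \<sigma> g"
  proof (induction g)
    case (pCons c g)
    \<comment> \<open>The case \<open>f = t\<close> of \<open>f g - \<sigma> (f g) = f (g - \<sigma>
      g) + (f - \<sigma> f) \<sigma> g\<close>; the constant \<open>c\<close> cancels.\<close>
    have "pCons c g - \<sigma> (pCons c g) = [:0, 1:] * (g - \<sigma> g) + \<epsilon> * \<sigma> g"
      by (simp add: \<epsilon>_def algebra_simps smult_2)
    then show ?case
      using pCons by (metis dvd_add dvd_mult dvd_triv_left)
  qed simp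
  then show ?thesis
    by (simp add: \<tau>_def)
qed

lemma \<tau>_eqI: "\<epsilon> * h = g - \<sigma> g \<Longrightarrow> \<tau> g = h"
  using \<epsilon>_\<tau>[of g] \<epsilon>_nonzero by (metis mult_cancel_left)

lemma \<tau>_add [simp]: "\<tau> (f + g) = \<tau> f + \<tau> g"
  by (rule \<tau>_eqI) (simp add: distrib_left \<epsilon>_\<tau>)

lemma \<tau>_diff [simp]: "\<tau> (f - g) = \<tau> f - \<tau> g"
  by (rule \<tau>_eqI) (simp add: right_diff_distrib \<epsilon>_\<tau>)

text \<open>Twisted Leibniz rule, from \<open>f g - \<sigma> (f g) = (f - \<sigma> f) g + \<sigma> f
  (g - \<sigma> g)\<close>.\<close>

lemma \<tau>_mult: "\<tau> (f * g) = \<tau> f * g + \<sigma> f * \<tau> g"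
proof (rule \<tau>_eqI)
  have "\<epsilon> * (\<tau> f * g + \<sigma> f * \<tau> g) = (\<epsilon> * \<tau> f) * g + \<sigma> f * (\<epsilon> * \<tau> g)"
    by (simp add: algebra_simps)
  then show "\<epsilon> * (\<tau> f * g + \<sigma> f * \<tau> g) = f * g - \<sigma> (f * g)"
    by (simp add: \<epsilon>_\<tau> algebra_simps)
qed

text \<open>Both \<open>\<epsilon>\<close> and \<open>g - \<sigma> g\<close> change sign under
  \<open>\<sigma>\<close>, so their quotient is invariant.\<close>

lemma \<sigma>_\<tau> [simp]: "\<sigma> (\<tau> g) = \<tau> g"
proof -
  have "\<sigma> \<epsilon> = - \<epsilon>"
    by (simp add: \<epsilon>_def)
  then have "\<epsilon> * \<sigma> (\<tau> g) = - \<sigma> (\<epsilon> * \<tau> g)"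
    by simp
  also have "\<dots> = \<epsilon> * \<tau> g"
    unfolding \<epsilon>_\<tau> by simp
  finally show ?thesis
    using \<epsilon>_nonzero by simp
qed

lemma \<tau>_invariant: "\<sigma> g = g \<Longrightarrow> \<tau> g = 0"
  by (rule \<tau>_eqI) simp

lemma \<tau>_const [simp]: "\<tau> [:c:] = 0"
  by (rule \<tau>_invariant) simp

lemma \<tau>_smult [simp]: "\<tau> (Polynomial.smult c g) = Polynomial.smult c (\<tau> g)"
  using \<tau>_mult[of "[:c:]" g] by simp

lemma \<tau>_X [simp]: "\<tau> [:0, 1:] = 1"
  by (rule \<tau>_eqI) (simp add: \<epsilon>_def)

lemma p1_minus_p2: "p1 - p2 = [:y1 - y2:] * \<epsilon>"
  by (subst p_eq, subst (2) p_eq) (simp add: pcompose_pCons \<delta>_def \<epsilon>_def algebra_simps)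

lemma \<tau>_p1 [simp]: "\<tau> p1 = [:y1 - y2:]"
  by (rule \<tau>_eqI) (simp only: \<sigma>_p1 p1_minus_p2 mult.commute)

lemma monic_p1: "lead_coeff p1 = 1"
  using lead_coeff_comp[of "[:y1, 1:]" p] monic_p by simp

lemma degree_p1: "Polynomial.degree p1 = 2"
  using degree_p by (simp add: degree_pcompose)

text \<open>The shift \<open>t \<mapsto> t - y1\<close> preserves degrees and carries a
  factorization of \<open>p1\<close> to one of \<open>p\<close>.\<close>

lemma irreducible_p1: "Factorial_Ring.irreducible p1"
proof (rule irreducibleI)
  show nz: "p1 \<noteq> 0"
    using degree_p1 by (metis degree_0 zero_neq_numeral)
  show "\<not> is_unit p1"
    using degree_p1 is_unit_iff_degree[OF nz] by simp
  fix a b assume ab: "p1 = a * b"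
  let ?s = "\<lambda>f. f \<circ>\<^sub>p [:- y1, 1:]"
  have "?s p1 = p"
    by (simp add: pcompose_pCons flip: pcompose_assoc)
  then have "p = ?s a * ?s b"
    unfolding ab by (simp add: pcompose_mult)
  then have "is_unit (?s a) \<or> is_unit (?s b)"
    using irreducible_p irreducibleD by blast
  moreover have "is_unit f" if "is_unit (?s f)" for f
  proof -
    have "f \<noteq> 0" using that by auto
    moreover have "Polynomial.degree f = 0"
      using that by (auto simp: is_unit_iff_degree degree_pcompose)
    ultimately show ?thesis by (simp add: is_unit_iff_degree)
  qed
  ultimately show "is_unit a \<or> is_unit b" by blast
qed

text \<open>Multiplication by \<open>t\<close> equals \<open>a_op - b_op\<close> on \<open>F[t]\<close>, where \<open>b_op\<close> is \<open>y1\<close> on the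
  \<open>\<sigma>\<close>-invariant subring generated by \<open>t (\<delta> - t)\<close> and \<open>y2\<close> on its multiple by \<open>p1\<close>.\<close>

definition b_op :: "'a poly \<Rightarrow> 'a poly" where
  "b_op g = [:y1:] * g - p1 * \<tau> g"

definition a_op :: "'a poly \<Rightarrow> 'a poly" where
  "a_op g = [:0, 1:] * g + b_op g"

text \<open>\<open>\<tau> g\<close> is invariant, so \<open>\<tau>\<close> acts on
  \<open>p1 * \<tau> g\<close> through \<open>\<tau> p1 = y1 - y2\<close> alone.\<close>

lemma \<tau>_b_op: "\<tau> (b_op g) = [:y2:] * \<tau> g"
proof -
  have "\<tau> (b_op g) = [:y1:] * \<tau> g - [:y1 - y2:] * \<tau> g"
    by (simp add: b_op_def \<tau>_mult \<tau>_invariant)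
  also have "\<dots> = ([:y1:] - [:y1 - y2:]) * \<tau> g"
    by (simp only: left_diff_distrib)
  finally show ?thesis by simp
qed

text \<open>Writing \<open>b\<close> for \<open>b_op\<close>, one has
  \<open>(b - y1) (b g) = - p1 * \<tau> (b g) = y2 (b - y1) g\<close>, hence
  \<open>(b - y2) (b - y1) = 0\<close>.\<close>

lemma b_op_quadratic: "b_op (b_op g) - [:y1 + y2:] * b_op g + [:y1 * y2:] * g = 0"
proof -
  have c: "[:y1 + y2:] = [:y1:] + [:y2:]" "[:y1 * y2:] = [:y1:] * [:y2:]"
    by simp_all
  have ring: "a * (a * g - P * h) - P * (b * h) - (a + b) * (a * g - P * h) + a * b * g = 0"
    for a b P h :: "'a poly"
    by (simp add: algebra_simps)
  have "b_op (b_op g) = [:y1:] * b_op g - p1 * ([:y2:] * \<tau> g)"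
    unfolding b_op_def[of "b_op g"] \<tau>_b_op ..
  then show ?thesis
    unfolding c by (simp only: b_op_def[of g] ring)
qed

lemma p1_expand: "p1 = ([:0, 1:] + [:y1:]) * ([:0, 1:] + [:y1:]) - [:poly_trace p:] * ([:0, 1:] + [:y1:]) + [:Polynomial.coeff p 0:]"
  by (subst p_eq, subst (2) p_eq) (simp add: pcompose_pCons algebra_simps)

text \<open>After expansion by the twisted Leibniz rule all terms containing \<open>\<tau> g\<close>
  cancel, and what remains is \<open>p(t + y1) g - p1 g\<close>.\<close>

lemma a_op_quadratic: "a_op (a_op g) - [:poly_trace p:] * a_op g + [:Polynomial.coeff p 0:] * g = 0"
proof -
  let ?X = "[:0, 1:] :: 'a poly" and ?Y1 = "[:y1:]" and ?Y2 = "[:y2:]" and ?L = "[:poly_trace p:]"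
  have sX: "\<sigma> ?X = ?L - ?Y1 - ?Y2 - ?X"
    by (simp add: \<delta>_def)
  have ring1: "1 * g + (l - a - b - x) * h + b * h = g + (l - a - x) * h"
    for l x a b h :: "'a poly"
    by (simp add: algebra_simps)
  have ring2: "(x + a) * ((x + a) * g - P * h) - P * (g + (l - a - x) * h) - l * ((x + a) * g - P * h) + c * g =
      ((x + a) * (x + a) - l * (x + a) + c) * g - P * g" for l x a c h P :: "'a poly"
    by (simp add: algebra_simps)
  have a: "a_op g = (?X + ?Y1) * g - p1 * \<tau> g"
    by (simp add: a_op_def b_op_def distrib_right)
  have "\<tau> (a_op g) = g + (?L - ?Y1 - ?X) * \<tau> g"
    unfolding a_op_def by (simp only: \<tau>_add \<tau>_mult \<tau>_X \<tau>_b_op sX ring1)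
  then have aa: "a_op (a_op g) = (?X + ?Y1) * a_op g - p1 * (g + (?L - ?Y1 - ?X) * \<tau> g)"
    by (simp add: a_op_def[of "a_op g"] b_op_def[of "a_op g"] distrib_right)
  have "a_op (a_op g) - ?L * a_op g + [:Polynomial.coeff p 0:] * g =
      ((?X + ?Y1) * (?X + ?Y1) - ?L * (?X + ?Y1) + [:Polynomial.coeff p 0:]) * g - p1 * g"
    unfolding aa unfolding a by (rule ring2)
  then show ?thesis
    by (simp only: p1_expand[symmetric]) simp
qed

lemma b_op_linear: "b_op (f + g) = b_op f + b_op g" "b_op ([:c:] * g) = [:c:] * b_op g"
  by (simp_all add: b_op_def smult_add_right algebra_simps)

text \<open>The product \<open>p1 ^ n * p2 ^ n\<close> is invariant under \<open>\<sigma>\<close>,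
  so \<open>b_op\<close> commutes with multiplication by it. An extra factor \<open>p1\<close>
  survives because \<open>b_op (p1 * h)\<close> is again a multiple of \<open>p1\<close>.\<close>

lemma b_op_dvd:
  assumes "m = n \<or> m = Suc n" "p1 ^ m * p2 ^ n dvd g"
  shows "p1 ^ m * p2 ^ n dvd b_op g"
proof -
  obtain h where h: "g = p1 ^ m * p2 ^ n * h"
    using assms(2) ..
  have inv: "\<tau> (p1 ^ n * p2 ^ n * k) = p1 ^ n * p2 ^ n * \<tau> k" for k
  proof -
    have "\<sigma> (p1 ^ n * p2 ^ n) = p1 ^ n * p2 ^ n"
      by (simp add: \<sigma>_power)
    then show ?thesis
      using \<tau>_mult[of "p1 ^ n * p2 ^ n" k] \<tau>_invariant[of "p1 ^ n * p2 ^ n"] by simp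
  qed
  from assms(1) show ?thesis
  proof
    assume m: "m = n"
    have "b_op g = p1 ^ m * p2 ^ n * ([:y1:] * h - p1 * \<tau> h)"
      unfolding h m b_op_def inv by (simp add: algebra_simps)
    then show ?thesis by simp
  next
    assume m: "m = Suc n"
    have g: "g = p1 ^ n * p2 ^ n * (p1 * h)"
      unfolding h m by (simp add: algebra_simps)
    have "b_op g = p1 ^ m * p2 ^ n * ([:y1:] * h - \<tau> (p1 * h))"
      unfolding g b_op_def inv unfolding m by (simp add: algebra_simps)
    then show ?thesis by simp
  qed
qed

end

text \<open>Exchanging the roots leaves \<open>\<delta>\<close>, \<open>\<epsilon>\<close> and
  \<open>\<sigma>\<close> unchanged but swaps \<open>p1\<close> and \<open>p2\<close>. The operator
  \<open>swap.b_op\<close> serves the ideals in which \<open>p2\<close> has the larger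
  exponent.\<close>

sublocale shifted_pair \<subseteq> swap: shifted_pair p y2 y1
  rewrites "swap.\<delta> = \<delta>" and "swap.\<epsilon> = \<epsilon>" and "swap.\<sigma> = \<sigma>"
proof -
  show s: "shifted_pair p y2 y1"
    by unfold_locales (use monic_p degree_p irreducible_p y12 nondegenerate in \<open>simp_all add: add.commute\<close>)
  show d: "shifted_pair.\<delta> p y2 y1 = \<delta>"
    by (simp add: shifted_pair.\<delta>_def[OF s] \<delta>_def add.commute)
  show "shifted_pair.\<epsilon> p y2 y1 = \<epsilon>"
    by (simp add: shifted_pair.\<epsilon>_def[OF s] \<epsilon>_def d)
  show "shifted_pair.\<sigma> p y2 y1 = \<sigma>"
    by (intro ext) (simp add: shifted_pair.\<sigma>_def[OF s] \<sigma>_def d)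
qed

context shifted_pair
begin

text \<open>Being monic of equal degree, the two would coincide if \<open>p1\<close> divided
  \<open>p2\<close>, whereas their difference \<open>(y1 - y2) \<epsilon>\<close> is
  nonzero.\<close>

lemma coprime_p1_p2: "coprime p1 p2"
proof (rule irreducible_coprime_poly[OF irreducible_p1])
  show "\<not> p1 dvd p2"
  proof
    assume "p1 dvd p2"
    then obtain k where k: "p2 = p1 * k" ..
    have "p1 \<noteq> 0" "k \<noteq> 0"
      using swap.degree_p1 degree_p1 k by auto
    then have "Polynomial.degree k = 0"
      using degree_mult_eq[of p1 k] degree_p1 swap.degree_p1 unfolding k by simp
    moreover have "lead_coeff k = 1"
      using swap.monic_p1 monic_p1 unfolding k by (simp add: lead_coeff_mult)
    ultimately have "k = 1"
      using degree_0_id[of k] by (simp add: one_pCons)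
    then have "[:y1 - y2:] * \<epsilon> = 0"
      using k p1_minus_p2 by simp
    then show False
      using y12 \<epsilon>_nonzero by simp
  qed
qed

end

subsection \<open>Constructing a difference\<close>

context endo
begin

text \<open>An F-linear operator on F[t] that preserves the ideal of \<open>f i\<close> descends to
  the quotient, which is the cyclic module of \<open>z i\<close>. It need not commute with
  multiplication by \<open>t\<close>, so it is applied to the cofactors.\<close>

lemma cyclic_decomp_lift:
  assumes dec: "cyclic_decomp I z f"
    and add: "\<And>i g h. i \<in> I \<Longrightarrow> B i (g + h) = B i g + B i h"
    and smult: "\<And>i c g. i \<in> I \<Longrightarrow> B i ([:c:] * g) = [:c:] * B i g"
    and ideal: "\<And>i g. i \<in> I \<Longrightarrow> f i dvd g \<Longrightarrow> f i dvd B i g"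
  obtains b where "Vector_Spaces.linear scale scale b"
    and "\<And>g. b (\<Sum>i\<in>I. E (g i) (z i)) = (\<Sum>i\<in>I. E (B i (g i)) (z i))"
proof -
  \<comment> \<open>The cofactors of \<open>v\<close> are chosen arbitrarily; they are unique modulo
    \<open>f i\<close>, and \<open>ideal\<close> makes the result independent of the choice.\<close>
  define b where "b v = (\<Sum>i\<in>I. E (B i ((SOME g. v = (\<Sum>i\<in>I. E (g i) (z i))) i)) (z i))" for v
  have b: "b (\<Sum>i\<in>I. E (g i) (z i)) = (\<Sum>i\<in>I. E (B i (g i)) (z i))" for g
  proof -
    define h where "h = (SOME h. (\<Sum>i\<in>I. E (g i) (z i)) = (\<Sum>i\<in>I. E (h i) (z i)))"
    have h: "(\<Sum>i\<in>I. E (g i) (z i)) = (\<Sum>i\<in>I. E (h i) (z i))"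
      unfolding h_def by (rule someI[of _ g]) simp
    then have "(\<Sum>i\<in>I. E (g i - h i) (z i)) = 0"
      by (simp add: E_diff_left sum_subtractf)
    then have dvd: "\<forall>i\<in>I. f i dvd g i - h i"
      using cyclic_decompD(3)[OF dec, of "\<lambda>i. g i - h i"] by blast
    have "f i dvd B i (g i) - B i (h i)" if i: "i \<in> I" for i
    proof -
      have "B i (g i) = B i (g i - h i) + B i (h i)"
        using add[OF i, of "g i - h i" "h i"] by simp
      then show ?thesis
        using ideal[OF i] dvd i by simp
    qed
    then have "(\<Sum>i\<in>I. E (B i (g i) - B i (h i)) (z i)) = 0"
      using cyclic_decompD(3)[OF dec, of "\<lambda>i. B i (g i) - B i (h i)"] by blast
    then have "(\<Sum>i\<in>I. E (B i (g i)) (z i)) = (\<Sum>i\<in>I. E (B i (h i)) (z i))"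
      by (simp add: E_diff_left sum_subtractf)
    then show ?thesis
      by (simp add: b_def h_def)
  qed
  have "b (v + w) = b v + b w" for v w
  proof -
    obtain g h where v: "v = (\<Sum>i\<in>I. E (g i) (z i))" and w: "w = (\<Sum>i\<in>I. E (h i) (z i))"
      using cyclic_decompD(2)[OF dec] by metis
    have "v + w = (\<Sum>i\<in>I. E (g i + h i) (z i))"
      by (simp add: v w E_add_left sum.distrib)
    then have "b (v + w) = (\<Sum>i\<in>I. E (B i (g i + h i)) (z i))"
      using b by simp
    also have "\<dots> = (\<Sum>i\<in>I. E (B i (g i)) (z i) + E (B i (h i)) (z i))"
      by (rule sum.cong) (simp_all add: add E_add_left)
    also have "\<dots> = b v + b w"
      unfolding v w b by (simp add: sum.distrib)
    finally show ?thesis .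
  qed
  moreover have "b (scale c v) = scale c (b v)" for c v
  proof -
    obtain g where v: "v = (\<Sum>i\<in>I. E (g i) (z i))"
      using cyclic_decompD(2)[OF dec] by metis
    have "scale c v = (\<Sum>i\<in>I. E ([:c:] * g i) (z i))"
      by (simp add: v E_smult_left scale_sum_right)
    then have "b (scale c v) = (\<Sum>i\<in>I. E (B i ([:c:] * g i)) (z i))"
      using b[of "\<lambda>i. [:c:] * g i"] by simp
    also have "\<dots> = (\<Sum>i\<in>I. scale c (E (B i (g i)) (z i)))"
      by (rule sum.cong) (simp_all add: smult E_smult_left del: mult_pCons_left, simp add: E_smult_left)
    also have "\<dots> = scale c (b v)"
      unfolding v b by (simp add: scale_sum_right)
    finally show ?thesis .
  qed
  ultimately have "Vector_Spaces.linear scale scale b"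
    using vector_space_axioms by (simp add: Vector_Spaces.linear_iff)
  then show ?thesis using b that by blast
qed

end

lemma (in vector_space) linear_poly_endo_quadratic:
  assumes "Vector_Spaces.linear scale scale h"
  shows "poly_endo scale [:c0, c1, 1:] h v = scale c0 v + scale c1 (h v) + h (h v)"
  by (simp add: poly_endo_def numeral_2_eq_2)

text \<open>On each summand \<open>b\<close> is induced by \<open>b_op\<close> or
  \<open>swap.b_op\<close>, and \<open>a = u + b\<close> by the matching \<open>a_op\<close>. The
  quadratic equations hold already on F[t].\<close>

lemma (in endo) pq_difference_of_cyclic_decomp:
  assumes sp: "shifted_pair p y1 y2"
    and dec: "cyclic_decomp I z (\<lambda>i. (p \<circ>\<^sub>p [:y1, 1:]) ^ \<alpha> i * (p \<circ>\<^sub>p [:y2, 1:]) ^ \<beta> i)"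
    and close: "\<And>i. i \<in> I \<Longrightarrow> \<bar>int (\<alpha> i) - int (\<beta> i)\<bar> \<le> 1"
  shows "pq_difference scale p ([:- y1, 1:] * [:- y2, 1:]) u"
proof -
  interpret shifted_pair p y1 y2 by (fact sp)
  \<comment> \<open>The choice depends on which prime has the larger exponent, so that the ideal of
    the summand is preserved.\<close>
  define B where "B i = (if \<beta> i \<le> \<alpha> i then b_op else swap.b_op)" for i
  have B_quadratic: "B i (B i g) - [:y1 + y2:] * B i g + [:y1 * y2:] * g = 0" for i g
    using b_op_quadratic[of g] swap.b_op_quadratic[of g] by (simp add: B_def add.commute mult.commute)
  have A_quadratic: "([:0, 1:] * ([:0, 1:] * g + B i g) + B i ([:0, 1:] * g + B i g)) -
      [:poly_trace p:] * ([:0, 1:] * g + B i g) + [:Polynomial.coeff p 0:] * g = 0" for i g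
    using a_op_quadratic[of g] swap.a_op_quadratic[of g]
    by (simp only: B_def a_op_def swap.a_op_def split: if_splits) blast
  have B_linear: "B i (f + g) = B i f + B i g" "B i ([:c:] * g) = [:c:] * B i g" for i f g c
    using b_op_linear swap.b_op_linear by (auto simp only: B_def split: if_splits)
  have B_ideal: "p1 ^ \<alpha> i * p2 ^ \<beta> i dvd B i g" if "i \<in> I" "p1 ^ \<alpha> i * p2 ^ \<beta> i dvd g" for i g
  proof (cases "\<beta> i \<le> \<alpha> i")
    case True
    then have "\<alpha> i = \<beta> i \<or> \<alpha> i = Suc (\<beta> i)"
      using close[OF that(1)] by linarith
    then show ?thesis
      using b_op_dvd that(2) True by (simp add: B_def)
  next
    case False
    then have "\<beta> i = Suc (\<alpha> i)"
      using close[OF that(1)] by linarith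
    then show ?thesis
      using swap.b_op_dvd[of "\<beta> i" "\<alpha> i" g] that(2) False by (simp add: B_def mult.commute)
  qed
  obtain b where lin: "Vector_Spaces.linear scale scale b"
    and b: "\<And>g. b (\<Sum>i\<in>I. E (g i) (z i)) = (\<Sum>i\<in>I. E (B i (g i)) (z i))"
  proof (rule cyclic_decomp_lift[OF dec, of B])
    fix i g assume "i \<in> I" "p1 ^ \<alpha> i * p2 ^ \<beta> i dvd g"
    then show "p1 ^ \<alpha> i * p2 ^ \<beta> i dvd B i g"
      by (rule B_ideal)
  next
    fix b
    assume "Vector_Spaces.linear scale scale b"
      "\<And>g. b (\<Sum>i\<in>I. E (g i) (z i)) = (\<Sum>i\<in>I. E (B i (g i)) (z i))"
    then show thesis by (rule that)
  qed (rule B_linear)+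
  define a where "a v = u v + b v" for v
  have lin_a: "Vector_Spaces.linear scale scale a"
    using lin linear_u by (simp add: Vector_Spaces.linear_iff a_def algebra_simps)
  have a: "a (\<Sum>i\<in>I. E (g i) (z i)) = (\<Sum>i\<in>I. E ([:0, 1:] * g i + B i (g i)) (z i))" for g
    unfolding a_def b by (simp add: u_sum E_add_left sum.distrib E_pCons)
  have "poly_endo scale ([:- y1, 1:] * [:- y2, 1:]) b v = 0" for v
  proof -
    obtain g where v: "v = (\<Sum>i\<in>I. E (g i) (z i))"
      using cyclic_decompD(2)[OF dec] by blast
    have q: "[:- y1, 1:] * [:- y2, 1:] = [:y1 * y2, - (y1 + y2), 1:]"
      by simp
    have "poly_endo scale ([:- y1, 1:] * [:- y2, 1:]) b v =
        scale (y1 * y2) v - scale (y1 + y2) (b v) + b (b v)"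
      unfolding q linear_poly_endo_quadratic[OF lin] scale_minus_left by simp
    also have "\<dots> = (\<Sum>i\<in>I. E (B i (B i (g i)) - [:y1 + y2:] * B i (g i) + [:y1 * y2:] * g i) (z i))"
      unfolding v b
      by (simp add: E_add_left E_diff_left E_smult_left sum.distrib sum_subtractf scale_sum_right)
    also have "\<dots> = 0"
      unfolding B_quadratic by simp
    finally show ?thesis .
  qed
  moreover have "poly_endo scale p a v = 0" for v
  proof -
    obtain g where v: "v = (\<Sum>i\<in>I. E (g i) (z i))"
      using cyclic_decompD(2)[OF dec] by blast
    let ?A = "\<lambda>i g. [:0, 1:] * g + B i g"
    have "poly_endo scale p a v =
        scale (Polynomial.coeff p 0) v + scale (- poly_trace p) (a v) + a (a v)"
      using linear_poly_endo_quadratic[OF lin_a] p_eq by metis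
    also have "\<dots> = (\<Sum>i\<in>I. E (?A i (?A i (g i)) - [:poly_trace p:] * ?A i (g i) + [:Polynomial.coeff p 0:] * g i) (z i))"
      unfolding v a
      by (simp add: E_add_left[of _ "[:Polynomial.coeff p 0:] * _"] E_diff_left E_smult_left sum.distrib sum_subtractf scale_sum_right
          del: mult_pCons_left)
        (simp add: E_smult_left sum_negf)
    also have "\<dots> = 0"
      unfolding A_quadratic by simp
    finally show ?thesis .
  qed
  ultimately show ?thesis
    unfolding pq_difference_def annihilates_def using lin lin_a
    by (intro exI[of _ a] exI[of _ b]) (simp add: a_def)
qed

subsection \<open>Eigenvalues\<close>

context endo
begin

abbreviation coord :: "'b list \<Rightarrow> 'b \<Rightarrow> nat \<Rightarrow> 'a" where
  "coord bs v i \<equiv> representation (set bs) v (bs ! i)"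

lemma representsD:
  assumes "represents scale bs u M"
  shows "distinct bs" "independent (set bs)" "span (set bs) = UNIV"
    "M \<in> carrier_mat (length bs) (length bs)"
    "j < length bs \<Longrightarrow> u (bs ! j) = (\<Sum>i<length bs. scale (M $$ (i, j)) (bs ! i))"
  using assms by (auto simp: represents_def)

lemma coord_sum:
  assumes "represents scale bs u M"
  shows "v = (\<Sum>i<length bs. scale (coord bs v i) (bs ! i))"
proof -
  note R = representsD[OF assms]
  have "v = (\<Sum>b\<in>set bs. scale (representation (set bs) v b) b)"
    using R(2,3) by (simp add: sum_representation_eq)
  also have "\<dots> = (\<Sum>i<length bs. scale (coord bs v i) (bs ! i))"
    by (rule sum.reindex_bij_betw[OF bij_betw_nth[OF R(1)], symmetric]) auto
  finally show ?thesis .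
qed

lemma coord_linear:
  assumes "represents scale bs u M"
  shows "coord bs (v + w) i = coord bs v i + coord bs w i"
    "coord bs (scale c v) i = c * coord bs v i"
    "coord bs (\<Sum>x\<in>A. h x) i = (\<Sum>x\<in>A. coord bs (h x) i)"
proof -
  note R = representsD[OF assms]
  show "coord bs (v + w) i = coord bs v i + coord bs w i"
    "coord bs (scale c v) i = c * coord bs v i"
    "coord bs (\<Sum>x\<in>A. h x) i = (\<Sum>x\<in>A. coord bs (h x) i)"
    using R(2,3) by (simp_all add: representation_add representation_scale representation_sum)
qed

lemma coord_basis:
  assumes "represents scale bs u M" "i < length bs" "j < length bs"
  shows "coord bs (bs ! j) i = (if i = j then 1 else 0)"
  using representsD[OF assms(1)] assms(2,3)
  by (simp add: representation_basis nth_eq_iff_index_eq)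

lemma coord_u:
  assumes "represents scale bs u M" "i < length bs"
  shows "coord bs (u v) i = (\<Sum>j<length bs. M $$ (i, j) * coord bs v j)"
proof -
  have col: "coord bs (u (bs ! j)) i = M $$ (i, j)" if j: "j < length bs" for j
  proof -
    have "coord bs (u (bs ! j)) i = (\<Sum>k<length bs. M $$ (k, j) * coord bs (bs ! k) i)"
      by (simp add: representsD(5)[OF assms(1) j] coord_linear[OF assms(1)])
    also have "\<dots> = (\<Sum>k<length bs. if k = i then M $$ (i, j) else 0)"
      by (rule sum.cong) (auto simp: coord_basis[OF assms])
    finally show ?thesis
      using assms(2) by (simp add: sum.delta)
  qed
  have "coord bs (u v) i = coord bs (\<Sum>j<length bs. scale (coord bs v j) (u (bs ! j))) i"
    by (subst coord_sum[OF assms(1), of v]) (simp add: u_sum u_scale)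
  also have "\<dots> = (\<Sum>j<length bs. coord bs v j * M $$ (i, j))"
    by (simp add: coord_linear[OF assms(1)] col)
  finally show ?thesis
    by (simp add: mult.commute)
qed

lemma ex_represents:
  assumes "finite B" "independent B" "span B = UNIV"
  shows "\<exists>bs M. represents scale bs u M"
proof -
  obtain bs where bs: "set bs = B" "distinct bs"
    using finite_distinct_list[OF assms(1)] by blast
  define M where "M = mat (length bs) (length bs) (\<lambda>(i, j). representation B (u (bs ! j)) (bs ! i))"
  have "u (bs ! j) = (\<Sum>i<length bs. scale (M $$ (i, j)) (bs ! i))" if "j < length bs" for j
  proof -
    have "u (bs ! j) = (\<Sum>b\<in>B. scale (representation B (u (bs ! j)) b) b)"
      using assms by (simp add: sum_representation_eq)
    also have "\<dots> = (\<Sum>i<length bs. scale (representation B (u (bs ! j)) (bs ! i)) (bs ! i))"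
      unfolding bs(1)[symmetric]
      by (rule sum.reindex_bij_betw[OF bij_betw_nth[OF bs(2)], symmetric]) auto
    finally show ?thesis
      using that by (simp add: M_def)
  qed
  then have "represents scale bs u M"
    using assms bs unfolding represents_def by (simp add: M_def)
  then show ?thesis by blast
qed

text \<open>For an eigenvector \<open>y\<close> over the closure, \<open>f(M) y = f(x) y\<close>,
  and \<open>f(M) = 0\<close> because \<open>f(u) = 0\<close>.\<close>

lemma ac_eigenvalue_root:
  assumes eig: "ac_eigenvalue scale u x" and f: "\<And>v. E f v = 0"
  shows "poly (map_poly to_ac f) x = 0"
proof -
  obtain bs M where rep: "represents scale bs u M" and "eigenvalue (map_mat to_ac M) x"
    using eig unfolding ac_eigenvalue_def by blast
  then obtain y where y: "eigenvector (map_mat to_ac M) y x"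
    unfolding eigenvalue_def by blast
  let ?n = "length bs"
  have M: "M \<in> carrier_mat ?n ?n"
    using representsD(4)[OF rep] .
  have y_carrier: "y \<in> carrier_vec ?n" and "y \<noteq> 0\<^sub>v ?n" and eq: "map_mat to_ac M *\<^sub>v y = x \<cdot>\<^sub>v y"
    using y M unfolding eigenvector_def by auto
  have row: "(\<Sum>j<?n. to_ac (M $$ (i, j)) * y $ j) = x * y $ i" if i: "i < ?n" for i
  proof -
    have "(map_mat to_ac M *\<^sub>v y) $ i = (\<Sum>j<?n. to_ac (M $$ (i, j)) * y $ j)"
      using i M y_carrier by (simp add: scalar_prod_def lessThan_atLeast0)
    then show ?thesis
      using eq i y_carrier by simp
  qed
  \<comment> \<open>Column \<open>j\<close> of the \<open>k\<close>-th power of \<open>M\<close>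
    holds the coordinates of \<open>(u ^^ k) (bs ! j)\<close>, so this says that the power
    multiplies \<open>y\<close> by \<open>x ^ k\<close>.\<close>
  have pow: "(\<Sum>j<?n. to_ac (coord bs ((u ^^ k) (bs ! j)) i) * y $ j) = x ^ k * y $ i" if i: "i < ?n" for i k
    using i
  proof (induction k arbitrary: i)
    case 0
    have "(\<Sum>j<?n. to_ac (coord bs (bs ! j) i) * y $ j) = (\<Sum>j<?n. if j = i then y $ i else 0)"
      by (rule sum.cong) (use 0 in \<open>auto simp: coord_basis[OF rep]\<close>)
    then show ?case using 0 by (simp add: sum.delta)
  next
    case (Suc k)
    have "(\<Sum>j<?n. to_ac (coord bs ((u ^^ Suc k) (bs ! j)) i) * y $ j) =
        (\<Sum>j<?n. \<Sum>l<?n. to_ac (M $$ (i, l)) * (to_ac (coord bs ((u ^^ k) (bs ! j)) l) * y $ j))"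
      by (simp add: coord_u[OF rep Suc.prems] to_ac_sum sum_distrib_right mult.assoc)
    also have "\<dots> = (\<Sum>l<?n. to_ac (M $$ (i, l)) * (\<Sum>j<?n. to_ac (coord bs ((u ^^ k) (bs ! j)) l) * y $ j))"
      by (subst sum.swap) (simp add: sum_distrib_left)
    also have "\<dots> = (\<Sum>l<?n. x ^ k * (to_ac (M $$ (i, l)) * y $ l))"
      by (rule sum.cong) (simp_all add: Suc.IH)
    also have "\<dots> = x ^ Suc k * y $ i"
      by (simp add: row[OF Suc.prems] flip: sum_distrib_left)
    finally show ?case .
  qed
  obtain i where i: "i < ?n" "y $ i \<noteq> 0"
    using y_carrier \<open>y \<noteq> 0\<^sub>v ?n\<close> by (metis carrier_vecD eq_vecI index_zero_vec)
  have "0 = (\<Sum>j<?n. to_ac (coord bs (E f (bs ! j)) i) * y $ j)"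
    using coord_linear(2)[OF rep, of 0 0] by (simp add: f)
  also have "\<dots> = (\<Sum>j<?n. \<Sum>k\<le>Polynomial.degree f. to_ac (Polynomial.coeff f k) * (to_ac (coord bs ((u ^^ k) (bs ! j)) i) * y $ j))"
    by (simp add: poly_endo_def coord_linear[OF rep] to_ac_sum sum_distrib_right mult.assoc)
  also have "\<dots> = (\<Sum>k\<le>Polynomial.degree f. to_ac (Polynomial.coeff f k) * (\<Sum>j<?n. to_ac (coord bs ((u ^^ k) (bs ! j)) i) * y $ j))"
    by (subst sum.swap) (simp add: sum_distrib_left)
  also have "\<dots> = poly (map_poly to_ac f) x * y $ i"
    by (simp add: pow[OF i(1)] poly_altdef coeff_map_poly degree_map_poly sum_distrib_right mult.assoc)
  finally show ?thesis
    using i(2) by simp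
qed

text \<open>Over the closure \<open>g\<close> splits into linear factors. Applied to
  \<open>v\<close> one after another they reach zero, and the last nonzero vector before that is an
  eigenvector for a root of \<open>g\<close>.\<close>

lemma root_ac_eigenvalue:
  assumes rep: "represents scale bs u M" and g: "E g v = 0" and v: "v \<noteq> 0"
    and gnz: "g \<noteq> 0"
  shows "\<exists>x. poly (map_poly to_ac g) x = 0 \<and> ac_eigenvalue scale u x"
proof -
  let ?n = "length bs"
  let ?M = "map_mat to_ac M"
  have M: "M \<in> carrier_mat ?n ?n"
    using representsD(4)[OF rep] .
  \<comment> \<open>\<open>s k\<close> is the coordinate vector of \<open>(u ^^ k) v\<close>, and
    \<open>T G\<close> is \<open>G(M)\<close> applied to the coordinate vector of \<open>v\<close>;
    here \<open>G\<close> may have coefficients in the closure.\<close>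
  define s where "s k i = to_ac (coord bs ((u ^^ k) v) i)" for k i
  define T where "T G i = (\<Sum>k\<le>Polynomial.degree G. Polynomial.coeff G k * s k i)" for G :: "'a alg_closure poly" and i
  have T_bound: "T G i = (\<Sum>k\<le>n. Polynomial.coeff G k * s k i)" if "Polynomial.degree G \<le> n" for G n i
    unfolding T_def
    by (rule sum.mono_neutral_left) (use that in \<open>auto simp: coeff_eq_0\<close>)
  have T_pCons: "T (pCons c G) i = c * s 0 i + (\<Sum>j<?n. ?M $$ (i, j) * T G j)" if i: "i < ?n" for c G i
  proof -
    have s_Suc: "s (Suc k) i = (\<Sum>j<?n. ?M $$ (i, j) * s k j)" for k
      using i M by (simp add: s_def coord_u[OF rep i] to_ac_sum)
    have "T (pCons c G) i = (\<Sum>k\<le>Suc (Polynomial.degree G). Polynomial.coeff (pCons c G) k * s k i)"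
      by (rule T_bound) (simp add: degree_pCons_le)
    also have "\<dots> = c * s 0 i + (\<Sum>k\<le>Polynomial.degree G. Polynomial.coeff G k * s (Suc k) i)"
      by (subst sum.atMost_Suc_shift) simp
    also have "(\<Sum>k\<le>Polynomial.degree G. Polynomial.coeff G k * s (Suc k) i) = (\<Sum>j<?n. ?M $$ (i, j) * T G j)"
      unfolding s_Suc T_def sum_distrib_left by (subst sum.swap) (simp add: mult.left_commute)
    finally show ?thesis .
  qed
  have T_add: "T (F + G) i = T F i + T G i" for F G i
  proof -
    let ?m = "max (Polynomial.degree F) (Polynomial.degree G)"
    show ?thesis
      using T_bound[of F ?m] T_bound[of G ?m] T_bound[of "F + G" ?m]
      by (simp add: degree_add_le distrib_right sum.distrib)
  qed
  have T_smult: "T (Polynomial.smult c G) i = c * T G i" for c G i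
    using T_bound[of "Polynomial.smult c G" "Polynomial.degree G"]
    by (simp add: T_def sum_distrib_left mult.assoc)
  have T_map: "T (map_poly to_ac f) i = to_ac (coord bs (E f v) i)" for f i
    by (simp add: T_def poly_endo_def coord_linear[OF rep] to_ac_sum coeff_map_poly degree_map_poly s_def)
  \<comment> \<open>Here \<open>M - x\<close> kills the nonzero vector \<open>T G\<close>.\<close>
  have eigen: "ac_eigenvalue scale u x"
    if zero: "\<And>i. i < ?n \<Longrightarrow> T ([:- x, 1:] * G) i = 0" and nz: "k < ?n" "T G k \<noteq> 0" for x G k
  proof -
    define y where "y = vec ?n (T G)"
    have "(?M *\<^sub>v y) $ i = (x \<cdot>\<^sub>v y) $ i" if i: "i < ?n" for i
    proof -
      have eq: "[:- x, 1:] * G = Polynomial.smult (- x) G + pCons 0 G"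
        by simp
      have "T ([:- x, 1:] * G) i = - x * T G i + (\<Sum>j<?n. ?M $$ (i, j) * T G j)"
        by (simp only: eq T_add T_smult T_pCons[OF i] mult_zero_left add_0_left)
      then have "(\<Sum>j<?n. ?M $$ (i, j) * T G j) = x * T G i"
        using zero[OF i] by (simp add: add_eq_0_iff)
      then show ?thesis
        using i M by (simp add: y_def scalar_prod_def lessThan_atLeast0)
    qed
    then have "?M *\<^sub>v y = x \<cdot>\<^sub>v y"
      using M by (intro eq_vecI) (simp_all add: y_def)
    moreover have "y \<noteq> 0\<^sub>v ?n"
      using nz by (metis index_vec index_zero_vec(1) y_def)
    ultimately have "eigenvalue ?M x"
      unfolding eigenvalue_def eigenvector_def using M by (intro exI[of _ y]) (auto simp: y_def)
    then show ?thesis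
      unfolding ac_eigenvalue_def using rep by blast
  qed
  have key: "\<exists>x. poly F x = 0 \<and> ac_eigenvalue scale u x"
    if "F \<noteq> 0" "k < ?n" "T G k \<noteq> 0" "\<And>i. i < ?n \<Longrightarrow> T (F * G) i = 0" for F G k
    using that
  proof (induction "Polynomial.degree F" arbitrary: F G k)
    case 0
    then obtain c where "F = [:c:]" "c \<noteq> 0"
      by (metis degree_eq_zeroE pCons_0_0)
    then show ?case
      using 0 T_smult by simp
  next
    case (Suc d)
    then obtain x where x: "poly F x = 0"
      using alg_closed by (metis Zero_not_Suc alg_closed_imp_poly_has_root neq0_conv)
    then obtain F' where F: "F = [:- x, 1:] * F'"
      by (metis dvdE poly_eq_0_iff_dvd)
    have "F' \<noteq> 0" using Suc.prems(1) F by auto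
    then have "Polynomial.degree F = Suc (Polynomial.degree F')"
      unfolding F by (subst degree_mult_eq) auto
    then have deg: "d = Polynomial.degree F'"
      using Suc.hyps(2) by simp
    \<comment> \<open>With \<open>F = (t - x) F'\<close>, either the vector of \<open>F' * G\<close>
      is already zero and induction applies to \<open>F'\<close>, or it is an eigenvector for
      \<open>x\<close>.\<close>
    show ?case
    proof (cases "\<forall>i<?n. T (F' * G) i = 0")
      case True
      then obtain z where "poly F' z = 0" "ac_eigenvalue scale u z"
        using Suc.hyps(1)[OF deg \<open>F' \<noteq> 0\<close> Suc.prems(2,3)] by blast
      then show ?thesis
        unfolding F by auto
    next
      case False
      then obtain i where i: "i < ?n" "T (F' * G) i \<noteq> 0"
        by blast
      have "T ([:- x, 1:] * (F' * G)) i' = 0" if "i' < ?n" for i'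
        using Suc.prems(4)[OF that] unfolding F by (simp only: mult.assoc)
      then have "ac_eigenvalue scale u x"
        using i by (rule eigen)
      then show ?thesis using x by blast
    qed
  qed
  have "\<exists>k<?n. coord bs v k \<noteq> 0"
  proof (rule ccontr)
    assume "\<not> (\<exists>k<?n. coord bs v k \<noteq> 0)"
    then have "v = 0"
      using coord_sum[OF rep, of v] by simp
    then show False using v by simp
  qed
  then obtain k where k: "k < ?n" "T 1 k \<noteq> 0"
    using T_map[of 1] by auto
  have "T (map_poly to_ac g * 1) i = 0" for i
    using T_map[of g i] coord_linear(2)[OF rep, of 0 0] by (simp add: g)
  moreover have "map_poly to_ac g \<noteq> 0"
    using gnz by (simp add: map_poly_eq_0_iff)
  ultimately show ?thesis
    using key[OF _ k] by blast
qed

end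

subsection \<open>Twisted modules\<close>

lemma sum_Times_bool:
  "(\<Sum>x\<in>I \<times> (UNIV :: bool set). h x) = (\<Sum>i\<in>I. h (i, True)) + (\<Sum>i\<in>I. h (i, False))"
proof -
  have UB: "(UNIV :: bool set) = {True, False}" by auto
  have "(\<Sum>x\<in>I \<times> UNIV. h x) = (\<Sum>i\<in>I. \<Sum>e\<in>UNIV. h (i, e))"
    by (simp add: sum.cartesian_product)
  then show ?thesis by (simp add: UB sum.distrib)
qed

text \<open>Modules over the skew polynomial ring over F[t] in which
  \<open>w g = (\<sigma> g) w\<close>, with the further relation that \<open>w\<close> squares to
  \<open>p1 p2\<close>. Scalars commute with \<open>w\<close> since \<open>\<sigma>\<close> fixes
  constants.\<close>

locale twisted = endo scale u + shifted_pair p y1 y2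
  for scale :: "'a::field \<Rightarrow> 'b::ab_group_add \<Rightarrow> 'b" and u :: "'b \<Rightarrow> 'b"
    and p :: "'a poly" and y1 y2 :: 'a +
  fixes w :: "'b \<Rightarrow> 'b"
  assumes w_add: "w (v + v') = w v + w v'"
    and w_E: "w (poly_endo scale g u v) = poly_endo scale (shifted_pair.\<sigma> p y1 y2 g) u (w v)"
    and w_w: "w (w v) = poly_endo scale ((p \<circ>\<^sub>p [:y1, 1:]) * (p \<circ>\<^sub>p [:y2, 1:])) u v"
begin

text \<open>Labelling the two primes by truth values makes \<open>\<sigma>\<close> act on the labels
  as negation.\<close>

definition P :: "bool \<Rightarrow> 'a poly" where
  "P e = (if e then p1 else p2)"

text \<open>Membership in the \<open>P e\<close>-primary component of the F[t]-module.\<close>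

definition hom :: "bool \<Rightarrow> 'b \<Rightarrow> bool" where
  "hom e x \<longleftrightarrow> (\<exists>n. E (P e ^ n) x = 0)"

definition submod :: "'b set \<Rightarrow> bool" where
  "submod W \<longleftrightarrow> 0 \<in> W \<and> (\<forall>v\<in>W. \<forall>v'\<in>W. v + v' \<in> W) \<and> (\<forall>g. \<forall>v\<in>W. E g v \<in> W) \<and> (\<forall>v\<in>W. w v \<in> W)"

lemma w_0: "w 0 = 0"
  using w_add[of 0 0] by simp

lemma w_sum: "w (\<Sum>i\<in>A. h i) = (\<Sum>i\<in>A. w (h i))"
  by (induction A rule: infinite_finite_induct) (auto simp: w_0 w_add)

lemma wpow_0: "(w ^^ k) 0 = 0"
  by (induction k) (auto simp: w_0)

lemma wpow_sum: "(w ^^ k) (\<Sum>i\<in>A. h i) = (\<Sum>i\<in>A. (w ^^ k) (h i))"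
  by (induction k) (auto simp: w_sum)

lemma wpow_E: "(w ^^ k) (E g v) = E ((\<sigma> ^^ k) g) ((w ^^ k) v)"
  by (induction k) (auto simp: w_E)

lemma wpow_even: "(w ^^ (2 * k)) v = E ((p1 * p2) ^ k) v"
proof (induction k)
  case (Suc k)
  have "(w ^^ (2 * Suc k)) v = w (w ((w ^^ (2 * k)) v))"
    by simp
  then show ?case
    by (simp add: w_w Suc.IH E_mult)
qed simp

lemma P_mult: "P e * P (\<not> e) = p1 * p2"
  by (simp add: P_def mult.commute)

lemma \<sigma>_P: "\<sigma> (P e) = P (\<not> e)"
  by (simp add: P_def)

text \<open>The label \<open>e = even k\<close> is \<open>e\<close> negated \<open>k\<close> times;
  in \<open>hom_wpow\<close> it names the component reached after \<open>k\<close> applications of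
  \<open>w\<close>.\<close>

lemma \<sigma>pow_P: "(\<sigma> ^^ k) (P e) = P (e = even k)"
  by (induction k) (simp_all add: \<sigma>_P)

lemma coprime_P: "coprime (P e) (P (\<not> e))"
  using coprime_p1_p2 by (simp add: P_def coprime_commute)

lemma irreducible_P: "Factorial_Ring.irreducible (P e)"
  using irreducible_p1 swap.irreducible_p1 by (simp add: P_def)

lemma coprime_\<sigma>: "coprime f g \<Longrightarrow> coprime (\<sigma> f) (\<sigma> g)"
  unfolding coprime_poly_iff_bezout by (metis \<sigma>_simps(1,3) \<sigma>_simps(7))

lemma coprime_\<sigma>pow: "coprime f g \<Longrightarrow> coprime ((\<sigma> ^^ k) f) ((\<sigma> ^^ k) g)"
  by (induction k) (auto intro: coprime_\<sigma>)

lemma hom_0: "hom e 0"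
  by (auto simp: hom_def)

lemma hom_E: "hom e x \<Longrightarrow> hom e (E g x)"
  unfolding hom_def by (metis E_0 E_mult_commute)

lemma hom_mono:
  assumes "E (P e ^ n) x = 0" "n \<le> m"
  shows "E (P e ^ m) x = 0"
  using assms E_dvd le_imp_power_dvd by blast

lemma hom_add:
  assumes "hom e x" "hom e y"
  shows "hom e (x + y)"
proof -
  obtain n m where "E (P e ^ n) x = 0" "E (P e ^ m) y = 0"
    using assms unfolding hom_def by blast
  then have "E (P e ^ max n m) x = 0" "E (P e ^ max n m) y = 0"
    by (auto intro: hom_mono)
  then have "E (P e ^ max n m) (x + y) = 0"
    by (simp add: E_add)
  then show ?thesis unfolding hom_def ..
qed

lemma hom_sum: "(\<And>i. i \<in> A \<Longrightarrow> hom e (h i)) \<Longrightarrow> hom e (\<Sum>i\<in>A. h i)"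
  by (induction A rule: infinite_finite_induct) (auto intro: hom_0 hom_add)

lemma hom_w:
  assumes "hom e x"
  shows "hom (\<not> e) (w x)"
proof -
  obtain n where "E (P e ^ n) x = 0"
    using assms unfolding hom_def by blast
  then have "E (\<sigma> (P e ^ n)) (w x) = 0"
    by (metis w_0 w_E)
  then show ?thesis
    unfolding hom_def \<sigma>_power \<sigma>_P ..
qed

lemma hom_wpow: "hom e x \<Longrightarrow> hom (e = even k) ((w ^^ k) x)"
proof (induction k)
  case (Suc k)
  then have "hom (\<not> (e = even k)) (w ((w ^^ k) x))"
    by (intro hom_w) simp
  then show ?case by (simp add: eq_commute)
qed simp

lemma hom_coprime:
  assumes "hom e x" "coprime h (P e)" "E h x = 0"
  shows "x = 0"
  using assms coprime_poly_power_right E_coprime unfolding hom_def by metis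

lemma hom_both: "hom e x \<Longrightarrow> hom (\<not> e) x \<Longrightarrow> x = 0"
  unfolding hom_def by (metis E_coprime coprime_P coprime_poly_power)

text \<open>The power of \<open>w\<close> with exponent \<open>2 * n\<close> acts as
  \<open>(p1 * p2) ^ n\<close>, a multiple of the power \<open>P e ^ n\<close> that kills
  \<open>x\<close>.\<close>

lemma hom_nilpotent:
  assumes "hom e x"
  shows "\<exists>l. (w ^^ l) x = 0"
proof -
  obtain n where n: "E (P e ^ n) x = 0"
    using assms unfolding hom_def by blast
  have "P e ^ n dvd (p1 * p2) ^ n"
    using P_mult[of e] by (metis dvd_triv_left power_mult_distrib)
  then have "(w ^^ (2 * n)) x = 0"
    unfolding wpow_even using n E_dvd by blast
  then show ?thesis ..
qed

text \<open>A string of length \<open>l\<close> starting at \<open>x\<close> spans two cyclic modules, generated by \<open>x\<close> and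
  \<open>w x\<close>.\<close>

lemma string_order:
  assumes x: "hom e x" and l: "(w ^^ l) x = 0"
  shows "E (P t ^ ((if t = e then l + 1 else l) div 2)) (if t = e then x else w x) = 0"
proof -
  \<comment> \<open>Half of \<open>l\<close>, rounded up for the component of \<open>x\<close> and
    down for that of \<open>w x\<close>.\<close>
  define K where "K = (if t = e then l + 1 else l) div 2"
  define y where "y = (if t = e then x else w x)"
  have y: "hom t y"
    using x hom_w[OF x] by (cases t; cases e) (auto simp: y_def)
  \<comment> \<open>In both cases the total exponent of \<open>w\<close> at \<open>x\<close> is at
    least \<open>l\<close>.\<close>
  have "(w ^^ (2 * K)) y = (w ^^ (2 * K + (if t = e then 0 else 1))) x"
    by (simp add: y_def funpow_swap1)
  also have "\<dots> = (w ^^ (2 * K + (if t = e then 0 else 1) - l)) ((w ^^ l) x)"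
    by (subst funpow_add[THEN fun_cong, unfolded o_apply, symmetric]) (auto simp: K_def)
  also have "\<dots> = 0"
    by (simp add: l wpow_0)
  \<comment> \<open>Since \<open>P (\<not> t)\<close> is injective on the
    \<open>P t\<close>-component, its power can be cancelled.\<close>
  finally have "E (P (\<not> t) ^ K) (E (P t ^ K) y) = 0"
    unfolding wpow_even P_mult[of t, symmetric] power_mult_distrib mult.commute[of "P t ^ K"] E_mult .
  moreover have "coprime (P (\<not> t) ^ K) (P t)"
    using coprime_P[of t] by (simp add: coprime_commute coprime_poly_power_right)
  ultimately show ?thesis
    using hom_coprime hom_E[OF y] unfolding K_def y_def by blast
qed

text \<open>Generation under \<open>u\<close> and \<open>w\<close> jointly. In this form a generator
  may be exchanged as soon as the old one is recovered inside every submodule containing the new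
  family.\<close>

definition generates :: "nat \<Rightarrow> (nat \<Rightarrow> 'b) \<Rightarrow> bool" where
  "generates N x \<longleftrightarrow> (\<forall>W. submod W \<longrightarrow> (\<forall>j<N. x j \<in> W) \<longrightarrow> W = UNIV)"

text \<open>\<open>l j\<close> only bounds the length of the string starting at \<open>x j\<close>
  from above; the total of these bounds is what gets minimized.\<close>

definition strings :: "nat \<Rightarrow> (nat \<Rightarrow> 'b) \<Rightarrow> (nat \<Rightarrow> bool) \<Rightarrow> (nat \<Rightarrow> nat) \<Rightarrow> bool" where
  "strings N x e l \<longleftrightarrow> generates N x \<and> (\<forall>j<N. hom (e j) (x j) \<and> (w ^^ l j) (x j) = 0)"

lemma submod_sum: "submod W \<Longrightarrow> (\<And>i. i \<in> A \<Longrightarrow> h i \<in> W) \<Longrightarrow> (\<Sum>i\<in>A. h i) \<in> W"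
  by (induction A rule: infinite_finite_induct) (auto simp: submod_def)

lemma submod_wpow: "submod W \<Longrightarrow> v \<in> W \<Longrightarrow> (w ^^ k) v \<in> W"
  by (induction k) (auto simp: submod_def)

text \<open>On \<open>x\<close> the action of \<open>h\<close> is undone by a polynomial in
  \<open>u\<close>, found by Bezout for \<open>h\<close> and a power of \<open>P e\<close>.\<close>

lemma submod_coprime:
  assumes "submod W" "hom e x" "coprime h (P e)" "E h x \<in> W"
  shows "x \<in> W"
proof -
  obtain n where n: "E (P e ^ n) x = 0"
    using assms(2) unfolding hom_def by blast
  obtain a b where "a * h + b * P e ^ n = 1"
    using coprime_poly_power_right[OF assms(3)] unfolding coprime_poly_iff_bezout by blast
  then have "x = E (a * h + b * P e ^ n) x"
    by simp
  also have "\<dots> = E a (E h x)"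
    by (simp add: E_add_left E_mult n)
  finally show ?thesis
    using assms(1,4) unfolding submod_def by metis
qed

text \<open>In a homogeneous relation, factor out the smallest power of \<open>w\<close>: the cofactor can replace
  one of the generators and has a shorter string.\<close>

lemma strings_exchange:
  assumes str: "strings N x e l"
    and rel: "(\<Sum>j<N. E (G j) (if t = e j then x j else w (x j))) = 0"
    and bad: "\<not> (\<forall>j<N. P t ^ ((if t = e j then l j + 1 else l j) div 2) dvd G j)"
  shows "\<exists>x' l'. strings N x' e l' \<and> (\<Sum>j<N. l' j) < (\<Sum>j<N. l j)"
proof -
  define K where "K j = (if t = e j then l j + 1 else l j) div 2" for j
  define y where "y j = (if t = e j then x j else w (x j))" for j
  \<comment> \<open>The other terms of the relation vanish, by \<open>string_order\<close>.\<close>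
  define J where "J = {j. j < N \<and> \<not> P t ^ K j dvd G j}"
  have gen: "generates N x" and x: "\<And>j. j < N \<Longrightarrow> hom (e j) (x j)"
    and l: "\<And>j. j < N \<Longrightarrow> (w ^^ l j) (x j) = 0"
    using str unfolding strings_def by auto
  have finJ: "finite J" and JN: "\<And>j. j \<in> J \<Longrightarrow> j < N"
    by (auto simp: J_def)
  have "J \<noteq> {}"
    using bad unfolding J_def K_def by blast
  have "\<exists>c G'. G j = P t ^ c * G' \<and> \<not> P t dvd G'" if "j \<in> J" for j
  proof -
    have "G j \<noteq> 0"
      using that by (auto simp: J_def)
    then show ?thesis
      using poly_split_prime_power[OF irreducible_P] by metis
  qed
  then obtain c G' where G': "\<And>j. j \<in> J \<Longrightarrow> G j = P t ^ c j * G' j"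
    and ndvd: "\<And>j. j \<in> J \<Longrightarrow> \<not> P t dvd G' j"
    by metis
  have cK: "c j < K j" if "j \<in> J" for j
  proof (rule ccontr)
    assume "\<not> c j < K j"
    then have "P t ^ K j dvd G j"
      unfolding G'[OF that] by (simp add: dvd_mult2 le_imp_power_dvd)
    then show False using that by (simp add: J_def)
  qed
  \<comment> \<open>Up to a cofactor prime to \<open>P t\<close>, the \<open>j\<close>-th term of
    the relation will become \<open>(w ^^ s j) (x j)\<close>; the 1 accounts for the
    \<open>w\<close> contained in \<open>y j\<close>.\<close>
  define s where "s j = 2 * c j + (if t = e j then 0 else 1)" for j
  have sl: "s j < l j" if "j \<in> J" for j
    using cK[OF that] by (auto simp: s_def K_def split: if_splits)
  have parity: "t = (e j = even (s j))" for j
    by (auto simp: s_def)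
  \<comment> \<open>Multiplying the relation by \<open>P (\<not> t) ^ C\<close> supplies enough
    factors to complete each \<open>P t ^ c j\<close> to \<open>(p1 * p2) ^ c j\<close>, that is, to
    \<open>w ^^ (2 * c j)\<close>.\<close>
  define C where "C = (\<Sum>j\<in>J. c j)"
  have cC: "c j \<le> C" if "j \<in> J" for j
    unfolding C_def using that finJ by (simp add: member_le_sum)
  define H where "H j = P (\<not> t) ^ (C - c j) * G' j" for j
  have H_cop: "coprime (H j) (P t)" if "j \<in> J" for j
  proof -
    have "coprime (P t) (P (\<not> t) ^ (C - c j))"
      by (intro coprime_poly_power_right coprime_P)
    moreover have "coprime (P t) (G' j)"
      by (intro irreducible_coprime_poly irreducible_P ndvd that)
    ultimately show ?thesis
      unfolding H_def by (simp add: coprime_commute coprime_poly_mult_right)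
  qed
  have "(\<Sum>j<N. E (G j) (y j)) = (\<Sum>j\<in>J. E (G j) (y j))"
  proof (rule sum.mono_neutral_right)
    show "\<forall>j\<in>{..<N} - J. E (G j) (y j) = 0"
    proof
      fix j assume j: "j \<in> {..<N} - J"
      then have "P t ^ K j dvd G j" by (auto simp: J_def)
      moreover have "E (P t ^ K j) (y j) = 0"
        using string_order[of "e j" "x j" "l j" t] x l j by (simp add: K_def y_def)
      ultimately show "E (G j) (y j) = 0"
        using E_dvd by blast
    qed
  qed (auto simp: J_def)
  then have "E (P (\<not> t) ^ C) (\<Sum>j\<in>J. E (G j) (y j)) = 0"
    using rel by (simp add: y_def)
  then have "(\<Sum>j\<in>J. E (P (\<not> t) ^ C) (E (G j) (y j))) = 0"
    by (simp add: E_sum)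
  moreover have "E (P (\<not> t) ^ C) (E (G j) (y j)) = E (H j) ((w ^^ s j) (x j))" if j: "j \<in> J" for j
  proof -
    have "(w ^^ s j) (x j) = (w ^^ (2 * c j)) (y j)"
      by (simp add: s_def y_def funpow_swap1)
    then have "E (H j) ((w ^^ s j) (x j)) = E (H j * (P t * P (\<not> t)) ^ c j) (y j)"
      unfolding wpow_even P_mult E_mult by simp
    also have "H j * (P t * P (\<not> t)) ^ c j = P (\<not> t) ^ (C - c j + c j) * (P t ^ c j * G' j)"
      by (simp add: H_def power_mult_distrib power_add mult_ac)
    also have "\<dots> = P (\<not> t) ^ C * G j"
      using cC[OF j] by (simp add: G'[OF j])
    finally show ?thesis
      by (simp add: E_mult)
  qed
  ultimately have rel': "(\<Sum>j\<in>J. E (H j) ((w ^^ s j) (x j))) = 0"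
    by simp
  \<comment> \<open>The smallest power of \<open>w\<close> in the relation can be factored out of
    all terms.\<close>
  obtain i where i: "i \<in> J" and least: "\<And>j. j \<in> J \<Longrightarrow> s i \<le> s j"
    using ex_min_if_finite[OF finite_imageI[OF finJ, of s]] \<open>J \<noteq> {}\<close>
    by (metis (no_types, lifting) arg_min_least arg_min_if_finite(1) finJ)
  \<comment> \<open>Applying \<open>w ^^ s i\<close> to \<open>Y\<close> gives back the relation:
    moving it past the coefficients twists them a second time by \<open>\<sigma> ^^ s i\<close>, and
    \<open>\<sigma>\<close> is an involution.\<close>
  define Y where "Y = (\<Sum>j\<in>J. E ((\<sigma> ^^ s i) (H j)) ((w ^^ (s j - s i)) (x j)))"
  have \<sigma>pow_\<sigma>pow: "(\<sigma> ^^ k) ((\<sigma> ^^ k) g) = g" for k g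
  proof (induction k arbitrary: g)
    case (Suc k)
    then show ?case
      by (simp add: funpow_swap1)
  qed simp
  have "(w ^^ s i) Y = (\<Sum>j\<in>J. E (H j) ((w ^^ s j) (x j)))"
    unfolding Y_def wpow_sum wpow_E \<sigma>pow_\<sigma>pow
  proof (rule sum.cong)
    fix j assume "j \<in> J"
    then have "s j = s i + (s j - s i)"
      using least by simp
    then show "E (H j) ((w ^^ s i) ((w ^^ (s j - s i)) (x j))) = E (H j) ((w ^^ s j) (x j))"
      by (metis comp_apply funpow_add)
  qed simp
  then have wY: "(w ^^ s i) Y = 0"
    by (simp add: rel')
  have homY: "hom (e i) Y"
    unfolding Y_def
  proof (intro hom_sum hom_E)
    fix j assume j: "j \<in> J"
    have "hom (e j = even (s j - s i)) ((w ^^ (s j - s i)) (x j))"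
      using j JN x by (intro hom_wpow) auto
    moreover have "even (s j - s i) = (even (s j) = even (s i))"
      using least[OF j] by (simp add: even_diff_nat)
    then have "(e j = even (s j - s i)) = e i"
      using parity[of i] parity[of j] by (cases t; cases "e i"; cases "e j") simp_all
    ultimately show "hom (e i) ((w ^^ (s j - s i)) (x j))"
      by simp
  qed
  define x' where "x' = x(i := Y)"
  define l' where "l' = l(i := s i)"
  have "generates N x'"
    unfolding generates_def
  proof (intro allI impI)
    fix W assume W: "submod W" and x'W: "\<forall>j<N. x' j \<in> W"
    have others: "x j \<in> W" if "j < N" "j \<noteq> i" for j
      using x'W that by (auto simp: x'_def)
    have YW: "Y \<in> W"
      using x'W JN[OF i] by (auto simp: x'_def)
    define R where "R = (\<Sum>j\<in>J - {i}. E ((\<sigma> ^^ s i) (H j)) ((w ^^ (s j - s i)) (x j)))"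
    have "Y = E ((\<sigma> ^^ s i) (H i)) (x i) + R"
      unfolding Y_def R_def by (subst sum.remove[OF finJ i]) simp
    then have "E ((\<sigma> ^^ s i) (H i)) (x i) = Y + E (-1) R"
      using E_uminus_left[of 1 R] by simp
    moreover have "R \<in> W"
      unfolding R_def
    proof (rule submod_sum[OF W])
      fix j assume "j \<in> J - {i}"
      then have "(w ^^ (s j - s i)) (x j) \<in> W"
        using JN others by (intro submod_wpow[OF W]) auto
      then show "E ((\<sigma> ^^ s i) (H j)) ((w ^^ (s j - s i)) (x j)) \<in> W"
        using W by (simp add: submod_def)
    qed
    ultimately have "E ((\<sigma> ^^ s i) (H i)) (x i) \<in> W"
      using W YW by (simp add: submod_def)
    \<comment> \<open>The coefficient of \<open>x i\<close> in \<open>Y\<close> is prime to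
      \<open>P (e i)\<close>, so \<open>x i\<close> is recovered from \<open>Y\<close> and the other
      generators.\<close>
    moreover have "coprime ((\<sigma> ^^ s i) (H i)) (P (e i))"
    proof -
      have "(t = even (s i)) = e i"
        using parity[of i] by auto
      then show ?thesis
        using coprime_\<sigma>pow[OF H_cop[OF i], of "s i"] by (simp add: \<sigma>pow_P)
    qed
    ultimately have "x i \<in> W"
      using submod_coprime[OF W x[OF JN[OF i]]] by blast
    then have "\<forall>j<N. x j \<in> W"
      using others by blast
    then show "W = UNIV"
      using gen W unfolding generates_def by blast
  qed
  then have "strings N x' e l'"
    unfolding strings_def using x l homY wY by (auto simp: x'_def l'_def)
  moreover have "(\<Sum>j<N. l' j) < (\<Sum>j<N. l j)"
    using sl[OF i] JN[OF i] by (intro sum_strict_mono_ex1) (auto simp: l'_def)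
  ultimately show ?thesis by blast
qed

text \<open>The vectors \<open>x j\<close> and \<open>w (x j)\<close> span over F[t] because
  \<open>w\<close> squares to a polynomial in \<open>u\<close>. A relation splits into its two
  primary parts, and a cofactor not divisible by the expected order would allow an exchange with a
  smaller total.\<close>

lemma strings_cyclic_decomp:
  assumes str: "strings N x e l"
    and least: "\<And>x' l'. strings N x' e l' \<Longrightarrow> (\<Sum>j<N. l j) \<le> (\<Sum>j<N. l' j)"
  shows "cyclic_decomp ({..<N} \<times> UNIV) (\<lambda>(j, t). if t = e j then x j else w (x j))
    (\<lambda>(j, t). P t ^ ((if t = e j then l j + 1 else l j) div 2))"
proof -
  define z where "z = (\<lambda>(j, t). if t = e j then x j else w (x j))"
  define f where "f = (\<lambda>(j, t). P t ^ ((if t = e j then l j + 1 else l j) div 2))"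
  have gen: "generates N x" and x: "\<And>j. j < N \<Longrightarrow> hom (e j) (x j)"
    and l: "\<And>j. j < N \<Longrightarrow> (w ^^ l j) (x j) = 0"
    using str unfolding strings_def by auto
  have z: "hom t (z (j, t))" "E (f (j, t)) (z (j, t)) = 0" if "j < N" for j t
    using string_order[OF x[OF that] l[OF that], of t] x[OF that] hom_w[OF x[OF that]]
    by (cases t; cases "e j"; simp add: z_def f_def)+
  define W where "W = {v. \<exists>g h. v = (\<Sum>j<N. E (g j) (x j) + E (h j) (w (x j)))}"
  have "submod W"
    unfolding submod_def
  proof (intro conjI ballI allI)
    show "0 \<in> W"
      unfolding W_def by (rule CollectI, intro exI[of _ "\<lambda>_. 0"]) simp
  next
    fix v v' assume "v \<in> W" "v' \<in> W"
    then obtain g h g' h' where "v = (\<Sum>j<N. E (g j) (x j) + E (h j) (w (x j)))"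
      "v' = (\<Sum>j<N. E (g' j) (x j) + E (h' j) (w (x j)))"
      unfolding W_def by blast
    then have "v + v' = (\<Sum>j<N. E (g j + g' j) (x j) + E (h j + h' j) (w (x j)))"
      by (simp add: E_add_left sum.distrib algebra_simps)
    then show "v + v' \<in> W"
      unfolding W_def by (intro CollectI exI)
  next
    fix k v assume "v \<in> W"
    then obtain g h where "v = (\<Sum>j<N. E (g j) (x j) + E (h j) (w (x j)))"
      unfolding W_def by blast
    then have "E k v = (\<Sum>j<N. E (k * g j) (x j) + E (k * h j) (w (x j)))"
      by (simp add: E_sum E_add E_mult)
    then show "E k v \<in> W"
      unfolding W_def by (intro CollectI exI)
  next
    fix v assume "v \<in> W"
    then obtain g h where "v = (\<Sum>j<N. E (g j) (x j) + E (h j) (w (x j)))"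
      unfolding W_def by blast
    then have "w v = (\<Sum>j<N. E (\<sigma> (h j) * (p1 * p2)) (x j) + E (\<sigma> (g j)) (w (x j)))"
      by (simp add: w_sum w_add w_E w_w E_mult add.commute)
    then show "w v \<in> W"
      unfolding W_def by (intro CollectI exI)
  qed
  moreover have "x j \<in> W" if "j < N" for j
  proof -
    have "(\<Sum>i<N. E (if i = j then 1 else 0) (x i) + E 0 (w (x i))) = (\<Sum>i<N. if i = j then x j else 0)"
      by (rule sum.cong) auto
    then have "x j = (\<Sum>i<N. E (if i = j then 1 else 0) (x i) + E 0 (w (x i)))"
      using that by (simp add: sum.delta)
    then show ?thesis
      unfolding W_def by (intro CollectI exI)
  qed
  ultimately have W: "W = UNIV"
    using gen unfolding generates_def by blast
  have span: "\<exists>g. v = (\<Sum>i\<in>{..<N} \<times> UNIV. E (g i) (z i))" for v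
  proof -
    obtain g h where v: "v = (\<Sum>j<N. E (g j) (x j) + E (h j) (w (x j)))"
      using W unfolding W_def by blast
    define k where "k = (\<lambda>(j, t). if t = e j then g j else h j)"
    have "(\<Sum>i\<in>{..<N} \<times> UNIV. E (k i) (z i)) = (\<Sum>j<N. E (k (j, True)) (z (j, True)) + E (k (j, False)) (z (j, False)))"
      by (simp add: sum_Times_bool sum.distrib)
    also have "\<dots> = v"
      unfolding v by (rule sum.cong) (auto simp: k_def z_def add.commute)
    finally show ?thesis by metis
  qed
  have rel: "\<forall>i\<in>{..<N} \<times> UNIV. f i dvd g i" if zero: "(\<Sum>i\<in>{..<N} \<times> UNIV. E (g i) (z i)) = 0" for g
  proof -
    \<comment> \<open>The two primary parts of the relation are opposite to each other, hence lie in
      both components and vanish.\<close>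
    define S where "S t = (\<Sum>j<N. E (g (j, t)) (z (j, t)))" for t
    have homS: "hom t (S t)" for t
      unfolding S_def by (intro hom_sum hom_E z) simp
    have "S True + S False = 0"
      using zero unfolding sum_Times_bool S_def .
    then have "S True = E (-1) (S False)"
      using E_uminus_left[of 1 "S False"] by (simp add: add_eq_0_iff2)
    then have "hom False (S True)"
      using hom_E[OF homS] by metis
    then have T: "S True = 0"
      using hom_both[of True] homS[of True] by simp
    then have "S t = 0" for t
      using \<open>S True + S False = 0\<close> by (cases t) auto
    then have "(\<Sum>j<N. E (g (j, t)) (if t = e j then x j else w (x j))) = 0" for t
      unfolding S_def z_def by simp
    then have "\<forall>j<N. P t ^ ((if t = e j then l j + 1 else l j) div 2) dvd g (j, t)" for t
      using strings_exchange[OF str, of "\<lambda>j. g (j, t)" t] least by (metis linorder_not_less)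
    then show ?thesis
      unfolding f_def by auto
  qed
  have "(\<Sum>i\<in>{..<N} \<times> UNIV. E (g i) (z i)) = 0" if "\<forall>i\<in>{..<N} \<times> UNIV. f i dvd g i" for g
  proof (rule sum.neutral, rule ballI)
    fix i :: "nat \<times> bool" assume i: "i \<in> {..<N} \<times> UNIV"
    then have "E (f i) (z i) = 0"
      using z(2) by (cases i) auto
    then show "E (g i) (z i) = 0"
      using that i E_dvd by blast
  qed
  then have "cyclic_decomp ({..<N} \<times> UNIV) z f"
    unfolding cyclic_decomp_def using span rel by (intro conjI allI iffI) auto
  then show ?thesis
    unfolding z_def f_def .
qed

text \<open>Bezout splits each vector of a finite spanning set into its two primary parts; these
  homogeneous vectors generate, and \<open>w\<close> is nilpotent on each.\<close>

lemma ex_strings: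
  assumes fin: "finite B" and span: "span B = UNIV"
    and nil: "\<And>v. \<exists>m n. E (p1 ^ m * p2 ^ n) v = 0"
  shows "\<exists>N x e l. strings N x e l"
proof -
  obtain bs where bs: "set bs = B"
    using finite_list[OF fin] by blast
  have ex: "\<exists>v1 v2. v = v1 + v2 \<and> hom True v1 \<and> hom False v2" for v
  proof -
    obtain m n where v: "E (p1 ^ m * p2 ^ n) v = 0"
      using nil by blast
    obtain a b where ab: "a * p1 ^ m + b * p2 ^ n = 1"
      using coprime_poly_power[OF coprime_p1_p2] unfolding coprime_poly_iff_bezout by blast
    have "E (p1 ^ m) (E (p2 ^ n) v) = 0" "E (p2 ^ n) (E (p1 ^ m) v) = 0"
      using v E_mult_commute by (simp_all add: E_mult)
    then have "E (P True ^ m) (E (b * p2 ^ n) v) = 0" "E (P False ^ n) (E (a * p1 ^ m) v) = 0"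
      unfolding P_def by (simp_all add: E_mult E_mult_commute[of _ b] E_mult_commute[of _ a])
    moreover have "v = E (b * p2 ^ n) v + E (a * p1 ^ m) v"
      using E_add_left[of "b * p2 ^ n" "a * p1 ^ m" v] ab by (simp add: add.commute)
    ultimately show ?thesis
      unfolding hom_def by blast
  qed
  then obtain c1 c2 where c: "\<And>v. v = c1 v + c2 v" "\<And>v. hom True (c1 v)" "\<And>v. hom False (c2 v)"
    by metis
  define xs where "xs = map (\<lambda>v. (c1 v, True)) bs @ map (\<lambda>v. (c2 v, False)) bs"
  define x where "x j = fst (xs ! j)" for j
  define e where "e j = snd (xs ! j)" for j
  have hom_x: "hom (e j) (x j)" if "j < length xs" for j
  proof -
    have "xs ! j \<in> set xs" using that by simp
    then show ?thesis
      unfolding xs_def x_def e_def using c by fastforce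
  qed
  have "\<forall>j. \<exists>k. j < length xs \<longrightarrow> (w ^^ k) (x j) = 0"
    using hom_nilpotent[OF hom_x] by blast
  from choice[OF this] obtain l where "\<forall>j. j < length xs \<longrightarrow> (w ^^ l j) (x j) = 0" ..
  moreover have "generates (length xs) x"
    unfolding generates_def
  proof (intro allI impI)
    fix W assume W: "submod W" "\<forall>j<length xs. x j \<in> W"
    have fstW: "fst y \<in> W" if "y \<in> set xs" for y
      using that W(2) unfolding x_def in_set_conv_nth by blast
    have BW: "B \<subseteq> W"
    proof
      fix v assume "v \<in> B"
      then have "(c1 v, True) \<in> set xs" "(c2 v, False) \<in> set xs"
        by (auto simp: xs_def bs)
      then have "c1 v \<in> W" "c2 v \<in> W"
        using fstW by fastforce+
      then have "c1 v + c2 v \<in> W"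
        using W(1) by (simp add: submod_def)
      then show "v \<in> W"
        using c(1)[of v] by simp
    qed
    have "scale k v \<in> W" if "v \<in> W" for k v
    proof -
      have "E [:k:] v \<in> W"
        using W(1) that unfolding submod_def by blast
      then show ?thesis by simp
    qed
    then have "subspace W"
      using W(1) by (simp add: subspace_def submod_def)
    then show "W = UNIV"
      using span_minimal[OF BW] span by blast
  qed
  ultimately show ?thesis
    unfolding strings_def using hom_x by blast
qed

text \<open>\<open>N\<close> and \<open>e\<close> stay fixed while the total of the
  \<open>l j\<close> is minimized. The exponents of a pair are \<open>l j / 2\<close> rounded up and
  down, hence differ by at most 1.\<close>

theorem twisted_cyclic_decomp:
  assumes "finite B" "span B = UNIV" "\<And>v. \<exists>m n. E (p1 ^ m * p2 ^ n) v = 0"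
  shows "\<exists>(N :: nat) z \<alpha> \<beta>. cyclic_decomp ({..<N} \<times> UNIV) z (\<lambda>(j, t). if t then p1 ^ \<alpha> j else p2 ^ \<beta> j) \<and>
    (\<forall>j<N. \<bar>int (\<alpha> j) - int (\<beta> j)\<bar> \<le> 1)"
proof -
  obtain N x e l where "strings N x e l"
    using ex_strings[OF assms] by blast
  then have "\<exists>xl. strings N (fst xl) e (snd xl)"
    by (intro exI[of _ "(x, l)"]) simp
  then obtain xl where xl: "strings N (fst xl) e (snd xl)"
    and least: "\<And>xl'. strings N (fst xl') e (snd xl') \<Longrightarrow> (\<Sum>j<N. snd xl j) \<le> (\<Sum>j<N. snd xl' j)"
    using ex_has_least_nat[of "\<lambda>xl. strings N (fst xl) e (snd xl)" _ "\<lambda>xl. \<Sum>j<N. snd xl j"] by blast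
  define l where "l = snd xl"
  define \<alpha> where "\<alpha> j = (if e j then l j + 1 else l j) div 2" for j
  define \<beta> where "\<beta> j = (if e j then l j else l j + 1) div 2" for j
  have "cyclic_decomp ({..<N} \<times> UNIV) (\<lambda>(j, t). if t = e j then fst xl j else w (fst xl j))
    (\<lambda>(j, t). P t ^ ((if t = e j then l j + 1 else l j) div 2))"
    unfolding l_def
    by (rule strings_cyclic_decomp[OF xl]) (use least in \<open>metis fst_conv snd_conv\<close>)
  moreover have "(\<lambda>(j, t). P t ^ ((if t = e j then l j + 1 else l j) div 2)) =
      (\<lambda>(j, t). if t then p1 ^ \<alpha> j else p2 ^ \<beta> j)"
    by (auto simp: P_def \<alpha>_def \<beta>_def fun_eq_iff)
  moreover have "\<bar>int (\<alpha> j) - int (\<beta> j)\<bar> \<le> 1" for j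
    by (auto simp: \<alpha>_def \<beta>_def)
  ultimately show ?thesis
    by (intro exI[of _ N] exI conjI) auto
qed

end

subsection \<open>Differences as twisted modules\<close>

lemma (in shifted_pair) p1_coeffs: "p1 = [:y1 * y1 - poly_trace p * y1 + Polynomial.coeff p 0, 2 * y1 - poly_trace p, 1:]"
  by (subst p_eq, subst (2) p_eq) (simp add: pcompose_pCons algebra_simps)

text \<open>With \<open>c = b - y1\<close> one obtains
  \<open>c g(u) = (\<sigma> g)(u) c - (p1 \<tau> g)(u)\<close>. Adding \<open>p1(u)\<close> to
  \<open>\<epsilon>(u) c\<close> removes the derivation term, which yields \<open>w\<close>.\<close>

lemma (in endo) twisted_of_pq_difference:
  assumes sp: "shifted_pair p y1 y2"
    and diff: "pq_difference scale p ([:- y1, 1:] * [:- y2, 1:]) u"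
  shows "\<exists>w. twisted scale u p y1 y2 w"
proof -
  interpret shifted_pair p y1 y2 by (fact sp)
  obtain a b where lin: "Vector_Spaces.linear scale scale a" "Vector_Spaces.linear scale scale b"
    and uab: "\<And>v. u v = a v - b v" and pa: "\<And>v. poly_endo scale p a v = 0"
    and qb: "\<And>v. poly_endo scale ([:- y1, 1:] * [:- y2, 1:]) b v = 0"
    using diff unfolding pq_difference_def annihilates_def by blast
  let ?l = "poly_trace p"
  have q: "[:- y1, 1:] * [:- y2, 1:] = [:y1 * y2, - (y1 + y2), 1:]"
    by simp
  have move: "x = y - z" if "z + - y + x = 0" for x y z :: 'b
  proof -
    have "x = (z + - y + x) + y - z"
      by (simp add: algebra_simps)
    also have "\<dots> = y - z"
      unfolding that by simp
    finally show ?thesis .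
  qed
  have bb: "b (b v) = scale (y1 + y2) (b v) - scale (y1 * y2) v" for v
    using qb[of v] unfolding q linear_poly_endo_quadratic[OF lin(2)] scale_minus_left
    by (rule move)
  have p_a: "poly_endo scale p a v = scale (Polynomial.coeff p 0) v + scale (- ?l) (a v) + a (a v)" for v
    using linear_poly_endo_quadratic[OF lin(1)] p_eq by metis
  have aa: "a (a v) = scale ?l (a v) - scale (Polynomial.coeff p 0) v" for v
    using pa[of v] unfolding p_a scale_minus_left by (rule move)
  define c where "c v = b v - scale y1 v" for v
  have b_add: "b (v + v') = b v + b v'" and b_scale: "b (scale k v) = scale k (b v)" for v v' k
    using lin(2) by (simp_all add: Vector_Spaces.linear_iff)
  have c_add: "c (v + v') = c v + c v'" and c_scale: "c (scale k v) = scale k (c v)" for v v' k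
    by (simp_all add: c_def b_add b_scale algebra_simps)
  have c_diff: "c (v - v') = c v - c v'" for v v'
    using c_add[of v "- v'"] c_scale[of "-1" v'] by simp
  have c_E_const: "c 0 = 0"
    using c_scale[of 0 0] by simp
  have a_c: "a v = u v + c v + scale y1 v" for v
    by (simp add: c_def uab)
  have cc: "c (c v) = scale (y2 - y1) (c v)" for v
  proof -
    have "c (c v) = b (c v) - scale y1 (c v)"
      by (simp add: c_def)
    also have "b (c v) = b (b v) - scale y1 (b v)"
      using b_add[of "c v" "scale y1 v"] by (simp add: c_def b_scale)
    finally show ?thesis
      by (simp add: bb c_def algebra_simps)
  qed
  \<comment> \<open>Substitute \<open>a = u + c + y1\<close> into \<open>p(a) = 0\<close> and use
    \<open>cc\<close>.\<close>
  have cu: "c (u v) = scale \<delta> (c v) - E p1 v - u (c v)" for v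
  proof -
    have "a (a v) = u (u v + c v + scale y1 v) + c (u v + c v + scale y1 v) + scale y1 (u v + c v + scale y1 v)"
      unfolding a_c[of "a v"] unfolding a_c ..
    then have *: "scale ?l (u v + c v + scale y1 v) - scale (Polynomial.coeff p 0) v =
        (u (u v) + u (c v) + scale y1 (u v)) + c (u v) + (scale (y2 - y1) (c v) + scale y1 (c v) +
        scale y1 (u v) + scale y1 (c v) + scale (y1 * y1) v)"
      unfolding aa unfolding a_c by (simp add: u_add u_scale c_add c_scale cc algebra_simps)
    have cu_eq: "c (u v) = scale ?l (u v + c v + scale y1 v) - scale (Polynomial.coeff p 0) v -
        (u (u v) + u (c v) + scale y1 (u v)) - (scale (y2 - y1) (c v) + scale y1 (c v) +
        scale y1 (u v) + scale y1 (c v) + scale (y1 * y1) v)"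
      unfolding * by simp
    have two: "scale (2 * y1 - ?l) (u v) = scale y1 (u v) + scale y1 (u v) - scale ?l (u v)"
      by (simp only: scale_left_diff_distrib mult_2 scale_left_distrib)
    have "E p1 v = scale (y1 * y1 - ?l * y1 + Polynomial.coeff p 0) v + scale (2 * y1 - ?l) (u v) + u (u v)"
      by (subst p1_coeffs) (simp add: E_pCons u_add u_scale u_0)
    then have E_p1: "E p1 v = scale (y1 * y1 - ?l * y1 + Polynomial.coeff p 0) v +
        (scale y1 (u v) + scale y1 (u v) - scale ?l (u v)) + u (u v)"
      unfolding two .
    show ?thesis
      unfolding cu_eq E_p1 by (simp add: \<delta>_def algebra_simps)
  qed
  \<comment> \<open>\<open>cu\<close> is the case \<open>g = t\<close>; the twisted Leibniz rule
    carries it to all \<open>g\<close>.\<close>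
  have cE: "c (E g v) = E (\<sigma> g) (c v) - E (p1 * \<tau> g) v" for g v
  proof (induction g)
    case 0
    show ?case by (simp add: c_E_const \<tau>_def)
  next
    case (pCons k g)
    have tau: "\<tau> (pCons k g) = g + [:\<delta>, -1:] * \<tau> g"
    proof -
      have "pCons k g = [:k:] + [:0, 1:] * g" by simp
      then have "\<tau> (pCons k g) = \<tau> [:k:] + \<tau> ([:0, 1:] * g)"
        by (metis \<tau>_add)
      then show ?thesis
        by (simp only: \<tau>_const \<tau>_mult \<tau>_X) simp
    qed
    let ?d = "\<lambda>x. scale \<delta> x - u x"
    have d: "E ([:\<delta>, -1:] * f) x = ?d (E f x)" for f x
      using u_scale[of "-1" "E f x"] by (simp only: E_mult) (simp add: E_pCons u_scale u_0 u_add)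
    have d_diff: "?d (x - x') = ?d x - ?d x'" for x x'
      using u_add[of "x - x'" x'] by (simp add: algebra_simps)
    have "c (E (pCons k g) v) = scale k (c v) + ?d (c (E g v)) - E p1 (E g v)"
      by (simp add: E_pCons c_add c_scale cu)
    also have "\<dots> = scale k (c v) + (?d (E (\<sigma> g) (c v)) - ?d (E (p1 * \<tau> g) v)) - E p1 (E g v)"
      by (simp only: pCons.IH d_diff)
    also have "\<dots> = E ([:k:] + [:\<delta>, -1:] * \<sigma> g) (c v) - E (p1 * g + [:\<delta>, -1:] * (p1 * \<tau> g)) v"
      unfolding E_add_left d E_const E_mult[of p1 g] by (simp add: algebra_simps)
    also have "p1 * g + [:\<delta>, -1:] * (p1 * \<tau> g) = p1 * \<tau> (pCons k g)"
      unfolding tau by (simp only: distrib_left mult.left_commute)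
    finally show ?case
      by (simp only: \<sigma>_simps)
  qed
  \<comment> \<open>By \<open>cu\<close>, this is the commutator \<open>u (b v) - b (u v)\<close>.\<close>
  define w where "w v = E \<epsilon> (c v) + E p1 v" for v
  have w_add: "w (v + v') = w v + w v'" for v v'
    by (simp add: w_def c_add E_add)
  have w_E: "w (E g v) = E (\<sigma> g) (w v)" for g v
  proof -
    have "w (E g v) = E (\<epsilon> * \<sigma> g) (c v) + E (p1 * g - \<epsilon> * (p1 * \<tau> g)) v"
      by (simp add: w_def cE E_diff E_diff_left E_mult)
    \<comment> \<open>Since \<open>\<epsilon> * \<tau> g = g - \<sigma> g\<close>, this becomes
      \<open>p1 * \<sigma> g\<close>, and \<open>\<sigma> g\<close> factors out of both
      terms.\<close>
    also have "p1 * g - \<epsilon> * (p1 * \<tau> g) = p1 * (g - \<epsilon> * \<tau> g)"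
      by (simp add: algebra_simps)
    also have "\<dots> = p1 * \<sigma> g"
      by (simp add: \<epsilon>_\<tau>)
    finally show ?thesis
      by (simp add: w_def E_add mult.commute[of _ "\<sigma> g"] E_mult)
  qed
  have w_w: "w (w v) = E (p1 * p2) v" for v
  proof -
    have \<sigma>\<epsilon>: "\<sigma> \<epsilon> = - \<epsilon>"
      by (simp add: \<epsilon>_def)
    then have \<tau>\<epsilon>: "\<tau> \<epsilon> = 2"
      by (intro \<tau>_eqI) simp
    have cw: "c (w v) = E (\<epsilon> * [:y1 - y2:] - p1 * 2 + p2) (c v) - E (p1 * [:y1 - y2:]) v"
    proof -
      have "c (E \<epsilon> (c v)) = E (\<epsilon> * [:y1 - y2:]) (c v) - E (p1 * 2) (c v)"
        unfolding cE \<sigma>\<epsilon> \<tau>\<epsilon> cc by (simp add: E_uminus_left E_diff E_scale E_smult_left algebra_simps)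
      moreover have "c (E p1 v) = E p2 (c v) - E (p1 * [:y1 - y2:]) v"
        by (simp only: cE \<sigma>_p1 \<tau>_p1)
      ultimately show ?thesis
        by (simp only: w_def c_add) (simp only: E_add_left E_diff_left add_diff_eq)
    qed
    have p2: "p2 = p1 - [:y1 - y2:] * \<epsilon>"
      using p1_minus_p2 by (simp add: algebra_simps)
    have "w (w v) = E \<epsilon> (c (w v)) + E p1 (w v)"
      by (simp add: w_def)
    also have "\<dots> = E (\<epsilon> * (\<epsilon> * [:y1 - y2:] - p1 * 2 + p2) + p1 * \<epsilon>) (c v) +
        E (p1 * p1 - \<epsilon> * (p1 * [:y1 - y2:])) v"
      unfolding cw unfolding w_def by (simp only: E_add E_diff E_add_left E_diff_left E_mult) (simp add: algebra_simps)
    \<comment> \<open>By \<open>p1 - p2 = (y1 - y2) \<epsilon>\<close>, the coefficient of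
      \<open>c v\<close> vanishes and that of \<open>v\<close> becomes
      \<open>p1 * p2\<close>.\<close>
    also have "\<epsilon> * (\<epsilon> * [:y1 - y2:] - p1 * 2 + p2) + p1 * \<epsilon> = 0"
    proof -
      have "x * (x * d - y * 2 + (y - d * x)) + y * x = 0" for x y d :: "'a poly"
        by (simp add: algebra_simps)
      then show ?thesis unfolding p2 .
    qed
    also have "p1 * p1 - \<epsilon> * (p1 * [:y1 - y2:]) = p1 * p2"
    proof -
      have "y * y - x * (y * d) = y * (y - d * x)" for x y d :: "'a poly"
        by (simp add: algebra_simps)
      then show ?thesis unfolding p2 .
    qed
    finally show ?thesis by simp
  qed
  have "twisted scale u p y1 y2 w"
    by unfold_locales (rule w_add w_E w_w)+
  then show ?thesis by (intro exI[of _ w])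
qed

subsection \<open>Exceptional spectra\<close>

lemma poly_map_ac_add: "poly (map_poly to_ac (f + g)) x = poly (map_poly to_ac f) x + poly (map_poly to_ac g) x"
proof -
  have "map_poly to_ac (f + g) = map_poly to_ac f + map_poly to_ac g"
    by (rule poly_eqI) (simp add: coeff_map_poly)
  then show ?thesis by simp
qed

lemma poly_map_ac_pCons: "poly (map_poly to_ac (pCons c f)) x = to_ac c + x * poly (map_poly to_ac f) x"
proof -
  have "map_poly to_ac (pCons c f) = pCons (to_ac c) (map_poly to_ac f)"
    by (rule poly_eqI) (simp add: coeff_map_poly coeff_pCons split: nat.split)
  then show ?thesis by simp
qed

lemma poly_map_ac_smult: "poly (map_poly to_ac (Polynomial.smult c f)) x = to_ac c * poly (map_poly to_ac f) x"
proof -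
  have "map_poly to_ac (Polynomial.smult c f) = Polynomial.smult (to_ac c) (map_poly to_ac f)"
    by (rule poly_eqI) (simp add: coeff_map_poly)
  then show ?thesis by simp
qed

lemma poly_map_ac_mult: "poly (map_poly to_ac (f * g)) x = poly (map_poly to_ac f) x * poly (map_poly to_ac g) x"
proof (induction f)
  case (pCons c f)
  have "pCons c f * g = Polynomial.smult c g + pCons 0 (f * g)"
    by simp
  then show ?case
    using pCons.IH by (simp only: poly_map_ac_add poly_map_ac_smult poly_map_ac_pCons)
      (simp add: algebra_simps)
qed simp

lemma poly_map_ac_power: "poly (map_poly to_ac (f ^ n)) x = poly (map_poly to_ac f) x ^ n"
  by (induction n) (simp_all add: poly_map_ac_mult)

lemma poly_map_ac_shift: "poly (map_poly to_ac (f \<circ>\<^sub>p [:y, 1:])) x = poly (map_poly to_ac f) (x + to_ac y)"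
  by (induction f) (simp_all add: pcompose_pCons poly_map_ac_add poly_map_ac_smult poly_map_ac_pCons algebra_simps)

lemma coprime_no_common_ac_root:
  assumes "coprime f g" "poly (map_poly to_ac f) x = 0"
  shows "poly (map_poly to_ac g) x \<noteq> 0"
proof
  assume g: "poly (map_poly to_ac g) x = 0"
  obtain a b where "a * f + b * g = 1"
    using assms(1) unfolding coprime_poly_iff_bezout by blast
  then have "poly (map_poly to_ac (a * f + b * g)) x = poly (map_poly to_ac 1) x"
    by simp
  then show False
    using assms(2) g by (simp add: poly_map_ac_add poly_map_ac_mult)
qed

text \<open>The roots of the product are \<open>y1\<close> and \<open>y2\<close>, and a root
  \<open>x\<close> of \<open>p\<close> corresponds to the root \<open>x - y1\<close> of
  \<open>p(t + y1)\<close> and to the root \<open>x - y2\<close> of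
  \<open>p(t + y2)\<close>.\<close>

lemma ac_roots_difference_iff:
  "z \<in> {x - y | x y. x \<in> ac_roots p \<and> y \<in> ac_roots ([:- y1, 1:] * [:- y2, 1:])} \<longleftrightarrow>
    poly (map_poly to_ac (p \<circ>\<^sub>p [:y1, 1:])) z = 0 \<or> poly (map_poly to_ac (p \<circ>\<^sub>p [:y2, 1:])) z = 0"
proof -
  have "y \<in> ac_roots ([:- y1, 1:] * [:- y2, 1:]) \<longleftrightarrow> y = to_ac y1 \<or> y = to_ac y2" for y
    unfolding ac_roots_def mem_Collect_eq poly_map_ac_mult by (simp add: poly_map_ac_pCons)
  then show ?thesis
    unfolding poly_map_ac_shift by (auto simp: ac_roots_def) (metis add_diff_cancel_right')+
qed

text \<open>The first \<open>card B + 1\<close> iterates of \<open>v\<close> are dependent, and the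
  coefficients of a relation form \<open>f\<close>.\<close>

lemma (in endo) ex_vector_annihilator:
  assumes "finite_dimensional_vector_space scale B"
  shows "\<exists>f. f \<noteq> 0 \<and> E f v = 0"
proof -
  interpret fd: finite_dimensional_vector_space scale B by (fact assms)
  let ?n = "card B"
  have "\<not> (inj_on (\<lambda>k. (u ^^ k) v) {..?n} \<and> independent ((\<lambda>k. (u ^^ k) v) ` {..?n}))"
  proof
    assume *: "inj_on (\<lambda>k. (u ^^ k) v) {..?n} \<and> independent ((\<lambda>k. (u ^^ k) v) ` {..?n})"
    then have "card ((\<lambda>k. (u ^^ k) v) ` {..?n}) \<le> ?n"
      using independent_span_bound[of B "(\<lambda>k. (u ^^ k) v) ` {..?n}"] fd.finite_Basis fd.span_Basis by auto
    then show False
      using * by (simp add: card_image)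
  qed
  then obtain c k where c: "(\<Sum>k\<le>?n. scale (c k) ((u ^^ k) v)) = 0" and k: "k \<le> ?n" "c k \<noteq> 0"
    unfolding independent_family_iff[OF finite_atMost] by auto
  define f where "f = (\<Sum>k\<le>?n. Polynomial.monom (c k) k)"
  have "Polynomial.coeff f k = c k"
    using k(1) by (simp add: f_def Polynomial.coeff_sum sum.delta)
  then have "f \<noteq> 0"
    using k(2) by auto
  moreover have "E f v = 0"
    using c by (simp add: f_def E_sum_left E_monom)
  ultimately show ?thesis by blast
qed

text \<open>Remove all factors \<open>p1\<close> and \<open>p2\<close> from an annihilator of
  \<open>v\<close>. If the product of the removed factors did not kill \<open>v\<close>, the
  cofactor \<open>g\<close> would have an eigenvalue among its roots, yet it shares no root with
  \<open>p1\<close> or \<open>p2\<close>.\<close>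

lemma (in endo) d_exceptional_primary:
  assumes fd: "finite_dimensional_vector_space scale B"
    and sp: "shifted_pair p y1 y2"
    and exc: "d_exceptional scale p ([:- y1, 1:] * [:- y2, 1:]) u"
  shows "\<exists>m n. E ((p \<circ>\<^sub>p [:y1, 1:]) ^ m * (p \<circ>\<^sub>p [:y2, 1:]) ^ n) v = 0"
proof -
  interpret shifted_pair p y1 y2 by (fact sp)
  interpret fd: finite_dimensional_vector_space scale B by (fact fd)
  obtain bs M where rep: "represents scale bs u M"
    using ex_represents[OF fd.finite_Basis fd.independent_Basis fd.span_Basis] by blast
  obtain f where f: "f \<noteq> 0" "E f v = 0"
    using ex_vector_annihilator[OF fd] by blast
  obtain m f1 where f1: "f = p1 ^ m * f1" "\<not> p1 dvd f1"
    using poly_split_prime_power[OF irreducible_p1 f(1)] by blast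
  have "f1 \<noteq> 0" using f1(2) by auto
  then obtain n g where g: "f1 = p2 ^ n * g" "\<not> p2 dvd g"
    using poly_split_prime_power[OF swap.irreducible_p1] by blast
  have cop: "coprime p1 g" "coprime p2 g"
    using irreducible_coprime_poly irreducible_p1 swap.irreducible_p1 f1(2) g by (metis dvd_mult)+
  have "E (p1 ^ m * p2 ^ n) v = 0"
  proof (rule ccontr)
    assume nz: "E (p1 ^ m * p2 ^ n) v \<noteq> 0"
    have "E g (E (p1 ^ m * p2 ^ n) v) = E f v"
      unfolding f1 g by (simp add: mult_ac flip: E_mult)
    then obtain x where x: "poly (map_poly to_ac g) x = 0" "ac_eigenvalue scale u x"
      using root_ac_eigenvalue[OF rep, of g] nz f(2) g(2) by auto
    then have "poly (map_poly to_ac p1) x = 0 \<or> poly (map_poly to_ac p2) x = 0"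
      using exc unfolding d_exceptional_def ac_roots_difference_iff by blast
    then show False
      using x(1) coprime_no_common_ac_root cop by blast
  qed
  then show ?thesis by blast
qed

lemma (in endo) d_exceptional_of_annihilator:
  assumes "\<And>v. E ((p \<circ>\<^sub>p [:y1, 1:]) ^ m * (p \<circ>\<^sub>p [:y2, 1:]) ^ n) v = 0"
  shows "d_exceptional scale p ([:- y1, 1:] * [:- y2, 1:]) u"
  unfolding d_exceptional_def ac_roots_difference_iff
  using ac_eigenvalue_root[OF _ assms] by (auto simp: poly_map_ac_mult poly_map_ac_power)

subsection \<open>Pairing the invariant factors\<close>

lemma ex_decreasing_enumeration:
  fixes h :: "nat \<Rightarrow> nat"
  shows "\<exists>\<pi>. bij_betw \<pi> {..<N} {..<N} \<and> (\<forall>i j. i \<le> j \<longrightarrow> j < N \<longrightarrow> h (\<pi> j) \<le> h (\<pi> i))"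
proof -
  \<comment> \<open>Sorting by the negated values puts the largest first.\<close>
  define xs where "xs = sort_key (\<lambda>j. - int (h j)) [0..<N]"
  have len: "length xs = N" and "distinct xs" "set xs = {..<N}"
    by (auto simp: xs_def)
  then have "bij_betw ((!) xs) {..<N} {..<N}"
    by (intro bij_betw_nth) simp_all
  moreover have "h (xs ! j) \<le> h (xs ! i)" if "i \<le> j" "j < N" for i j
  proof -
    have "sorted (map (\<lambda>j. - int (h j)) xs)"
      unfolding xs_def by (rule sorted_sort_key)
    then have "map (\<lambda>j. - int (h j)) xs ! i \<le> map (\<lambda>j. - int (h j)) xs ! j"
      using that len by (intro sorted_nth_mono) auto
    then show ?thesis
      using that len by simp
  qed
  ultimately show ?thesis by blast
qed

text \<open>Otherwise the \<open>k + 1\<close> indices that come first under \<open>\<pi>\<close>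
  all have a \<open>\<beta>\<close>-value above \<open>\<beta> (\<rho> k)\<close>, hence lie among
  the first \<open>k\<close> under \<open>\<rho>\<close>.\<close>

lemma decreasing_enumerations_close:
  fixes \<alpha> \<beta> :: "nat \<Rightarrow> nat"
  assumes \<pi>: "bij_betw \<pi> {..<N} {..<N}" "\<And>i j. i \<le> j \<Longrightarrow> j < N \<Longrightarrow> \<alpha> (\<pi> j) \<le> \<alpha> (\<pi> i)"
    and \<rho>: "bij_betw \<rho> {..<N} {..<N}" "\<And>i j. i \<le> j \<Longrightarrow> j < N \<Longrightarrow> \<beta> (\<rho> j) \<le> \<beta> (\<rho> i)"
    and le: "\<And>j. j < N \<Longrightarrow> \<alpha> j \<le> \<beta> j + 1" and k: "k < N"
  shows "\<alpha> (\<pi> k) \<le> \<beta> (\<rho> k) + 1"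
proof (rule ccontr)
  assume neg: "\<not> \<alpha> (\<pi> k) \<le> \<beta> (\<rho> k) + 1"
  have "\<pi> ` {..k} \<subseteq> \<rho> ` {..<k}"
  proof
    fix x assume "x \<in> \<pi> ` {..k}"
    then obtain i where i: "i \<le> k" "x = \<pi> i" by blast
    have x: "x < N"
      using bij_betwE[OF \<pi>(1)] i k by auto
    then obtain j where j: "j < N" "x = \<rho> j"
      using bij_betw_imp_surj_on[OF \<rho>(1)] by blast
    have "\<alpha> (\<pi> k) \<le> \<alpha> x"
      using \<pi>(2)[OF i(1) k] i(2) by simp
    then have "\<beta> (\<rho> k) < \<beta> x"
      using neg le[OF x] by linarith
    then have "\<not> k \<le> j"
      using \<rho>(2)[of k j] j by auto
    then show "x \<in> \<rho> ` {..<k}"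
      using j by simp
  qed
  then have "card (\<pi> ` {..k}) \<le> card (\<rho> ` {..<k})"
    by (intro card_mono) auto
  also have "\<dots> \<le> k"
    using card_image_le[of "{..<k}" \<rho>] by simp
  finally have "card (\<pi> ` {..k}) \<le> k" .
  moreover have "inj_on \<pi> {..k}"
    using bij_betw_imp_inj_on[OF \<pi>(1)] by (rule inj_on_subset) (use k in auto)
  ultimately show False
    by (simp add: card_image)
qed

section \<open>Irreducible divisors of a product of two prime powers\<close>

lemma irreducible_monic_dvd_eq:
  fixes d P :: "'a::field poly"
  assumes "Factorial_Ring.irreducible P" "lead_coeff P = 1" "\<not> is_unit d" "lead_coeff d = 1" "d dvd P"
  shows "d = P"
proof -
  obtain k where k: "P = d * k"
    using assms(5) ..
  then have "is_unit k"
    using assms(1,3) irreducibleD by blast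
  then obtain c where c: "k = [:c:]"
    using is_unit_polyE by blast
  have "lead_coeff k = 1"
    using assms(2,4) unfolding k by (simp add: lead_coeff_mult)
  then show ?thesis
    unfolding k c by (simp add: one_pCons)
qed

lemma irreducible_dvd_prime_powers:
  fixes d P Q :: "'a::field poly"
  assumes irr: "Factorial_Ring.irreducible d" "Factorial_Ring.irreducible P" "Factorial_Ring.irreducible Q"
    and monic: "lead_coeff d = 1" "lead_coeff P = 1" "lead_coeff Q = 1"
    and dvd: "d dvd P ^ m * Q ^ n"
  shows "d \<in> {P, Q}"
proof (rule ccontr)
  assume "d \<notin> {P, Q}"
  have nu: "\<not> is_unit d"
    using irr(1) unfolding Factorial_Ring.irreducible_def by blast
  then have "\<not> d dvd P" "\<not> d dvd Q"
    using \<open>d \<notin> {P, Q}\<close> irreducible_monic_dvd_eq irr monic by blast+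
  then have "coprime d (P ^ m * Q ^ n)"
    using irr(1) by (intro coprime_poly_mult_right coprime_poly_power_right irreducible_coprime_poly)
  then have "is_unit d"
    using dvd by (metis coprime_common_divisor dvd_refl)
  then show False
    using nu by blast
qed

lemma dvd_antisym_monic:
  fixes f g :: "'a::field poly"
  assumes "f dvd g" "g dvd f" "lead_coeff f = 1" "lead_coeff g = 1"
  shows "f = g"
  using assms poly_dvd_antisym by metis

lemma power_prod_dvd_mono:
  fixes P Q :: "'a::comm_semiring_1"
  shows "a \<le> a' \<Longrightarrow> b \<le> b' \<Longrightarrow> P ^ a * Q ^ b dvd P ^ a' * Q ^ b'"
  by (simp add: le_imp_power_dvd mult_dvd_mono)

section \<open>Paired companion blocks and the minimal polynomial\<close>

context endo
begin

text \<open>Nested block-diagonal matrices flatten, so \<open>represents_companions_iff\<close>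
  applies, with the blocks indexed by the pairs listed in \<open>ks\<close>.\<close>

lemma represents_pairs_iff:
  fixes F :: "'i \<Rightarrow> bool \<Rightarrow> 'a poly"
  assumes dist: "distinct js" and monic: "\<And>j t. j \<in> set js \<Longrightarrow> lead_coeff (F j t) = 1"
  shows "(\<exists>bs. represents scale bs u (diag_block_mat
      (map (\<lambda>j. diag_block_mat [companion (F j True), companion (F j False)]) js))) \<longleftrightarrow>
    (\<exists>z. cyclic_decomp (set js \<times> UNIV) z (\<lambda>(j, t). F j t))"
proof -
  define ks where "ks = concat (map (\<lambda>j. [(j, True), (j, False)]) js)"
  define fs where "fs = map (\<lambda>(j, t). F j t) ks"
  have set_ks: "set ks = set js \<times> UNIV"
    by (auto simp: ks_def)
  have dist_ks: "distinct ks"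
    using dist unfolding ks_def by (induction js) auto
  have bij: "bij_betw ((!) ks) {..<length fs} (set js \<times> UNIV)"
    unfolding set_ks[symmetric] fs_def by (rule bij_betw_nth[OF dist_ks]) auto
  have M: "diag_block_mat (map (\<lambda>j. diag_block_mat [companion (F j True), companion (F j False)]) js) =
      diag_block_mat (map companion fs)"
  proof -
    have "map companion fs = concat (map (\<lambda>j. [companion (F j True), companion (F j False)]) js)"
      unfolding fs_def ks_def by (simp add: map_concat o_def)
    then show ?thesis
      by (simp add: diag_block_mat_concat o_def del: diag_block_mat.simps)
  qed
  have "\<forall>f\<in>set fs. lead_coeff f = 1"
    unfolding fs_def using monic by (auto simp: set_ks)
  then have "(\<exists>bs. represents scale bs u (diag_block_mat (map companion fs))) \<longleftrightarrow>
      (\<exists>z. cyclic_decomp {..<length fs} z ((!) fs))"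
    by (rule represents_companions_iff)
  also have "\<dots> \<longleftrightarrow> (\<exists>z. cyclic_decomp (set js \<times> UNIV) z (\<lambda>(j, t). F j t))"
  proof
    assume "\<exists>z. cyclic_decomp {..<length fs} z ((!) fs)"
    then obtain z where z: "cyclic_decomp {..<length fs} z ((!) fs)" ..
    let ?h = "the_inv_into {..<length fs} ((!) ks)"
    have h: "bij_betw ?h (set js \<times> UNIV) {..<length fs}"
      by (rule bij_betw_the_inv_into[OF bij])
    have "fs ! ?h i = (case i of (j, t) \<Rightarrow> F j t)" if "i \<in> set js \<times> UNIV" for i
    proof -
      have "ks ! ?h i = i"
        using f_the_inv_into_f_bij_betw[OF bij] that by blast
      moreover have "?h i < length ks"
        using bij_betwE[OF h] that by (auto simp: fs_def)
      ultimately show ?thesis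
        by (simp add: fs_def)
    qed
    then have "cyclic_decomp (set js \<times> UNIV) (\<lambda>i. z (?h i)) (\<lambda>(j, t). F j t)"
      using cyclic_decomp_reindex[OF z h] by simp
    then show "\<exists>z. cyclic_decomp (set js \<times> UNIV) z (\<lambda>(j, t). F j t)"
      by (intro exI[of _ "\<lambda>i. z (?h i)"])
  next
    assume "\<exists>z. cyclic_decomp (set js \<times> UNIV) z (\<lambda>(j, t). F j t)"
    then obtain z where z: "cyclic_decomp (set js \<times> UNIV) z (\<lambda>(j, t). F j t)" ..
    have "cyclic_decomp {..<length fs} (\<lambda>k. z (ks ! k)) ((!) fs)"
      using cyclic_decomp_reindex[OF z bij] by (simp add: fs_def)
    then show "\<exists>z. cyclic_decomp {..<length fs} z ((!) fs)"
      by (intro exI[of _ "\<lambda>k. z (ks ! k)"])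
  qed
  finally show ?thesis
    unfolding M .
qed

text \<open>\<open>r 0\<close> is a multiple of every other order, so it kills every generator. For
  \<open>m = 0\<close> the space is zero and every polynomial annihilates, in accordance with
  \<open>r 0 = 1\<close>.\<close>

lemma annihilates_iff_dvd:
  fixes m :: nat
  assumes dec: "cyclic_decomp {..<m} z r"
    and chain: "\<And>i. i < m \<Longrightarrow> r i dvd r 0" and unit: "m = 0 \<Longrightarrow> r 0 = 1"
  shows "annihilates scale f u \<longleftrightarrow> r 0 dvd f"
proof
  assume ann: "annihilates scale f u"
  show "r 0 dvd f"
  proof (cases "m = 0")
    case False
    then show ?thesis
      using ann cyclic_decomp_order[OF dec, of 0 f] by (simp add: annihilates_def)
  qed (simp add: unit)
next
  assume dvd: "r 0 dvd f"
  show "annihilates scale f u"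
    unfolding annihilates_def
  proof
    fix v
    obtain g where v: "v = (\<Sum>i<m. E (g i) (z i))"
      using cyclic_decompD(2)[OF dec] by blast
    have "E f (E (g i) (z i)) = 0" if "i < m" for i
    proof -
      have "E f (z i) = 0"
        using cyclic_decomp_order[OF dec, of i f] chain[OF that] dvd that by (auto intro: dvd_trans)
      then show ?thesis
        by (metis E_0 E_mult_commute)
    qed
    then show "E f v = 0"
      unfolding v E_sum by simp
  qed
qed

lemma minimal_poly_eq:
  assumes "\<And>f. annihilates scale f u \<longleftrightarrow> m dvd f" "lead_coeff m = 1"
  shows "minimal_poly scale u = m"
  unfolding minimal_poly_def
proof (rule the_equality)
  show "lead_coeff m = 1 \<and> (\<forall>f. annihilates scale f u \<longleftrightarrow> m dvd f)"
    using assms by blast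
next
  fix m' assume m': "lead_coeff m' = 1 \<and> (\<forall>f. annihilates scale f u \<longleftrightarrow> m' dvd f)"
  have "m' dvd m" "m dvd m'"
    using m' assms(1) dvd_refl by blast+
  then show "m' = m"
    using m' assms(2) dvd_antisym_monic by blast
qed

end

theorem theorem3p15:
  fixes scale :: "'a::field \<Rightarrow> 'b::ab_group_add \<Rightarrow> 'b"
    and Basis :: "'b set"
    and u :: "'b \<Rightarrow> 'b"
    and p q :: "'a poly"
    and y1 y2 :: 'a
  assumes V: "finite_dimensional_vector_space scale Basis"
    and u: "Vector_Spaces.linear scale scale u"
    and p: "lead_coeff p = 1" "Polynomial.degree p = 2" "Factorial_Ring.irreducible p"
    and q: "lead_coeff q = 1" "Polynomial.degree q = 2"
    and q_splits: "q = [:- y1, 1:] * [:- y2, 1:]" "y1 \<noteq> y2"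
    and char2: "CHAR('a) = 2 \<Longrightarrow> poly_trace p \<noteq> poly_trace q"
  defines "p1 \<equiv> p \<circ>\<^sub>p [:y1, 1:]"
    and "p2 \<equiv> p \<circ>\<^sub>p [:y2, 1:]"
  defines "cond_i \<equiv> pq_difference scale p q u \<and> d_exceptional scale p q u"
    and "cond_ii \<equiv>
      (\<forall>d. Factorial_Ring.irreducible d \<and> lead_coeff d = 1 \<and> d dvd minimal_poly scale u
         \<longrightarrow> d \<in> {p1, p2}) \<and>
      (\<exists>r \<alpha> \<beta>. invariant_factors scale u r \<and>
         (\<forall>k. r k = p1 ^ \<alpha> k * p2 ^ \<beta> k) \<and>
         (\<forall>k. \<bar>int (\<alpha> k) - int (\<beta> k)\<bar> \<le> 1))"
    and "cond_iii \<equiv>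
      (\<exists>bs Bs. represents scale bs u (diag_block_mat Bs) \<and>
         (\<forall>B \<in> set Bs. \<exists>n>0.
            B = diag_block_mat [companion (p1 ^ n), companion (p2 ^ n)] \<or>
            B = diag_block_mat [companion (p1 ^ n), companion (p2 ^ (n - 1))] \<or>
            B = diag_block_mat [companion (p1 ^ (n - 1)), companion (p2 ^ n)]))"
  shows "(cond_i \<longleftrightarrow> cond_ii) \<and> (cond_ii \<longleftrightarrow> cond_iii)"
proof -
  interpret fd: finite_dimensional_vector_space scale Basis by (fact V)
  interpret endo scale u
    by (intro endo.intro endo_axioms.intro fd.vector_space_axioms u)
  have nondeg: "[:y1 + y2 - poly_trace p, 2:] \<noteq> 0"
  proof
    assume "[:y1 + y2 - poly_trace p, 2:] = 0"
    then have two: "(2::'a) = 0" and tr: "poly_trace p = y1 + y2"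
      by auto
    have "of_nat 2 = (0::'a)"
      using two by simp
    then have "CHAR('a) dvd 2"
      by (simp only: of_nat_eq_0_iff_char_dvd)
    then have "CHAR('a) = 2"
      using CHAR_not_1'[where ?'a = 'a] by (metis One_nat_def prime_nat_iff two_is_prime_nat)
    moreover have "poly_trace q = y1 + y2"
      by (simp add: poly_trace_def q_splits(1))
    ultimately show False
      using char2 tr by simp
  qed
  have sp: "shifted_pair p y1 y2"
    by unfold_locales (fact p q_splits nondeg)+
  interpret sp: shifted_pair p y1 y2 by (fact sp)
  note defs = p1_def p2_def
  have monic: "lead_coeff p1 = 1" "lead_coeff p2 = 1"
    unfolding defs using sp.monic_p1 sp.swap.monic_p1 by blast+
  have monic_pow: "lead_coeff (p1 ^ a) = 1" "lead_coeff (p2 ^ a) = 1" for a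
    using monic by (simp_all add: lead_coeff_power)
  have cop: "coprime p1 p2"
    unfolding defs by (rule sp.coprime_p1_p2)
  define F where "F \<alpha> \<beta> j t = (if t then p1 ^ \<alpha> j else p2 ^ \<beta> j)" for \<alpha> \<beta> :: "nat \<Rightarrow> nat" and j t
  have monic_F: "lead_coeff (F \<alpha> \<beta> j t) = 1" for \<alpha> \<beta> j t
    using monic_pow by (simp add: F_def)
  \<comment> \<open>The hub of the equivalences: (i) implies \<open>paired\<close>, which implies
    (ii) and (iii); (iii) implies it in turn, and (ii) leads back to (i).\<close>
  define paired where "paired \<longleftrightarrow> (\<exists>(N :: nat) z \<alpha> \<beta>. cyclic_decomp ({..<N} \<times> UNIV) z (\<lambda>(j, t). F \<alpha> \<beta> j t) \<and>
    (\<forall>j<N. \<bar>int (\<alpha> j) - int (\<beta> j)\<bar> \<le> 1))"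
  have i_paired: "paired" if A: "cond_i"
  proof -
    have "pq_difference scale p ([:- y1, 1:] * [:- y2, 1:]) u"
      and exc: "d_exceptional scale p ([:- y1, 1:] * [:- y2, 1:]) u"
      using A unfolding cond_i_def q_splits(1) by blast+
    then obtain w where "twisted scale u p y1 y2 w"
      using twisted_of_pq_difference[OF sp] by blast
    then interpret tw: twisted scale u p y1 y2 w .
    show ?thesis
      unfolding paired_def F_def defs
      by (rule tw.twisted_cyclic_decomp[OF fd.finite_Basis fd.span_Basis d_exceptional_primary[OF V sp exc]])
  qed
  have paired_iii: "cond_iii" if A: "paired"
  proof -
    obtain N z \<alpha> \<beta> where dec: "cyclic_decomp ({..<N::nat} \<times> UNIV) z (\<lambda>(j, t). F \<alpha> \<beta> j t)"
      and close: "\<forall>j<N. \<bar>int (\<alpha> j) - int (\<beta> j)\<bar> \<le> 1"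
      using A unfolding paired_def by blast
    \<comment> \<open>A pair with both exponents 0 is a zero summand and fits none of the three
      block shapes, which require \<open>n > 0\<close>; it is dropped.\<close>
    define js where "js = filter (\<lambda>j. \<alpha> j + \<beta> j \<noteq> 0) [0..<N]"
    have "cyclic_decomp (set js \<times> UNIV) z (\<lambda>(j, t). F \<alpha> \<beta> j t)"
    proof (rule cyclic_decomp_subset[OF dec])
      show "set js \<times> UNIV \<subseteq> {..<N} \<times> UNIV"
        by (auto simp: js_def)
      fix i assume i: "i \<in> {..<N} \<times> UNIV - set js \<times> (UNIV :: bool set)"
      obtain j t where jt: "i = (j, t)" by (cases i)
      then have "\<alpha> j = 0 \<and> \<beta> j = 0"
        using i by (simp add: js_def)
      then show "(case i of (j, t) \<Rightarrow> F \<alpha> \<beta> j t) = 1"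
        by (simp add: jt F_def)
    qed
    then obtain bs where rep: "represents scale bs u (diag_block_mat
        (map (\<lambda>j. diag_block_mat [companion (F \<alpha> \<beta> j True), companion (F \<alpha> \<beta> j False)]) js))"
      using represents_pairs_iff[of js "F \<alpha> \<beta>"] monic_F by (auto simp: js_def)
    have "\<exists>n>0. B = diag_block_mat [companion (p1 ^ n), companion (p2 ^ n)] \<or>
        B = diag_block_mat [companion (p1 ^ n), companion (p2 ^ (n - 1))] \<or>
        B = diag_block_mat [companion (p1 ^ (n - 1)), companion (p2 ^ n)]"
      if j: "j \<in> set js" and B: "B = diag_block_mat [companion (F \<alpha> \<beta> j True), companion (F \<alpha> \<beta> j False)]" for j B
    proof -
      have "\<bar>int (\<alpha> j) - int (\<beta> j)\<bar> \<le> 1" "\<alpha> j + \<beta> j \<noteq> 0"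
        using j close by (auto simp: js_def)
      then consider "\<alpha> j = \<beta> j" "\<alpha> j > 0" | "\<beta> j = \<alpha> j - 1" "\<alpha> j > 0" | "\<alpha> j = \<beta> j - 1" "\<beta> j > 0"
        by linarith
      then show ?thesis
        unfolding B F_def by cases auto
    qed
    then show ?thesis
      unfolding cond_iii_def using rep by (intro exI conjI) auto
  qed
  have iii_paired: "paired" if A: "cond_iii"
  proof -
    obtain bs Bs where rep: "represents scale bs u (diag_block_mat Bs)"
      and Bs: "\<forall>B \<in> set Bs. \<exists>n>0.
            B = diag_block_mat [companion (p1 ^ n), companion (p2 ^ n)] \<or>
            B = diag_block_mat [companion (p1 ^ n), companion (p2 ^ (n - 1))] \<or>
            B = diag_block_mat [companion (p1 ^ (n - 1)), companion (p2 ^ n)]"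
      using A unfolding cond_iii_def by blast
    have "\<exists>a b. B = diag_block_mat [companion (p1 ^ a), companion (p2 ^ b)] \<and> \<bar>int a - int b\<bar> \<le> 1"
      if B: "B \<in> set Bs" for B
    proof -
      obtain n where n: "n > 0" "B = diag_block_mat [companion (p1 ^ n), companion (p2 ^ n)] \<or>
            B = diag_block_mat [companion (p1 ^ n), companion (p2 ^ (n - 1))] \<or>
            B = diag_block_mat [companion (p1 ^ (n - 1)), companion (p2 ^ n)]"
        using Bs B by blast
      have "\<bar>int n - int n\<bar> \<le> 1" "\<bar>int n - int (n - 1)\<bar> \<le> 1" "\<bar>int (n - 1) - int n\<bar> \<le> 1"
        using n(1) by auto
      then show ?thesis
        using n(2) by blast
    qed
    then have "\<forall>j. \<exists>a b. j < length Bs \<longrightarrow>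
        Bs ! j = diag_block_mat [companion (p1 ^ a), companion (p2 ^ b)] \<and> \<bar>int a - int b\<bar> \<le> 1"
      using nth_mem by blast
    then obtain \<alpha> \<beta> where \<alpha>\<beta>: "\<And>j. j < length Bs \<Longrightarrow>
        Bs ! j = diag_block_mat [companion (p1 ^ \<alpha> j), companion (p2 ^ \<beta> j)] \<and> \<bar>int (\<alpha> j) - int (\<beta> j)\<bar> \<le> 1"
      by metis
    have "Bs = map (\<lambda>j. diag_block_mat [companion (F \<alpha> \<beta> j True), companion (F \<alpha> \<beta> j False)]) [0..<length Bs]"
      by (rule nth_equalityI) (use \<alpha>\<beta> in \<open>auto simp: F_def\<close>)
    then have "\<exists>bs. represents scale bs u (diag_block_mat
        (map (\<lambda>j. diag_block_mat [companion (F \<alpha> \<beta> j True), companion (F \<alpha> \<beta> j False)]) [0..<length Bs]))"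
      using rep by auto
    then obtain z where "cyclic_decomp (set [0..<length Bs] \<times> UNIV) z (\<lambda>(j, t). F \<alpha> \<beta> j t)"
      using represents_pairs_iff[of "[0..<length Bs]" "F \<alpha> \<beta>"] monic_F by auto
    then have "cyclic_decomp ({..<length Bs} \<times> UNIV) z (\<lambda>(j, t). F \<alpha> \<beta> j t)"
      by (simp add: atLeast_upt)
    then show ?thesis
      unfolding paired_def using \<alpha>\<beta> by blast
  qed
  have paired_ii: "cond_ii" if A: "paired"
  proof -
    obtain N z \<alpha> \<beta> where dec: "cyclic_decomp ({..<N::nat} \<times> UNIV) z (\<lambda>(j, t). F \<alpha> \<beta> j t)"
      and close: "\<And>j. j < N \<Longrightarrow> \<bar>int (\<alpha> j) - int (\<beta> j)\<bar> \<le> 1"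
      using A unfolding paired_def by blast
    obtain \<pi> where \<pi>: "bij_betw \<pi> {..<N} {..<N}" "\<And>i j. i \<le> j \<Longrightarrow> j < N \<Longrightarrow> \<alpha> (\<pi> j) \<le> \<alpha> (\<pi> i)"
      using ex_decreasing_enumeration[of N \<alpha>] by blast
    obtain \<rho> where \<rho>: "bij_betw \<rho> {..<N} {..<N}" "\<And>i j. i \<le> j \<Longrightarrow> j < N \<Longrightarrow> \<beta> (\<rho> j) \<le> \<beta> (\<rho> i)"
      using ex_decreasing_enumeration[of N \<beta>] by blast
    \<comment> \<open>The exponents of each prime are sorted separately and padded with 0, so that
      \<open>r k = 1\<close> from \<open>N\<close> on.\<close>
    define a where "a k = (if k < N then \<alpha> (\<pi> k) else 0)" for k
    define b where "b k = (if k < N then \<beta> (\<rho> k) else 0)" for k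
    define r where "r k = p1 ^ a k * p2 ^ b k" for k
    have ab: "\<bar>int (a k) - int (b k)\<bar> \<le> 1" for k
    proof (cases "k < N")
      case True
      have "\<alpha> j \<le> \<beta> j + 1" "\<beta> j \<le> \<alpha> j + 1" if "j < N" for j
        using close[OF that] by linarith+
      then have "\<alpha> (\<pi> k) \<le> \<beta> (\<rho> k) + 1" "\<beta> (\<rho> k) \<le> \<alpha> (\<pi> k) + 1"
        using decreasing_enumerations_close[of \<pi> N \<alpha> \<rho> \<beta> k] decreasing_enumerations_close[of \<rho> N \<beta> \<pi> \<alpha> k] \<pi> \<rho> True
        by blast+
      then show ?thesis
        using True by (simp add: a_def b_def)
    qed (simp add: a_def b_def)
    \<comment> \<open>Regroups the cyclic modules by rank among the powers of the same prime instead
      of by their original pair.\<close>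
    define h where "h = (\<lambda>(k, t). (if t then \<pi> k else \<rho> k, t))"
    have "bij_betw h ({..<N} \<times> UNIV) ({..<N} \<times> UNIV)"
    proof (rule bij_betw_imageI)
      show "inj_on h ({..<N} \<times> UNIV)"
        using bij_betw_imp_inj_on[OF \<pi>(1)] bij_betw_imp_inj_on[OF \<rho>(1)]
        by (auto simp: inj_on_def h_def)
      show "h ` ({..<N} \<times> UNIV) = {..<N} \<times> UNIV"
      proof (rule card_subset_eq)
        show "h ` ({..<N} \<times> UNIV) \<subseteq> {..<N} \<times> UNIV"
          using bij_betwE[OF \<pi>(1)] bij_betwE[OF \<rho>(1)] by (auto simp: h_def)
        show "card (h ` ({..<N} \<times> UNIV)) = card ({..<N} \<times> (UNIV :: bool set))"
          using \<open>inj_on h ({..<N} \<times> UNIV)\<close> by (rule card_image)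
      qed simp
    qed
    then have "cyclic_decomp ({..<N} \<times> UNIV) (\<lambda>i. z (h i)) (\<lambda>(k, t). F a b k t)"
      by (rule cyclic_decomp_reindex[OF dec]) (auto simp: h_def F_def a_def b_def)
    \<comment> \<open>The \<open>k\<close>-th largest powers of \<open>p1\<close> and
      \<open>p2\<close> are merged into one cyclic module of order \<open>r k\<close>.\<close>
    then have "cyclic_decomp {..<N} (\<lambda>k. z (h (k, True)) + z (h (k, False)))
        (\<lambda>k. (\<lambda>(k, t). F a b k t) (k, True) * (\<lambda>(k, t). F a b k t) (k, False))"
      by (rule cyclic_decomp_combine) (simp add: F_def coprime_poly_power[OF cop])
    then have dec': "cyclic_decomp {..<N} (\<lambda>k. z (h (k, True)) + z (h (k, False))) r"
      by (simp add: F_def r_def[abs_def])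
    have chain: "r j dvd r i" if "i \<le> j" for i j
      unfolding r_def by (rule power_prod_dvd_mono) (use \<pi>(2) \<rho>(2) that in \<open>auto simp: a_def b_def\<close>)
    have monic_r: "lead_coeff (r k) = 1" for k
      using monic_pow by (simp add: r_def lead_coeff_mult)
    have "cyclic_decomp {..<length (map r [0..<N])} (\<lambda>k. z (h (k, True)) + z (h (k, False))) ((!) (map r [0..<N]))"
      by (rule cyclic_decomp_reindex[OF dec', of id]) auto
    then obtain bs where "represents scale bs u (diag_block_mat (map companion (map r [0..<N])))"
      using represents_companions_iff[of "map r [0..<N]"] monic_r by auto
    then have "represents scale bs u (diag_block_mat (map (\<lambda>i. companion (r i)) [0..<N]))"
      by (simp add: o_def)
    moreover have "\<forall>i\<ge>N. r i = 1"
      by (simp add: r_def a_def b_def)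
    ultimately have inv: "invariant_factors scale u r"
      unfolding invariant_factors_def using monic_r chain by (metis le_add2 plus_1_eq_Suc)
    have "annihilates scale f u \<longleftrightarrow> r 0 dvd f" for f
      by (rule annihilates_iff_dvd[OF dec']) (simp_all add: chain, simp add: r_def a_def b_def)
    then have "minimal_poly scale u = r 0"
      using monic_r by (intro minimal_poly_eq) auto
    then have "\<forall>d. Factorial_Ring.irreducible d \<and> lead_coeff d = 1 \<and> d dvd minimal_poly scale u
         \<longrightarrow> d \<in> {p1, p2}"
      using irreducible_dvd_prime_powers[of _ p1 p2 "a 0" "b 0"] monic sp.irreducible_p1 sp.swap.irreducible_p1
      unfolding r_def defs by metis
    then show ?thesis
      unfolding cond_ii_def using inv ab r_def by blast
  qed
  have ii_i: "cond_i" if A: "cond_ii"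
  proof -
    obtain r \<alpha> \<beta> where inv: "invariant_factors scale u r" and r: "\<And>k. r k = p1 ^ \<alpha> k * p2 ^ \<beta> k"
      and close: "\<And>k. \<bar>int (\<alpha> k) - int (\<beta> k)\<bar> \<le> 1"
      using A unfolding cond_ii_def by blast
    obtain m bs where chain: "\<And>i. r (Suc i) dvd r i" and one: "\<And>i. i \<ge> m \<Longrightarrow> r i = 1"
      and rep: "represents scale bs u (diag_block_mat (map (\<lambda>i. companion (r i)) [0..<m]))"
      and monic_r: "\<And>i. lead_coeff (r i) = 1"
      using inv unfolding invariant_factors_def by blast
    have "represents scale bs u (diag_block_mat (map companion (map r [0..<m])))"
      using rep by (simp add: o_def)
    then obtain z where z: "cyclic_decomp {..<length (map r [0..<m])} z ((!) (map r [0..<m]))"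
      using represents_companions_iff[of "map r [0..<m]"] monic_r by auto
    have dec: "cyclic_decomp {..<m} z r"
      by (rule cyclic_decomp_reindex[OF z, of id]) auto
    \<comment> \<open>The invariant factors themselves have exponents differing by at most 1, so the
      difference is built directly on their cyclic modules.\<close>
    have "pq_difference scale p q u"
      unfolding q_splits(1)
      by (rule pq_difference_of_cyclic_decomp[OF sp, of "{..<m}" z \<alpha> \<beta>])
        (use dec close in \<open>simp_all add: r[abs_def] defs\<close>)
    moreover have "d_exceptional scale p q u"
    proof -
      \<comment> \<open>Every invariant factor divides \<open>r 0\<close>, so \<open>r 0\<close>
        annihilates the space and every eigenvalue is a root of it.\<close>
      have "r i dvd r 0" for i
        by (induction i) (auto intro: dvd_trans chain)
      then have "annihilates scale (r 0) u"
        using annihilates_iff_dvd[OF dec, of "r 0"] one by auto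
      then have "E (p1 ^ \<alpha> 0 * p2 ^ \<beta> 0) v = 0" for v
        by (simp add: annihilates_def r)
      then show ?thesis
        unfolding q_splits(1) defs by (rule d_exceptional_of_annihilator)
    qed
    ultimately show ?thesis
      unfolding cond_i_def ..
  qed
  show ?thesis
    using i_paired paired_iii iii_paired paired_ii ii_i by blast
qed

end
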